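(* Let $e>1$, let $f,m\in R[x]$ be monic with $1\le\deg(f)<\deg(m)$, and let $\pi_e(m)=m_1m_2$ with $m_1,m_2\in R_e[x]$ be an $f$-decomposition of $m$ in $R_e[x]$. Let $g_1,\dots,g_r\in R_e[x]$ be pairwise coprime polynomials with $m_1=g_1g_2\cdots g_r$ and $\bar g_i=G_i^{k_i}$, where $G_i\in R_1[x]$ is irreducible and $k_i\ge1$ $(1\le i\le r)$. Define $$\mathcal{H}:=\bigodot_{i=1}^r\{1,\mathcal{O}_e(f,g_i)\}.$$ Then $\mathcal{L}(\Gamma_e(f,m))=\mathcal{L}(\Gamma_{e-1}(f,m))\cup\mathcal{H}$.
   Context: Let $p$ be a prime, $h\in\mathbb{Z}[t]$ monic of degree $d\ge1$ and irreducible modulo $p$, $q=p^d$, and $R=\mathbb{Z}[t]/\langle h\rangle$. For $e\ge1$ let $R_e=R/\langle p^e\rangle$, $R_1=\mathbb{F}_q$; $\pi_e$ denotes reduction mod $p^e$ on $R$ and (coefficientwise) on $R[x]$, and $\bar z$ denotes reduction mod $p$ of polynomials over $R$ or $R_e$. Two polynomials are coprime in $R_e[x]$ if together they generate the unit ideal. An $f$-decomposition $\pi_e(m)=m_1m_2$ in $R_e[x]$ means: $\pi_e(f)$ is coprime with $m_1$, and some power of $\pi_e(f)$ lies in $m_2R_e[x]$. $\Gamma_e(f,g)$ is the map $R_e[x]/\langle g\rangle\to R_e[x]/\langle g\rangle$, $z\mapsto fz$ (with $f,g$ reduced mod $p^e$). For a self-map $\Gamma$ of a finite set $X$ and $x\in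 X$, let $\tau\ge0$ and $\ell\ge1$ be the least integers with $\Gamma^{\tau+\ell}(x)=\Gamma^\tau(x)$; $\mathrm{per}(\Gamma,x):=\ell$. The set of cycle lengths is $\mathcal{L}(\Gamma)=\{\mathrm{per}(\Gamma,x):x\in X\}$. $\mathcal{O}_e(f,g)$ is the smallest positive integer $k$ with $f^k\equiv1\pmod g$ in $R_e[x]$ (for $f,g$ coprime in $R_e[x]$). For sets of positive integers, $\mathcal{X}\odot\mathcal{Y}=\{\mathrm{lcm}(x,y):x\in\mathcal{X},y\in\mathcal{Y}\}$, and $\bigodot$ denotes the iterated product. *)

theory Defs
  imports "HOL-Algebra.Algebra"
begin

section \<open>Polynomials over an arbitrary ring\<close>

definition up_monic :: "('a, 'b) ring_scheme \<Rightarrow> (nat \<Rightarrow> 'a) \<Rightarrow> bool" where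
  "up_monic R f \<longleftrightarrow> f \<in> carrier (UP R) \<and> coeff (UP R) f (deg R f) = \<one>\<^bsub>R\<^esub>"

text \<open>
  An element of \<^term>\<open>UP R\<close> is its own coefficient function, so applying a map coefficientwise
  is just composition.
\<close>

definition up_map :: "('a \<Rightarrow> 'b) \<Rightarrow> (nat \<Rightarrow> 'a) \<Rightarrow> (nat \<Rightarrow> 'b)" where
  "up_map \<phi> f = (\<lambda>n. \<phi> (f n))"

section \<open>Ring-theoretic notions\<close>

definition gen_coprime :: "('a, 'b) ring_scheme \<Rightarrow> 'a \<Rightarrow> 'a \<Rightarrow> bool" where
  "gen_coprime A a b \<longleftrightarrow> Idl\<^bsub>A\<^esub> {a, b} = carrier A"

definition is_decomposition ::
  "('a, 'b) ring_scheme \<Rightarrow> 'a \<Rightarrow> 'a \<Rightarrow> 'a \<Rightarrow> 'a \<Rightarrow> bool" where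
  "is_decomposition A f m m1 m2 \<longleftrightarrow>
     m1 \<in> carrier A \<and> m2 \<in> carrier A \<and> m = m1 \<otimes>\<^bsub>A\<^esub> m2 \<and>
     gen_coprime A f m1 \<and> (\<exists>n::nat. f [^]\<^bsub>A\<^esub> n \<in> PIdl\<^bsub>A\<^esub> m2)"

definition mod_order :: "('a, 'b) ring_scheme \<Rightarrow> 'a \<Rightarrow> 'a \<Rightarrow> nat" where
  "mod_order A f g = (LEAST k. 0 < k \<and> f [^]\<^bsub>A\<^esub> k \<ominus>\<^bsub>A\<^esub> \<one>\<^bsub>A\<^esub> \<in> PIdl\<^bsub>A\<^esub> g)"

definition quot_by :: "('a, 'b) ring_scheme \<Rightarrow> 'a \<Rightarrow> 'a set ring" where
  "quot_by A g = A Quot (PIdl\<^bsub>A\<^esub> g)"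

definition mult_map :: "('a, 'b) ring_scheme \<Rightarrow> 'a \<Rightarrow> 'a \<Rightarrow> 'a set \<Rightarrow> 'a set" where
  "mult_map A f g z = (PIdl\<^bsub>A\<^esub> g +>\<^bsub>A\<^esub> f) \<otimes>\<^bsub>quot_by A g\<^esub> z"

section \<open>Eventual periods of self-maps\<close>

definition preperiod :: "('a \<Rightarrow> 'a) \<Rightarrow> 'a \<Rightarrow> nat" where
  "preperiod \<Gamma> x = (LEAST t. \<exists>l>0. (\<Gamma> ^^ (t + l)) x = (\<Gamma> ^^ t) x)"

definition per :: "('a \<Rightarrow> 'a) \<Rightarrow> 'a \<Rightarrow> nat" where
  "per \<Gamma> x = (LEAST l. 0 < l \<and> (\<Gamma> ^^ (preperiod \<Gamma> x + l)) x = (\<Gamma> ^^ preperiod \<Gamma> x) x)"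

definition cycle_lengths :: "('a \<Rightarrow> 'a) \<Rightarrow> 'a set \<Rightarrow> nat set" where
  "cycle_lengths \<Gamma> S = per \<Gamma> ` S"

definition lcm_prod :: "nat set \<Rightarrow> nat set \<Rightarrow> nat set" where
  "lcm_prod S T = {lcm x y |x y. x \<in> S \<and> y \<in> T}"

text \<open>Iterated product of \<open>S 1, \<dots>, S r\<close>; the empty product is the neutral element \<open>{1}\<close>.\<close>

primrec big_lcm_prod :: "(nat \<Rightarrow> nat set) \<Rightarrow> nat \<Rightarrow> nat set" where
  "big_lcm_prod S 0 = {1}"
| "big_lcm_prod S (Suc r) = lcm_prod (big_lcm_prod S r) (S (Suc r))"

section \<open>The rings \<open>R = \<int>[t]/\<langle>h\<rangle>\<close> and \<open>R\<^sub>e = R/\<langle>p\<^sup>e\<rangle>\<close>\<close>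

definition irreducible_mod :: "nat \<Rightarrow> (nat \<Rightarrow> int) \<Rightarrow> bool" where
  "irreducible_mod p h \<longleftrightarrow>
     ring_irreducible\<^bsub>UP (ZFact (int p))\<^esub> (up_map (ZMod (int p)) h)"

definition base_ring :: "(nat \<Rightarrow> int) \<Rightarrow> (nat \<Rightarrow> int) set ring" where
  "base_ring h = quot_by (UP \<Z>) h"

definition p_ideal :: "nat \<Rightarrow> (nat \<Rightarrow> int) \<Rightarrow> nat \<Rightarrow> (nat \<Rightarrow> int) set set" where
  "p_ideal p h e = PIdl\<^bsub>base_ring h\<^esub> (add_pow (base_ring h) (p ^ e) \<one>\<^bsub>base_ring h\<^esub>)"

definition level_ring :: "nat \<Rightarrow> (nat \<Rightarrow> int) \<Rightarrow> nat \<Rightarrow> (nat \<Rightarrow> int) set set ring" where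
  "level_ring p h e = base_ring h Quot p_ideal p h e"

definition proj :: "nat \<Rightarrow> (nat \<Rightarrow> int) \<Rightarrow> nat \<Rightarrow> (nat \<Rightarrow> int) set \<Rightarrow> (nat \<Rightarrow> int) set set" where
  "proj p h e a = p_ideal p h e +>\<^bsub>base_ring h\<^esub> a"

text \<open>
  Reduction modulo \<open>p\<close> from \<open>R\<^sub>e\<close> (with \<open>e \<ge> 1\<close>) to \<open>R\<^sub>1\<close>: since \<open>p\<^sup>e R \<subseteq> p R\<close>, adding \<open>p R\<close> to the
  coset \<open>a + p\<^sup>e R\<close> gives the coset \<open>a + p R\<close>.
\<close>

definition bar :: "nat \<Rightarrow> (nat \<Rightarrow> int) \<Rightarrow> (nat \<Rightarrow> int) set set \<Rightarrow> (nat \<Rightarrow> int) set set" where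
  "bar p h c = p_ideal p h 1 <+>\<^bsub>base_ring h\<^esub> c"

abbreviation level_poly ::
  "nat \<Rightarrow> (nat \<Rightarrow> int) \<Rightarrow> nat \<Rightarrow> ((nat \<Rightarrow> int) set set, nat \<Rightarrow> (nat \<Rightarrow> int) set set) up_ring" where
  "level_poly p h e \<equiv> UP (level_ring p h e)"

text \<open>The set of cycle lengths of \<open>\<Gamma>\<^sub>e(f, g)\<close>, for \<open>f\<close> and \<open>g\<close> in \<open>R[x]\<close>.\<close>

definition Gamma_cycle_lengths ::
  "nat \<Rightarrow> (nat \<Rightarrow> int) \<Rightarrow> nat \<Rightarrow> (nat \<Rightarrow> (nat \<Rightarrow> int) set) \<Rightarrow> (nat \<Rightarrow> (nat \<Rightarrow> int) set) \<Rightarrow> nat set" where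
  "Gamma_cycle_lengths p h e f g =
     cycle_lengths
       (mult_map (level_poly p h e) (up_map (proj p h e) f) (up_map (proj p h e) g))
       (carrier (quot_by (level_poly p h e) (up_map (proj p h e) g)))"

end

theory Submission
  imports Defs
begin

text \<open>
  Write \<open>A = R\<^sub>e[x]\<close>. The class of \<open>z\<close> in \<open>A/(m)\<close> eventually returns after \<open>l\<close> steps iff
  \<open>(f\<^sup>l - 1) z\<close> lies in every ideal \<open>(g i)\<close>, since \<open>f\<close> is invertible modulo \<open>m1\<close> and nilpotent
  modulo \<open>m2\<close> (\<open>returns_iff\<close>). So the period of \<open>z\<close> is the least common multiple of its periods
  in the factors \<open>A/(g i)\<close>, and by the Chinese remainder theorem the components of \<open>z\<close> can be
  chosen independently.

  Each factor is a local ring whose maximal ideal \<open>M\<close>, generated by \<open>p\<close> and a lift of \<open>G i\<close>, is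
  nilpotent. Let \<open>n i\<close> be the order of \<open>f\<close> in the finite residue field; it is prime to \<open>p\<close>. The zero
  element has period 1. The period of a nonzero element is \<open>n i p\<^sup>j\<close> for some \<open>j\<close>
  (\<open>fixing_iff_ladder\<close>): it is a multiple of \<open>n i\<close> as only elements of \<open>M\<close> annihilate nonzero
  elements, and for \<open>v\<close> in \<open>1 + M\<close> the identity \<open>v\<^sup>p - 1 = (v - 1) (p + (v - 1) T)\<close> shows that one
  factor \<open>p\<close> in the exponent gains one factor from \<open>M\<close>. The same identity excludes gaps: if \<open>n i p\<^sup>j\<close>
  occurs, then so do all smaller periods in the chain, already among the multiples of the given
  element (\<open>level_attained\<close>).

  Multiplication by \<open>p\<close> embeds \<open>R\<^sub>e\<^sub>-\<^sub>1[x]/(m)\<close> into \<open>A/(m)\<close>, because \<open>m\<close> is nonzero modulo \<open>p\<close> and \<open>p\<close> is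
  regular in \<open>R\<close>. Therefore the cycle lengths at level \<open>e - 1\<close> are the periods of the multiples
  of \<open>p\<close> at level \<open>e\<close> (\<open>\<rho>_mem_iff\<close>, \<open>cycle_lengths_via_quotient\<close>).

  Number the chain \<open>1, n i, n i p, \<dots>\<close> by 0, 1, 2, \<open>\<dots>\<close>, and let \<open>C i\<close> and \<open>C' i\<close> be the positions of the
  periods of the classes of 1 and of \<open>p\<close> in \<open>A/(g i)\<close>. The period of 1 is the order of \<open>f\<close> modulo
  \<open>g i\<close>. The three sets in the theorem are then the sets of least common multiples over all
  positions \<open>c i \<le> C i\<close>, over all \<open>c i \<le> C' i\<close>, and over all \<open>c i \<in> {0, C i}\<close>. If \<open>f\<^sup>l\<close> fixes \<open>p\<close>, then
  \<open>f\<^sup>p\<^sup>l\<close> fixes 1, so that \<open>1 \<le> C' i \<le> C i \<le> C' i + 1\<close> (\<open>level_one_le\<close>, which needs \<open>e > 1\<close>). Since the \<open>n i\<close>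
  are prime to \<open>p\<close>, a least common multiple depends only on the support of \<open>c\<close> and on the largest
  \<open>c i\<close>, and the asserted equality becomes a statement about bounded families of natural numbers
  (\<open>ladder_lcms_decomposition\<close>).
\<close>

section \<open>Eventual periods\<close>

lemma funpow_fixed_multiple:
  assumes "(F ^^ l) y = y"
  shows "(F ^^ (s * l)) y = y"
  using assms by (induction s) (simp_all add: funpow_add)

text \<open>
  The period is measured from the preperiod on, while \<open>iff\<close> allows any starting time: a return
  from a later point of the orbit can be moved back, because the point reached after the
  preperiod recurs at arbitrarily late times.
\<close>

lemma per_eqI:
  assumes N: "0 < N"
    and iff: "\<And>l. (\<exists>t. (F ^^ (t + l)) x = (F ^^ t) x) \<longleftrightarrow> N dvd l"
  shows "per F x = N"
proof -
  let ?t = "preperiod F x"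
  have "\<exists>t. \<exists>l>0. (F ^^ (t + l)) x = (F ^^ t) x"
    using iff[of N] N by auto
  then have "\<exists>l>0. (F ^^ (?t + l)) x = (F ^^ ?t) x"
    unfolding preperiod_def by (rule LeastI_ex)
  then obtain L where L: "L > 0" "(F ^^ L) ((F ^^ ?t) x) = (F ^^ ?t) x"
    by (auto simp: funpow_add add.commute)
  have returns: "(F ^^ (?t + l)) x = (F ^^ ?t) x \<longleftrightarrow> N dvd l" for l
  proof
    assume "N dvd l"
    then obtain t where t: "(F ^^ (t + l)) x = (F ^^ t) x"
      using iff by blast
    \<comment> \<open>The point reached after the preperiod comes back after \<open>t * L \<ge> t\<close> further steps.\<close>
    define s where "s = ?t + t * L - t"
    have s: "?t + t * L = s + t" 
    proof -
      have "t \<le> t * L" using L(1) by simp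
      then show ?thesis unfolding s_def by linarith
    qed
    have again: "(F ^^ (?t + t * L)) x = (F ^^ ?t) x"
      using funpow_fixed_multiple[OF L(2), of t] by (simp add: funpow_add add.commute[of ?t])
    have "(F ^^ (?t + l)) x = (F ^^ l) ((F ^^ (?t + t * L)) x)"
      unfolding again by (simp add: funpow_add add.commute[of ?t])
    also have "\<dots> = (F ^^ (s + (t + l))) x"
    proof -
      have "s + (t + l) = l + (?t + t * L)" using s by simp
      then show ?thesis by (simp only: funpow_add comp_apply)
    qed
    also have "\<dots> = (F ^^ (s + t)) x"
      using t by (simp only: funpow_add[of s] comp_apply)
    also have "\<dots> = (F ^^ ?t) x"
      using again s by simp
    finally show "(F ^^ (?t + l)) x = (F ^^ ?t) x" .
  qed (use iff in blast)
  show ?thesis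
    unfolding per_def returns using N by (intro Least_equality) (auto dest: dvd_imp_le)
qed

section \<open>Least common multiples of numbers \<open>n p\<^sup>j\<close>\<close>

text \<open>
  The candidates for a period in one local factor: the zero element has period 1, and
  \<open>n, n p, n p\<^sup>2, \<dots>\<close> are the periods of nonzero elements. Shifting the exponent by one leaves index 0
  to the zero element.
\<close>

definition ladder :: "nat \<Rightarrow> nat \<Rightarrow> nat \<Rightarrow> nat" where
  "ladder p n c = (if c = 0 then 1 else n * p ^ (c - 1))"

lemma ladder_0 [simp]: "ladder p n 0 = 1"
  and ladder_Suc [simp]: "ladder p n (Suc c) = n * p ^ c"
  by (simp_all add: ladder_def)

text \<open>
  The numbers \<open>n i\<close> are prime to \<open>p\<close>, so the least common multiple splits into a part that depends
  only on the set of indices with \<open>c i > 0\<close> and a power of \<open>p\<close> that depends only on the largest \<open>c i\<close>.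
\<close>

lemma Lcm_ladder_dvd:
  assumes cop: "\<And>i. i \<in> I \<Longrightarrow> coprime (n i) p"
    and supp: "\<And>i. i \<in> I \<Longrightarrow> c i > 0 \<Longrightarrow> c' i > 0"
    and top: "\<And>i. i \<in> I \<Longrightarrow> \<exists>j\<in>I. c i \<le> c' j"
  shows "(LCM i\<in>I. ladder p (n i) (c i)) dvd (LCM i\<in>I. ladder p (n i) (c' i))"
proof (rule Lcm_least, clarify)
  fix i assume i: "i \<in> I"
  let ?L = "LCM i\<in>I. ladder p (n i) (c' i)"
  have dvdL: "ladder p (n j) (c' j) dvd ?L" if "j \<in> I" for j
    using that by (intro dvd_Lcm) auto
  show "ladder p (n i) (c i) dvd ?L"
  proof (cases "c i")
    case (Suc a)
    then obtain b where b: "c' i = Suc b"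
      using supp[OF i] by (auto simp: gr0_conv_Suc)
    have "n i dvd ?L"
      using dvdL[OF i] unfolding b ladder_Suc by (rule dvd_mult_left)
    obtain j where j: "j \<in> I" "Suc a \<le> c' j"
      using top[OF i] Suc by auto
    then obtain b' where b': "c' j = Suc b'" "a \<le> b'"
      by (cases "c' j") auto
    have "p ^ a dvd n j * p ^ b'"
      using b'(2) by (intro dvd_mult le_imp_power_dvd)
    then have "p ^ a dvd ?L"
      using dvdL[OF j(1)] unfolding b'(1) ladder_Suc by (rule dvd_trans)
    then show ?thesis
      using Suc cop[OF i] \<open>n i dvd ?L\<close> by (simp add: divides_mult)
  qed simp
qed

lemma Lcm_ladder_cong:
  assumes "\<And>i. i \<in> I \<Longrightarrow> coprime (n i) p"
    and "\<And>i. i \<in> I \<Longrightarrow> c i > 0 \<longleftrightarrow> c' i > 0"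
    and "\<And>i. i \<in> I \<Longrightarrow> \<exists>j\<in>I. c i \<le> c' j"
    and "\<And>i. i \<in> I \<Longrightarrow> \<exists>j\<in>I. c' i \<le> c j"
  shows "(LCM i\<in>I. ladder p (n i) (c i)) = (LCM i\<in>I. ladder p (n i) (c' i))"
proof (rule dvd_antisym)
  show "(LCM i\<in>I. ladder p (n i) (c i)) dvd (LCM i\<in>I. ladder p (n i) (c' i))"
    by (rule Lcm_ladder_dvd) (use assms in blast)+
  show "(LCM i\<in>I. ladder p (n i) (c' i)) dvd (LCM i\<in>I. ladder p (n i) (c i))"
    by (rule Lcm_ladder_dvd) (use assms in blast)+
qed

text \<open>
  The least common multiple only remembers the support of \<open>c\<close> and its maximum \<open>\<mu>\<close>. If some index of the
  support admits \<open>\<mu>\<close> under the bound \<open>C'\<close>, the exponent \<open>\<mu>\<close> can be moved there, and 1 is enough elsewhere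
  on the support. If none does, then \<open>C\<close>, exceeding \<open>C'\<close> by at most one, is itself at most \<open>\<mu>\<close> on the
  support and reaches \<open>\<mu>\<close>, so that \<open>c\<close> can be raised to \<open>C\<close> on its whole support.
\<close>

lemma ladder_lcms_decomposition:
  fixes n C C' :: "nat \<Rightarrow> nat"
  assumes fin: "finite I" and cop: "\<And>i. i \<in> I \<Longrightarrow> coprime (n i) p"
    and C': "\<And>i. i \<in> I \<Longrightarrow> 1 \<le> C' i" "\<And>i. i \<in> I \<Longrightarrow> C' i \<le> C i"
    and C: "\<And>i. i \<in> I \<Longrightarrow> C i \<le> Suc (C' i)"
  defines "L \<equiv> \<lambda>c. LCM i\<in>I. ladder p (n i) (c i)"
  shows "L ` {c. \<forall>i\<in>I. c i \<le> C i} =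
    L ` {c. \<forall>i\<in>I. c i \<le> C' i} \<union> L ` {c. \<forall>i\<in>I. c i \<in> {0, C i}}"
proof (intro equalityI subsetI)
  fix x assume "x \<in> L ` {c. \<forall>i\<in>I. c i \<le> C i}"
  then obtain c where x: "x = L c" and c: "\<And>i. i \<in> I \<Longrightarrow> c i \<le> C i" by auto
  show "x \<in> L ` {c. \<forall>i\<in>I. c i \<le> C' i} \<union> L ` {c. \<forall>i\<in>I. c i \<in> {0, C i}}"
  proof (cases "\<forall>i\<in>I. c i = 0")
    case True
    then show ?thesis using x by (intro UnI1 image_eqI) auto
  next
    case False
    then have "I \<noteq> {}" by auto
    define \<mu> where "\<mu> = Max (c ` I)"
    have le: "c i \<le> \<mu>" if "i \<in> I" for i using that fin by (simp add: \<mu>_def)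
    obtain j where j: "j \<in> I" "c j = \<mu>"
      using Max_in[of "c ` I"] fin \<open>I \<noteq> {}\<close> unfolding \<mu>_def by fastforce
    have "\<mu> > 0" using False le by fastforce
    show ?thesis
    proof (cases "\<exists>i\<in>I. c i > 0 \<and> \<mu> \<le> C' i")
      case True
      then obtain i where i: "i \<in> I" "c i > 0" "\<mu> \<le> C' i" by blast
      define c' where "c' = (\<lambda>l. if c l = 0 then 0 else if l = i then \<mu> else 1)"
      have "L c = L c'"
        unfolding L_def
      proof (rule Lcm_ladder_cong[OF cop])
        show "c l > 0 \<longleftrightarrow> c' l > 0" if "l \<in> I" for l
          using \<open>\<mu> > 0\<close> by (simp add: c'_def)
        show "\<exists>j\<in>I. c l \<le> c' j" if "l \<in> I" for l
          using le[OF that] i by (intro bexI[of _ i]) (auto simp: c'_def)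
        show "\<exists>j\<in>I. c' l \<le> c j" if "l \<in> I" for l
          using \<open>\<mu> > 0\<close> j by (intro bexI[of _ j]) (auto simp: c'_def)
      qed
      moreover have "c' l \<le> C' l" if "l \<in> I" for l
        using C'(1)[OF that] i by (auto simp: c'_def)
      ultimately show ?thesis using x by auto
    next
      case False
      \<comment> \<open>Now the maximal exponent occurs at the upper level only, hence it is the top exponent
        of the factor where it occurs, and no top exponent in the support exceeds it.\<close>
      then have top: "C l \<le> \<mu>" if "l \<in> I" "c l > 0" for l
        using that C[of l] by (meson le_trans not_less_eq_eq)
      define c' where "c' = (\<lambda>l. if c l = 0 then 0 else C l)"
      have "L c = L c'"
        unfolding L_def
      proof (rule Lcm_ladder_cong[OF cop])
        show "c l > 0 \<longleftrightarrow> c' l > 0" if "l \<in> I" for l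
          using c[OF that] by (auto simp: c'_def)
        show "\<exists>j\<in>I. c l \<le> c' j" if "l \<in> I" for l
          using le[OF that] j c[of j] \<open>\<mu> > 0\<close> by (intro bexI[of _ j]) (auto simp: c'_def)
        show "\<exists>j\<in>I. c' l \<le> c j" if "l \<in> I" for l
          using j top[OF that] by (intro bexI[of _ j]) (auto simp: c'_def)
      qed
      moreover have "c' l \<in> {0, C l}" for l by (simp add: c'_def)
      ultimately show ?thesis using x by auto
    qed
  qed
next
  fix x assume "x \<in> L ` {c. \<forall>i\<in>I. c i \<le> C' i} \<union> L ` {c. \<forall>i\<in>I. c i \<in> {0, C i}}"
  then show "x \<in> L ` {c. \<forall>i\<in>I. c i \<le> C i}"
  proof (elim UnE)
    assume "x \<in> L ` {c. \<forall>i\<in>I. c i \<le> C' i}"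
    then show ?thesis
      using C'(2) by (auto intro: le_trans)
  next
    assume "x \<in> L ` {c. \<forall>i\<in>I. c i \<in> {0, C i}}"
    then obtain c where c: "x = L c" "\<forall>i\<in>I. c i \<in> {0, C i}" by blast
    then have "\<forall>i\<in>I. c i \<le> C i" by fastforce
    then show ?thesis using c(1) by blast
  qed
qed

lemma big_lcm_prod_eq:
  "big_lcm_prod S r = {LCM i\<in>{1..r}. x i | x. \<forall>i\<in>{1..r}. x i \<in> S i}"
proof (induction r)
  case 0
  then show ?case by simp
next
  case (Suc r)
  have split: "{1..Suc r} = insert (Suc r) {1..r}" by auto
  show ?case
  proof (intro equalityI subsetI)
    fix y assume "y \<in> big_lcm_prod S (Suc r)"
    then obtain x b where y: "y = lcm (LCM i\<in>{1..r}. x i) b"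
      and x: "\<forall>i\<in>{1..r}. x i \<in> S i" "b \<in> S (Suc r)"
      by (auto simp: lcm_prod_def Suc.IH)
    have "(x(Suc r := b)) ` {1..r} = x ` {1..r}"
      by (intro image_cong) auto
    then have "y = (LCM i\<in>{1..Suc r}. (x(Suc r := b)) i)"
      unfolding split y image_insert Lcm_insert by (simp only: fun_upd_same lcm.commute)
    then show "y \<in> {LCM i\<in>{1..Suc r}. x i | x. \<forall>i\<in>{1..Suc r}. x i \<in> S i}"
      using x by (intro CollectI exI[of _ "x(Suc r := b)"]) auto
  next
    fix y assume "y \<in> {LCM i\<in>{1..Suc r}. x i | x. \<forall>i\<in>{1..Suc r}. x i \<in> S i}"
    then obtain x where x: "y = (LCM i\<in>{1..Suc r}. x i)" "\<forall>i\<in>{1..Suc r}. x i \<in> S i"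
      by blast
    then have "y = lcm (LCM i\<in>{1..r}. x i) (x (Suc r))"
      unfolding split by (simp add: lcm.commute)
    moreover have "(LCM i\<in>{1..r}. x i) \<in> big_lcm_prod S r"
      unfolding Suc.IH using x(2) by force
    moreover have "x (Suc r) \<in> S (Suc r)" using x(2) by simp
    ultimately show "y \<in> big_lcm_prod S (Suc r)"
      unfolding big_lcm_prod.simps lcm_prod_def by blast
  qed
qed

section \<open>Exponents fixing an element modulo an ideal\<close>

text \<open>
  Euclid's algorithm: remainders are obtained by repeated subtraction.
\<close>

lemma gcd_mem_of_diff_closed:
  fixes S :: "nat set"
  assumes add: "\<And>a b. a \<in> S \<Longrightarrow> b \<in> S \<Longrightarrow> a + b \<in> S"
    and diff: "\<And>a b. a \<in> S \<Longrightarrow> a + b \<in> S \<Longrightarrow> b \<in> S"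
    and zero: "0 \<in> S"
  shows "a \<in> S \<Longrightarrow> b \<in> S \<Longrightarrow> gcd a b \<in> S"
proof (induction a b rule: gcd_nat_induct)
  case (base a)
  then show ?case by simp
next
  case (step a b)
  have mult: "b * c \<in> S" for c
    by (induction c) (use zero add step.prems in auto)
  have "a mod b \<in> S"
    using diff[of "b * (a div b)" "a mod b"] mult step.prems by simp
  then show ?case
    using step by (metis gcd_red_nat)
qed

context cring
begin

definition fixing :: "'a set \<Rightarrow> 'a \<Rightarrow> 'a \<Rightarrow> nat set" where
  "fixing I f z = {l. (f [^] l \<ominus> \<one>) \<otimes> z \<in> I}"

lemma fixing_zero:
  assumes "ideal I R" "f \<in> carrier R" "z \<in> carrier R"
  shows "0 \<in> fixing I f z"
proof -
  interpret I: ideal I R by fact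
  have "(f [^] (0::nat) \<ominus> \<one>) \<otimes> z = \<zero>"
    using assms by (simp add: minus_eq r_neg)
  then show ?thesis unfolding fixing_def by simp
qed

lemma fixing_add:
  assumes "ideal I R" "f \<in> carrier R" "z \<in> carrier R"
    and "a \<in> fixing I f z" "b \<in> fixing I f z"
  shows "a + b \<in> fixing I f z"
proof -
  interpret I: ideal I R by fact
  have "f [^] a \<in> carrier R" "f [^] b \<in> carrier R" using assms by auto
  then have "(f [^] (a + b) \<ominus> \<one>) \<otimes> z =
    f [^] a \<otimes> ((f [^] b \<ominus> \<one>) \<otimes> z) \<oplus> (f [^] a \<ominus> \<one>) \<otimes> z"
    unfolding nat_pow_mult[OF assms(2), symmetric] using assms(3) by algebra
  then show ?thesis
    using assms unfolding fixing_def by (simp add: I.I_l_closed)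
qed

text \<open>
  If \<open>f\<^sup>a\<close> fixes \<open>z\<close>, then \<open>f\<^sup>b z = f\<^sup>a\<^sup>+\<^sup>b z\<close>.
\<close>

lemma fixing_diff:
  assumes "ideal I R" "f \<in> carrier R" "z \<in> carrier R"
    and "a \<in> fixing I f z" "a + b \<in> fixing I f z"
  shows "b \<in> fixing I f z"
proof -
  interpret I: ideal I R by fact
  have "f [^] a \<in> carrier R" "f [^] b \<in> carrier R" using assms by auto
  then have "(f [^] b \<ominus> \<one>) \<otimes> z =
    (f [^] (a + b) \<ominus> \<one>) \<otimes> z \<ominus> f [^] b \<otimes> ((f [^] a \<ominus> \<one>) \<otimes> z)"
    unfolding nat_pow_mult[OF assms(2), symmetric] using assms(3) by algebra
  then show ?thesis
    using assms unfolding fixing_def minus_eq by (simp add: I.I_l_closed)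
qed

lemma fixing_gcd:
  assumes "ideal I R" "f \<in> carrier R" "z \<in> carrier R"
    and "a \<in> fixing I f z" "b \<in> fixing I f z"
  shows "gcd a b \<in> fixing I f z"
  using gcd_mem_of_diff_closed[of "fixing I f z" a b] fixing_add[OF assms(1-3)]
    fixing_diff[OF assms(1-3)] fixing_zero[OF assms(1-3)] assms(4,5) by blast

lemma fixing_multiple:
  assumes "ideal I R" "f \<in> carrier R" "z \<in> carrier R"
    and "a \<in> fixing I f z" "a dvd b"
  shows "b \<in> fixing I f z"
proof -
  have "a * c \<in> fixing I f z" for c
    by (induction c) (use fixing_zero[OF assms(1-3)] fixing_add[OF assms(1-4)] in auto)
  then show ?thesis using assms(5) by (auto elim: dvdE)
qed

text \<open>
  The beginning of the expansion of \<open>v\<^sup>N\<close> at \<open>v = 1\<close>. For \<open>N = p\<close> it shows that passing from \<open>v\<close> to \<open>v\<^sup>p\<close>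
  multiplies \<open>v - 1\<close> by an element of every ideal that contains both \<open>p\<close> and \<open>v - 1\<close>.
\<close>

lemma geometric_factor:
  assumes v: "v \<in> carrier R"
  shows "\<exists>T\<in>carrier R. v [^] (N::nat) \<ominus> \<one> = (v \<ominus> \<one>) \<otimes> ([N] \<cdot> \<one> \<oplus> (v \<ominus> \<one>) \<otimes> T)"
proof (induction N)
  case 0
  show ?case using v by (intro bexI[of _ \<zero>]) (auto simp: minus_eq r_neg)
next
  case (Suc N)
  then obtain T where T: "T \<in> carrier R"
    "v [^] N \<ominus> \<one> = (v \<ominus> \<one>) \<otimes> ([N] \<cdot> \<one> \<oplus> (v \<ominus> \<one>) \<otimes> T)" by blast
  define c where "c = [N] \<cdot> \<one>"
  define x where "x = v [^] N"
  have cx: "c \<in> carrier R" "x \<in> carrier R" using v by (auto simp: c_def x_def)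
  have "x \<ominus> \<one> \<oplus> \<one> = x" using cx by algebra
  then have x: "x = (v \<ominus> \<one>) \<otimes> (c \<oplus> (v \<ominus> \<one>) \<otimes> T) \<oplus> \<one>"
    using T(2) unfolding c_def x_def by simp
  have "x \<otimes> v \<ominus> \<one> = (v \<ominus> \<one>) \<otimes> (c \<oplus> \<one> \<oplus> (v \<ominus> \<one>) \<otimes> (T \<oplus> (c \<oplus> (v \<ominus> \<one>) \<otimes> T)))"
    unfolding x using cx(1) v T(1) by algebra
  moreover have "[Suc N] \<cdot> \<one> = c \<oplus> \<one>" by (simp add: c_def)
  ultimately show ?case
    using cx v T(1) by (intro bexI[of _ "T \<oplus> (c \<oplus> (v \<ominus> \<one>) \<otimes> T)"]) (auto simp: x_def)
qed

end

lemma (in ideal) I_minus_closed: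
  assumes "x \<in> I" "y \<in> I"
  shows "x \<ominus> y \<in> I"
  using assms unfolding minus_eq by simp

section \<open>Periods in one local factor\<close>

text \<open>
  Unless it is zero, the ring \<open>R/I\<close> is local with maximal ideal \<open>M/I\<close>, generated by the classes of \<open>\<pi>\<close> and \<open>G\<close>. This ideal
  is nilpotent by \<open>nilpotent\<close> and \<open>power_G\<close>, which make \<open>\<pi>\<close> nilpotent, and \<open>G\<close> nilpotent modulo \<open>\<pi>\<close>. The
  number \<open>n\<close> is the order of \<open>f\<close> in the residue field \<open>R/M\<close>.
\<close>

locale local_factor = cring +
  fixes p e n k :: nat and I M f G w \<pi>
  defines "\<pi> \<equiv> [p] \<cdot> \<one>"
  assumes prime: "Factorial_Ring.prime p"
    and I: "ideal I R" and M: "ideal M R"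
    and f [simp]: "f \<in> carrier R" and G [simp]: "G \<in> carrier R" and w [simp]: "w \<in> carrier R"
    and nilpotent: "\<pi> [^] e = \<zero>"
    and power_G: "G [^] k \<oplus> \<pi> \<otimes> w \<in> I"
    and \<pi>_mem_M: "\<pi> \<in> M" and G_mem_M: "G \<in> M"
    and M_sub: "\<And>x. x \<in> M \<Longrightarrow> \<exists>a\<in>carrier R. \<exists>b\<in>carrier R. x = a \<otimes> \<pi> \<oplus> b \<otimes> G"
    and inverse_mod: "\<And>a. a \<in> carrier R \<Longrightarrow> a \<notin> M \<Longrightarrow> \<exists>b\<in>carrier R. b \<otimes> a \<ominus> \<one> \<in> M"
    and n_pos: "0 < n"
    and order_mod: "\<And>l. f [^] (l::nat) \<ominus> \<one> \<in> M \<longleftrightarrow> n dvd l"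
begin

sublocale I: ideal I R by (rule I)
sublocale M: ideal M R by (rule M)

lemma \<pi>_closed [simp]: "\<pi> \<in> carrier R"
  by (simp add: \<pi>_def)

text \<open>
  The maximal ideal of \<open>R/I\<close> is nilpotent, so a nonzero cyclic module \<open>(R y + K)/K\<close> contains a nonzero
  element annihilated by \<open>M\<close>: multiply \<open>y\<close> by \<open>\<pi>\<close>, and then by \<open>G\<close>, as long as the product stays outside \<open>K\<close>.
\<close>

lemma socle:
  assumes K: "ideal K R" and sub: "I \<subseteq> K" and y: "y \<in> carrier R" "y \<notin> K"
  shows "\<exists>a\<in>carrier R. a \<otimes> y \<notin> K \<and> (\<forall>x\<in>M. x \<otimes> (a \<otimes> y) \<in> K)"
proof -
  interpret K: ideal K R by (rule K)
  \<comment> \<open>The first power of \<open>\<pi>\<close>, and after it the first power of \<open>G\<close>, that moves \<open>y\<close> into \<open>K\<close>.\<close>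
  define s where "s = (LEAST s::nat. \<pi> [^] s \<otimes> y \<in> K)"
  have "\<pi> [^] e \<otimes> y \<in> K" using y(1) by (simp add: nilpotent)
  then have s: "\<pi> [^] s \<otimes> y \<in> K" unfolding s_def by (rule LeastI[where P = "\<lambda>s::nat. \<pi> [^] s \<otimes> y \<in> K"])
  have "s \<noteq> 0" using s y by (metis l_one nat_pow_0)
  then obtain s' where s': "s = Suc s'" using not0_implies_Suc by blast
  define u where "u = \<pi> [^] s' \<otimes> y"
  have u: "u \<in> carrier R" "u \<notin> K"
    using y(1) not_less_Least[of s' "\<lambda>s::nat. \<pi> [^] s \<otimes> y \<in> K"] s' by (auto simp: s_def u_def)
  have \<pi>u: "\<pi> \<otimes> u \<in> K"
    using s y(1) unfolding s' u_def by (simp add: m_assoc[symmetric] m_comm[of \<pi>])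
  define t where "t = (LEAST t::nat. G [^] t \<otimes> u \<in> K)"
  have "(G [^] k \<oplus> \<pi> \<otimes> w) \<otimes> u \<in> K"
    using K.I_r_closed[of "G [^] k \<oplus> \<pi> \<otimes> w" u] power_G sub u(1) by auto
  moreover have "w \<otimes> (\<pi> \<otimes> u) \<in> K"
    using K.I_l_closed[OF \<pi>u w] .
  moreover have "G [^] k \<otimes> u = (G [^] k \<oplus> \<pi> \<otimes> w) \<otimes> u \<ominus> w \<otimes> (\<pi> \<otimes> u)"
  proof -
    have "G [^] k \<in> carrier R" by simp
    then show ?thesis using u(1) w \<pi>_closed by algebra
  qed
  ultimately have "G [^] k \<otimes> u \<in> K"
    using K.I_minus_closed by metis
  then have t: "G [^] t \<otimes> u \<in> K" unfolding t_def by (rule LeastI[where P = "\<lambda>t::nat. G [^] t \<otimes> u \<in> K"])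
  have "t \<noteq> 0" using t u by (metis l_one nat_pow_0)
  then obtain t' where t': "t = Suc t'" using not0_implies_Suc by blast
  define v where "v = G [^] t' \<otimes> u"
  have v: "v \<in> carrier R" "v \<notin> K"
    using u(1) not_less_Least[of t' "\<lambda>t::nat. G [^] t \<otimes> u \<in> K"] t' by (auto simp: t_def v_def)
  have Gv: "G \<otimes> v \<in> K"
    using t u(1) unfolding t' v_def by (simp add: m_assoc[symmetric] m_comm[of G])
  have \<pi>v: "\<pi> \<otimes> v \<in> K"
    using K.I_l_closed[OF \<pi>u, of "G [^] t'"] u(1) unfolding v_def by (simp add: m_lcomm)
  have "x \<otimes> v \<in> K" if x: "x \<in> M" for x
  proof -
    obtain a b where ab: "a \<in> carrier R" "b \<in> carrier R" "x = a \<otimes> \<pi> \<oplus> b \<otimes> G"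
      using M_sub[OF x] by blast
    have "x \<otimes> v = a \<otimes> (\<pi> \<otimes> v) \<oplus> b \<otimes> (G \<otimes> v)"
      using ab v(1) by (simp add: l_distr m_assoc)
    then show ?thesis using K.I_l_closed[OF \<pi>v ab(1)] K.I_l_closed[OF Gv ab(2)] by simp
  qed
  moreover have "v = (G [^] t' \<otimes> \<pi> [^] s') \<otimes> y"
    using y(1) by (simp add: v_def u_def m_assoc)
  ultimately show ?thesis using v(2) by (intro bexI[of _ "G [^] t' \<otimes> \<pi> [^] s'"]) auto
qed

text \<open>
  For \<open>c > 0\<close> these are the elements whose period modulo \<open>I\<close> divides \<open>ladder p n c\<close>. Stage 0 is \<open>I\<close> itself,
  which for \<open>n = 1\<close> can be smaller than the set of elements of period 1.
\<close>

definition stage :: "nat \<Rightarrow> 'a set" where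
  "stage c = (if c = 0 then I else {y \<in> carrier R. n * p ^ (c - 1) \<in> fixing I f y})"

lemma stage_0 [simp]: "stage 0 = I"
  and stage_Suc: "stage (Suc c) = {y \<in> carrier R. n * p ^ c \<in> fixing I f y}"
  by (simp_all add: stage_def)

lemma stage_ideal: "ideal (stage c) R"
proof (cases c)
  case 0
  then show ?thesis by (simp add: I)
next
  case (Suc c')
  define u where "u = f [^] (n * p ^ c') \<ominus> \<one>"
  have u: "u \<in> carrier R" by (simp add: u_def)
  have "ideal {y \<in> carrier R. u \<otimes> y \<in> I} R"
  proof (intro idealI ring_axioms add.subgroupI)
    fix a b assume ab: "a \<in> {y \<in> carrier R. u \<otimes> y \<in> I}" "b \<in> {y \<in> carrier R. u \<otimes> y \<in> I}"
    then show "a \<oplus> b \<in> {y \<in> carrier R. u \<otimes> y \<in> I}"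
      using u by (simp add: r_distr)
  next
    fix a assume a: "a \<in> {y \<in> carrier R. u \<otimes> y \<in> I}"
    then show "\<ominus> a \<in> {y \<in> carrier R. u \<otimes> y \<in> I}"
      using u by (simp add: r_minus)
  next
    fix a x assume a: "a \<in> {y \<in> carrier R. u \<otimes> y \<in> I}" and x: "x \<in> carrier R"
    then have "x \<otimes> (u \<otimes> a) \<in> I" by (simp add: I.I_l_closed)
    then show "x \<otimes> a \<in> {y \<in> carrier R. u \<otimes> y \<in> I}"
      using u a x by (simp add: m_lcomm)
    then show "a \<otimes> x \<in> {y \<in> carrier R. u \<otimes> y \<in> I}"
      using u a x by (simp add: m_comm)
  qed (use u I.zero_closed in auto)
  then show ?thesis unfolding Suc stage_Suc fixing_def u_def by simp
qed

lemma stage_Suc_mono: "stage c \<subseteq> stage (Suc c)"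
proof
  fix y assume y: "y \<in> stage c"
  show "y \<in> stage (Suc c)"
  proof (cases c)
    case 0
    then show ?thesis using y I.Icarr by (auto simp: stage_Suc fixing_def I.I_l_closed)
  next
    case (Suc c')
    then show ?thesis
      using y fixing_multiple[OF I f, of y "n * p ^ c'" "n * p ^ c"] by (simp add: stage_Suc)
  qed
qed

lemma stage_mono: "c \<le> c' \<Longrightarrow> stage c \<subseteq> stage c'"
  by (rule lift_Suc_mono_le[of stage, OF stage_Suc_mono])

text \<open>
  For \<open>v = f\<^sup>m\<close> with \<open>m = n p\<^sup>j\<close> the difference \<open>v - 1\<close> lies in \<open>M\<close>, hence so does the second factor in
  \<open>v\<^sup>p - 1 = (v - 1) (\<pi> + (v - 1) T)\<close>. One more factor \<open>p\<close> in the exponent therefore makes up for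
  one factor from \<open>M\<close>.
\<close>

lemma stage_step:
  assumes y: "y \<in> carrier R" and My: "\<And>x. x \<in> M \<Longrightarrow> x \<otimes> y \<in> stage c"
  shows "y \<in> stage (Suc c)"
proof (cases c)
  case 0
  then show ?thesis
    using y My[of "f [^] n \<ominus> \<one>"] order_mod[of n] by (simp add: stage_Suc fixing_def)
next
  case (Suc c')
  define v where "v = f [^] (n * p ^ c')"
  have v: "v \<in> carrier R" by (simp add: v_def)
  then obtain T where T: "T \<in> carrier R"
    "v [^] p \<ominus> \<one> = (v \<ominus> \<one>) \<otimes> (\<pi> \<oplus> (v \<ominus> \<one>) \<otimes> T)"
    using geometric_factor[OF v, of p] unfolding \<pi>_def by blast
  have "v \<ominus> \<one> \<in> M" unfolding v_def by (simp add: order_mod)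
  then have "\<pi> \<oplus> (v \<ominus> \<one>) \<otimes> T \<in> M"
    using T(1) by (simp add: M.I_r_closed \<pi>_mem_M)
  then have "(v \<ominus> \<one>) \<otimes> ((\<pi> \<oplus> (v \<ominus> \<one>) \<otimes> T) \<otimes> y) \<in> I"
    using My[of "\<pi> \<oplus> (v \<ominus> \<one>) \<otimes> T"] unfolding Suc by (simp add: stage_Suc fixing_def v_def)
  then have "(v [^] p \<ominus> \<one>) \<otimes> y \<in> I"
    unfolding T(2) using v T(1) y by (simp add: m_assoc)
  moreover have "v [^] p = f [^] (n * p ^ c)"
    unfolding v_def Suc by (simp add: nat_pow_pow mult.commute mult.left_commute)
  ultimately show ?thesis using y by (simp add: stage_Suc fixing_def)
qed

text \<open>
  The union \<open>K\<close> of the stages is an ideal. An element outside \<open>K\<close> would have a multiple \<open>x\<close> outside \<open>K\<close>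
  with \<open>M x \<subseteq> K\<close>; as \<open>M\<close> has two generators, a single stage contains \<open>M x\<close>, and the next one contains \<open>x\<close>.
\<close>

lemma exhausts: "\<exists>c. y \<in> stage c" if y: "y \<in> carrier R"
proof (rule ccontr)
  assume no: "\<nexists>c. y \<in> stage c"
  have "subset.chain {J. ideal J R} (range stage)"
    unfolding subset_chain_def
  proof (intro conjI ballI)
    fix A B assume "A \<in> range stage" "B \<in> range stage"
    then obtain c c' where "A = stage c" "B = stage c'" by blast
    then show "A \<subseteq> B \<or> B \<subseteq> A"
      using linear[of c c'] stage_mono by blast
  qed (use stage_ideal in blast)
  then have "ideal (\<Union>(range stage)) R"
    using chain_Union_is_ideal[of "range stage"] by simp
  moreover have "I \<subseteq> \<Union>(range stage)" using stage_0 by blast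
  ultimately obtain a where a: "a \<in> carrier R" "a \<otimes> y \<notin> \<Union>(range stage)"
    and Ma: "\<forall>x\<in>M. x \<otimes> (a \<otimes> y) \<in> \<Union>(range stage)"
    using socle[of "\<Union>(range stage)" y] y no by auto
  obtain c1 c2 where "\<pi> \<otimes> (a \<otimes> y) \<in> stage c1" "G \<otimes> (a \<otimes> y) \<in> stage c2"
    using Ma \<pi>_mem_M G_mem_M by blast
  then have gens: "\<pi> \<otimes> (a \<otimes> y) \<in> stage (max c1 c2)" "G \<otimes> (a \<otimes> y) \<in> stage (max c1 c2)"
    using stage_mono[of c1 "max c1 c2"] stage_mono[of c2 "max c1 c2"] by auto
  interpret S: ideal "stage (max c1 c2)" R by (rule stage_ideal)
  have "x \<otimes> (a \<otimes> y) \<in> stage (max c1 c2)" if x: "x \<in> M" for x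
  proof -
    obtain b d where bd: "b \<in> carrier R" "d \<in> carrier R" "x = b \<otimes> \<pi> \<oplus> d \<otimes> G"
      using M_sub[OF x] by blast
    have "x \<otimes> (a \<otimes> y) = b \<otimes> (\<pi> \<otimes> (a \<otimes> y)) \<oplus> d \<otimes> (G \<otimes> (a \<otimes> y))"
      using bd a y by (simp add: l_distr m_assoc)
    then show ?thesis using S.I_l_closed gens bd by simp
  qed
  then have "a \<otimes> y \<in> stage (Suc c)" using stage_step a y by blast
  then show False using a(2) by blast
qed


text \<open>
  Replace \<open>y\<close> by a nonzero multiple annihilated by \<open>M\<close>. If \<open>n\<close> does not divide \<open>l\<close>, then \<open>f\<^sup>l - 1\<close> is
  invertible modulo \<open>M\<close> and cannot annihilate that multiple.
\<close>

lemma fixing_nonzero: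
  assumes y: "y \<in> carrier R" "y \<notin> I" and l: "l \<in> fixing I f y"
  shows "n dvd l"
proof (rule ccontr)
  assume "\<not> n dvd l"
  define u where "u = f [^] l \<ominus> \<one>"
  have u: "u \<in> carrier R" "u \<notin> M" using \<open>\<not> n dvd l\<close> order_mod by (auto simp: u_def)
  then obtain b where b: "b \<in> carrier R" "b \<otimes> u \<ominus> \<one> \<in> M" using inverse_mod by blast
  obtain a where a: "a \<in> carrier R" "a \<otimes> y \<notin> I" "\<forall>x\<in>M. x \<otimes> (a \<otimes> y) \<in> I"
    using socle[OF I subset_refl y] by blast
  have "(b \<otimes> a) \<otimes> (u \<otimes> y) \<in> I"
    using l a b unfolding fixing_def u_def by (simp add: I.I_l_closed)
  moreover have "(b \<otimes> u \<ominus> \<one>) \<otimes> (a \<otimes> y) \<in> I" using a b by blast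
  moreover have "a \<otimes> y = (b \<otimes> a) \<otimes> (u \<otimes> y) \<ominus> (b \<otimes> u \<ominus> \<one>) \<otimes> (a \<otimes> y)"
    using a(1) b(1) u(1) y(1) by algebra
  ultimately have "a \<otimes> y \<in> I" using I.I_minus_closed by metis
  with a(2) show False by contradiction
qed

definition level :: "'a \<Rightarrow> nat" where
  "level y = (LEAST c. y \<in> stage c)"

lemma mem_stage_iff: "y \<in> carrier R \<Longrightarrow> y \<in> stage c \<longleftrightarrow> level y \<le> c"
  unfolding level_def using exhausts[of y] stage_mono
  by (meson LeastI_ex Least_le subsetD)

lemma level_eq_0_iff: "y \<in> carrier R \<Longrightarrow> level y = 0 \<longleftrightarrow> y \<in> I"
  using mem_stage_iff[of y 0] by simp

lemma level_mult_le:
  assumes "a \<in> carrier R" "y \<in> carrier R"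
  shows "level (a \<otimes> y) \<le> level y"
proof -
  have "y \<in> stage (level y)" using assms mem_stage_iff by blast
  then have "a \<otimes> y \<in> stage (level y)"
    using ideal.I_l_closed[OF stage_ideal] assms by blast
  then show ?thesis using assms mem_stage_iff by blast
qed

lemma level_cong:
  assumes y: "y \<in> carrier R" "z \<in> carrier R" and diff: "y \<ominus> z \<in> I"
  shows "level y = level z"
proof -
  have mem: "a \<in> stage c \<longleftrightarrow> b \<in> stage c" if "a \<in> carrier R" "b \<in> carrier R" "a \<ominus> b \<in> I" for a b c
  proof -
    interpret S: ideal "stage c" R by (rule stage_ideal)
    have d: "a \<ominus> b \<in> stage c" using that(3) stage_mono[of 0 c] by auto
    have "a = (a \<ominus> b) \<oplus> b" "b = a \<ominus> (a \<ominus> b)" using that by algebra+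
    then show ?thesis using d that(1,2) by (metis S.a_closed S.I_minus_closed)
  qed
  show ?thesis unfolding level_def using mem[OF y diff] by simp
qed

text \<open>
  The fixing exponents of \<open>y \<notin> I\<close> are closed under greatest common divisors and divisible by \<open>n\<close>.
  If \<open>j + 1\<close> is the level of \<open>y\<close>, the greatest common divisor of such an exponent with \<open>n p\<^sup>j\<close> thus has the
  form \<open>n p\<^sup>i\<close>, and \<open>i < j\<close> is excluded because \<open>y\<close> lies in no smaller stage.
\<close>

lemma fixing_iff_ladder:
  assumes y: "y \<in> carrier R"
  shows "l \<in> fixing I f y \<longleftrightarrow> ladder p n (level y) dvd l"
proof (cases "level y")
  case 0
  then have "y \<in> I" using y level_eq_0_iff by blast
  then show ?thesis using 0 by (simp add: fixing_def I.I_l_closed)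
next
  case (Suc j)
  have in_stage: "n * p ^ j \<in> fixing I f y"
    using mem_stage_iff[OF y, of "Suc j"] Suc by (simp add: stage_Suc)
  show ?thesis
  proof
    assume l: "l \<in> fixing I f y"
    have "y \<notin> I" using level_eq_0_iff[OF y] Suc by simp
    define d where "d = gcd l (n * p ^ j)"
    have d: "d \<in> fixing I f y" unfolding d_def using fixing_gcd[OF I f y l in_stage] .
    then have "n dvd d" using fixing_nonzero[OF y \<open>y \<notin> I\<close>] by blast
    then obtain x where x: "d = n * x" by (elim dvdE)
    have "d dvd n * p ^ j" by (simp add: d_def)
    then have "x dvd p ^ j" using x n_pos by simp
    then obtain i where i: "x = p ^ i" "i \<le> j" using divides_primepow_nat[OF prime] by blast
    have "i = j"
    proof (rule ccontr)
      assume "i \<noteq> j"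
      then obtain j' where j': "j = Suc j'" "i \<le> j'" using i(2) by (cases j) auto
      then have "n * p ^ j' \<in> fixing I f y"
        using fixing_multiple[OF I f y d] x i by (simp add: le_imp_power_dvd)
      then have "level y \<le> j" using mem_stage_iff[OF y, of j] y j'(1) by (simp add: stage_Suc)
      then show False using Suc by simp
    qed
    then have "d = n * p ^ j" using x i by simp
    then show "ladder p n (level y) dvd l" unfolding Suc ladder_Suc by (metis d_def gcd_dvd1)
  next
    assume "ladder p n (level y) dvd l"
    then show "l \<in> fixing I f y"
      using fixing_multiple[OF I f y in_stage] Suc by simp
  qed
qed

text \<open>
  Modulo the stage before \<open>c\<close>, the element \<open>y\<close> has a nonzero multiple annihilated by \<open>M\<close>; this multiple
  enters exactly at stage \<open>c\<close>. So the periods inside a cyclic submodule have no gaps.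
\<close>

lemma level_attained:
  assumes y: "y \<in> carrier R" and c: "c \<le> level y"
  shows "\<exists>a\<in>carrier R. level (a \<otimes> y) = c"
proof (cases c)
  case 0
  then show ?thesis using y level_eq_0_iff by (intro bexI[of _ \<zero>]) auto
next
  case (Suc c')
  then have "y \<notin> stage c'" using y c mem_stage_iff by auto
  then obtain a where a: "a \<in> carrier R" "a \<otimes> y \<notin> stage c'" "\<forall>x\<in>M. x \<otimes> (a \<otimes> y) \<in> stage c'"
    using socle[OF stage_ideal _ y, of c'] stage_mono[of 0 c'] by auto
  then have "a \<otimes> y \<in> stage c" unfolding Suc using stage_step y by blast
  then have "level (a \<otimes> y) = c"
    using a y mem_stage_iff[of "a \<otimes> y"] unfolding Suc by (simp add: le_antisym not_less_eq_eq)
  then show ?thesis using a(1) by blast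
qed

text \<open>
  Let \<open>\<pi> u \<in> I\<close>. By \<open>divide\<close> the class of \<open>u\<close> is a multiple of \<open>\<pi>\<^sup>e\<^sup>-\<^sup>1\<close>, which is divisible by \<open>\<pi>\<close> as
  \<open>e > 1\<close>; hence \<open>u\<^sup>2 \<in> I\<close>. For \<open>u = 1\<close> this would make \<open>I\<close> improper, so the level of \<open>\<pi>\<close> is positive.
  For \<open>u = v - 1\<close>, where \<open>v\<close> is a power of \<open>f\<close> that fixes \<open>\<pi>\<close>, it gives
  \<open>v\<^sup>p - 1 = \<pi> u + u\<^sup>2 T \<in> I\<close>.
\<close>

lemma level_one_le:
  assumes e: "e > 1"
    and divide: "\<And>u. u \<in> carrier R \<Longrightarrow> \<pi> \<otimes> u \<in> I \<Longrightarrow>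
      \<exists>a\<in>carrier R. u \<ominus> \<pi> [^] (e - 1) \<otimes> a \<in> I"
    and proper: "I \<subseteq> M" "\<one> \<notin> M"
  shows "1 \<le> level \<pi>" "level \<one> \<le> Suc (level \<pi>)"
proof -
  have square: "u \<otimes> u \<in> I" if u: "u \<in> carrier R" "\<pi> \<otimes> u \<in> I" for u
  proof -
    obtain a where a: "a \<in> carrier R" "u \<ominus> \<pi> [^] (e - 1) \<otimes> a \<in> I" using divide[OF u] by blast
    have "e - 1 = Suc (e - 2)" using e by simp
    then have pw: "\<pi> [^] (e - 1) = \<pi> [^] (e - 2) \<otimes> \<pi>" by simp
    have "u \<otimes> (u \<ominus> \<pi> [^] (e - 1) \<otimes> a) \<in> I" using u a by (simp add: I.I_l_closed)
    moreover have "\<pi> [^] (e - 2) \<otimes> a \<otimes> (\<pi> \<otimes> u) \<in> I" using u a by (simp add: I.I_l_closed)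
    moreover have "u \<otimes> u = u \<otimes> (u \<ominus> \<pi> [^] (e - 1) \<otimes> a) \<oplus> \<pi> [^] (e - 2) \<otimes> a \<otimes> (\<pi> \<otimes> u)"
    proof -
      have "\<pi> [^] (e - 2) \<in> carrier R" by simp
      then show ?thesis unfolding pw using u(1) a(1) \<pi>_closed by algebra
    qed
    ultimately show ?thesis by simp
  qed
  show pos: "1 \<le> level \<pi>"
  proof (rule ccontr)
    assume "\<not> 1 \<le> level \<pi>"
    then have "\<pi> \<in> I" using level_eq_0_iff[of \<pi>] by simp
    then have "\<one> \<otimes> \<one> \<in> I" using square[of \<one>] by simp
    then show False using proper by auto
  qed
  then obtain j where j: "level \<pi> = Suc j" using Suc_le_D by auto
  define u where "u = f [^] (n * p ^ j) \<ominus> \<one>"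
  define v where "v = f [^] (n * p ^ j)"
  have v: "v \<in> carrier R" "u = v \<ominus> \<one>" "u \<in> carrier R" by (auto simp: u_def v_def)
  have "\<pi> \<in> stage (Suc j)" using mem_stage_iff[of \<pi>] j by simp
  then have \<pi>u: "\<pi> \<otimes> u \<in> I"
    using v(3) by (simp add: stage_Suc fixing_def u_def m_comm)
  obtain T where T: "T \<in> carrier R" "v [^] p \<ominus> \<one> = u \<otimes> (\<pi> \<oplus> u \<otimes> T)"
    using geometric_factor[OF v(1), of p] unfolding \<pi>_def v(2) by blast
  have "u \<otimes> (\<pi> \<oplus> u \<otimes> T) = \<pi> \<otimes> u \<oplus> T \<otimes> (u \<otimes> u)"
    using v(3) T(1) \<pi>_closed by algebra
  then have "v [^] p \<ominus> \<one> \<in> I"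
    unfolding T(2) using \<pi>u square[OF v(3) \<pi>u] T(1) by (simp add: I.I_l_closed)
  moreover have "v [^] p = f [^] (n * p ^ Suc j)"
    unfolding v_def by (simp add: nat_pow_pow mult.commute mult.left_commute)
  ultimately have "\<one> \<in> stage (Suc (Suc j))" by (simp add: stage_Suc fixing_def I.Icarr)
  then show "level \<one> \<le> Suc (level \<pi>)" using mem_stage_iff[of \<one>] j by simp
qed

end

section \<open>Comaximal factors\<close>

context cring
begin

text \<open>
  Comaximality as an explicit linear combination, which can be multiplied and substituted.
\<close>

definition bezout :: "'a \<Rightarrow> 'a \<Rightarrow> bool" where
  "bezout a b \<longleftrightarrow> (\<exists>x\<in>carrier R. \<exists>y\<in>carrier R. a \<otimes> x \<oplus> b \<otimes> y = \<one>)"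

lemma mem_PIdl_iff: "x \<in> PIdl a \<longleftrightarrow> (\<exists>c\<in>carrier R. x = c \<otimes> a)"
  by (auto simp: cgenideal_def)

lemma gen_coprime_imp_bezout:
  assumes ab: "a \<in> carrier R" "b \<in> carrier R" and cop: "gen_coprime R a b"
  shows "bezout a b"
proof -
  have J: "ideal (PIdl a <+> PIdl b) R"
    using ab by (intro add_ideals cgenideal_ideal)
  have "a \<in> PIdl a" "b \<in> PIdl b" "\<zero> \<in> PIdl a" "\<zero> \<in> PIdl b"
    using ab cgenideal_self cgenideal_ideal[THEN ideal.axioms(1)] additive_subgroup.zero_closed
    by auto
  then have "a \<oplus> \<zero> \<in> PIdl a <+> PIdl b" "\<zero> \<oplus> b \<in> PIdl a <+> PIdl b"
    unfolding set_add_def' by blast+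
  then have "{a, b} \<subseteq> PIdl a <+> PIdl b" using ab by simp
  then have "Idl {a, b} \<subseteq> PIdl a <+> PIdl b" by (rule genideal_minimal[OF J])
  then have "\<one> \<in> PIdl a <+> PIdl b" using cop unfolding gen_coprime_def by auto
  then obtain x y where "x \<in> carrier R" "y \<in> carrier R" "\<one> = x \<otimes> a \<oplus> y \<otimes> b"
    unfolding set_add_def' by (auto simp: mem_PIdl_iff)
  then show ?thesis unfolding bezout_def using ab by (metis m_comm)
qed

lemma bezout_one: "a \<in> carrier R \<Longrightarrow> bezout a \<one>"
  unfolding bezout_def by (intro bexI[of _ \<zero>] bexI[of _ \<one>]) auto

lemma bezout_commute:
  assumes "a \<in> carrier R" "b \<in> carrier R" "bezout a b" shows "bezout b a"
  using assms unfolding bezout_def by (metis a_comm m_closed)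

lemma bezout_mult:
  assumes a: "a \<in> carrier R" and b: "b \<in> carrier R" and c: "c \<in> carrier R"
    and "bezout a b" "bezout a c"
  shows "bezout a (b \<otimes> c)"
proof -
  obtain x y x' y' where xy: "x \<in> carrier R" "y \<in> carrier R" "a \<otimes> x \<oplus> b \<otimes> y = \<one>"
    and xy': "x' \<in> carrier R" "y' \<in> carrier R" "a \<otimes> x' \<oplus> c \<otimes> y' = \<one>"
    using assms(4,5) unfolding bezout_def by blast
  have "\<one> = (a \<otimes> x \<oplus> b \<otimes> y) \<otimes> (a \<otimes> x' \<oplus> c \<otimes> y')" unfolding xy(3) xy'(3) by simp
  also have "\<dots> = a \<otimes> (x \<otimes> (a \<otimes> x' \<oplus> c \<otimes> y') \<oplus> b \<otimes> y \<otimes> x') \<oplus> (b \<otimes> c) \<otimes> (y \<otimes> y')"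
    using a b c xy(1,2) xy'(1,2) by algebra
  finally show ?thesis
    unfolding bezout_def
    using a b c xy(1,2) xy'(1,2) by (metis a_closed m_closed)
qed

lemma bezout_factor:
  assumes "a \<in> carrier R" "b \<in> carrier R" "c \<in> carrier R" "bezout a (b \<otimes> c)"
  shows "bezout a b"
  using assms unfolding bezout_def by (metis m_assoc m_closed)

lemma bezout_cancel:
  assumes "a \<in> carrier R" "b \<in> carrier R" "z \<in> carrier R" and bez: "bezout a b"
    and mem: "b \<otimes> z \<in> PIdl a"
  shows "z \<in> PIdl a"
proof -
  obtain x y where xy: "x \<in> carrier R" "y \<in> carrier R" "a \<otimes> x \<oplus> b \<otimes> y = \<one>"
    using bez unfolding bezout_def by blast
  obtain t where t: "t \<in> carrier R" "b \<otimes> z = t \<otimes> a" using mem mem_PIdl_iff by blast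
  have "z = (a \<otimes> x \<oplus> b \<otimes> y) \<otimes> z" unfolding xy(3) using assms by simp
  also have "\<dots> = x \<otimes> z \<otimes> a \<oplus> y \<otimes> (b \<otimes> z)" using assms(1-3) xy(1,2) by algebra
  also have "\<dots> = (x \<otimes> z \<oplus> y \<otimes> t) \<otimes> a" unfolding t(2) using assms(1-3) xy(1,2) t(1) by algebra
  finally show ?thesis using mem_PIdl_iff xy t assms by blast
qed

lemma bezout_power:
  assumes "a \<in> carrier R" "b \<in> carrier R" "bezout a b"
  shows "bezout a (b [^] (t::nat))"
  by (induction t) (use assms bezout_one bezout_mult in auto)

lemma bezout_finprod:
  assumes "finite S" "a \<in> carrier R" "g \<in> S \<rightarrow> carrier R" "\<And>i. i \<in> S \<Longrightarrow> bezout a (g i)"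
  shows "bezout a (finprod R g S)"
  using assms
proof (induction S rule: finite_induct)
  case empty
  then show ?case by (simp add: bezout_one)
next
  case (insert i S)
  then show ?case by (simp add: Pi_def bezout_mult finprod_closed)
qed

lemma factor_dvd_finprod:
  assumes "finite S" "g \<in> S \<rightarrow> carrier R" "i \<in> S"
  shows "\<exists>c\<in>carrier R. finprod R g S = g i \<otimes> c"
proof -
  have "finprod R g (insert i (S - {i})) = g i \<otimes> finprod R g (S - {i})"
    using assms by (intro finprod_insert) auto
  then show ?thesis
    using assms by (auto simp: insert_absorb intro!: bexI[of _ "finprod R g (S - {i})"] finprod_closed)
qed

lemma mem_PIdl_finprod:
  assumes "finite S" "g \<in> S \<rightarrow> carrier R"
    and "\<And>i j. i \<in> S \<Longrightarrow> j \<in> S \<Longrightarrow> i \<noteq> j \<Longrightarrow> bezout (g i) (g j)"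
    and z: "z \<in> carrier R" and "\<And>i. i \<in> S \<Longrightarrow> z \<in> PIdl (g i)"
  shows "z \<in> PIdl (finprod R g S)"
  using assms
proof (induction S rule: finite_induct)
  case empty
  then show ?case by (auto simp: mem_PIdl_iff)
next
  case (insert i S)
  let ?P = "finprod R g S"
  have P: "?P \<in> carrier R" "g i \<in> carrier R" using insert.prems by (auto intro: finprod_closed)
  have "bezout (g i) ?P" using insert by (intro bezout_finprod) auto
  obtain a where a: "a \<in> carrier R" "z = a \<otimes> g i" using insert.prems(4)[of i] mem_PIdl_iff by auto
  have "z \<in> PIdl ?P" using insert by auto
  then have "g i \<otimes> a \<in> PIdl ?P" using a P by (simp add: m_comm)
  then have "a \<in> PIdl ?P"
    using bezout_cancel[of ?P "g i" a] bezout_commute \<open>bezout (g i) ?P\<close> P a(1) by blast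
  then obtain b where "b \<in> carrier R" "a = b \<otimes> ?P" using mem_PIdl_iff by blast
  then have "z = b \<otimes> (g i \<otimes> ?P)" using a P by (simp add: m_ac)
  moreover have "finprod R g (insert i S) = g i \<otimes> ?P"
    using insert by (intro finprod_insert) auto
  ultimately show ?case using \<open>b \<in> carrier R\<close> mem_PIdl_iff by auto
qed

lemma chinese_remainder_principal:
  assumes "finite S" "g \<in> S \<rightarrow> carrier R" "z \<in> S \<rightarrow> carrier R"
    and "\<And>i j. i \<in> S \<Longrightarrow> j \<in> S \<Longrightarrow> i \<noteq> j \<Longrightarrow> bezout (g i) (g j)"
  shows "\<exists>y\<in>carrier R. \<forall>i\<in>S. y \<ominus> z i \<in> PIdl (g i)"
  using assms
proof (induction S rule: finite_induct)
  case empty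
  then show ?case by auto
next
  case (insert j S)
  let ?P = "finprod R g S"
  have P: "?P \<in> carrier R" "g j \<in> carrier R" "z j \<in> carrier R"
    using insert.prems by (auto intro: finprod_closed)
  have "bezout (g j) ?P" using insert by (intro bezout_finprod) auto
  then obtain s t where st: "s \<in> carrier R" "t \<in> carrier R" "g j \<otimes> s \<oplus> ?P \<otimes> t = \<one>"
    unfolding bezout_def by blast
  obtain y where y: "y \<in> carrier R" "\<forall>i\<in>S. y \<ominus> z i \<in> PIdl (g i)"
    using insert by auto
  let ?y = "y \<oplus> ?P \<otimes> t \<otimes> (z j \<ominus> y)"
  have "?y \<in> carrier R" using y P st by simp
  moreover have "?y \<ominus> z j \<in> PIdl (g j)"
  proof -
    have "?P \<otimes> t = (g j \<otimes> s \<oplus> ?P \<otimes> t) \<ominus> g j \<otimes> s" using st(1,2) P by algebra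
    then have "?P \<otimes> t = \<one> \<ominus> g j \<otimes> s" unfolding st(3) .
    then have "?y \<ominus> z j = y \<oplus> (\<one> \<ominus> g j \<otimes> s) \<otimes> (z j \<ominus> y) \<ominus> z j" by simp
    also have "\<dots> = s \<otimes> (y \<ominus> z j) \<otimes> g j" using y(1) P(2,3) st(1) by algebra
    finally show ?thesis using mem_PIdl_iff y st P by blast
  qed
  moreover have "?y \<ominus> z i \<in> PIdl (g i)" if i: "i \<in> S" for i
  proof -
    have gi: "g i \<in> carrier R" "z i \<in> carrier R" using insert.prems i by auto
    obtain c where c: "c \<in> carrier R" "?P = g i \<otimes> c"
      using factor_dvd_finprod[of S g i] insert i by auto
    obtain b where b: "b \<in> carrier R" "y \<ominus> z i = b \<otimes> g i" using y(2) i mem_PIdl_iff by blast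
    have "?y \<ominus> z i = (y \<ominus> z i) \<oplus> ?P \<otimes> t \<otimes> (z j \<ominus> y)" using y(1) P gi st by algebra
    also have "\<dots> = (b \<oplus> c \<otimes> t \<otimes> (z j \<ominus> y)) \<otimes> g i"
      unfolding b(2) c(2) using b(1) c(1) y(1) P(3) gi st by algebra
    finally show ?thesis using mem_PIdl_iff b(1) c(1) y(1) P(3) st(2) by blast
  qed
  ultimately show ?case by blast
qed

section \<open>Periods of multiplication maps\<close>

text \<open>
  The class of \<open>z\<close> modulo \<open>m\<close> has an eventual period dividing \<open>l\<close> under multiplication by \<open>f\<close>.
\<close>

definition returns :: "'a \<Rightarrow> 'a \<Rightarrow> 'a \<Rightarrow> nat \<Rightarrow> bool" where
  "returns f m z l \<longleftrightarrow> (\<exists>t::nat. f [^] t \<otimes> ((f [^] l \<ominus> \<one>) \<otimes> z) \<in> PIdl m)"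

lemma mult_map_coset:
  assumes "f \<in> carrier R" "m \<in> carrier R" "z \<in> carrier R"
  shows "mult_map R f m (PIdl m +> z) = PIdl m +> (f \<otimes> z)"
  using ideal.rcoset_mult_add[OF cgenideal_ideal] assms
  by (simp add: mult_map_def quot_by_def FactRing_def)

lemma mult_map_coset_funpow:
  assumes "f \<in> carrier R" "m \<in> carrier R" "z \<in> carrier R"
  shows "(mult_map R f m ^^ t) (PIdl m +> z) = PIdl m +> (f [^] t \<otimes> z)"
proof (induction t)
  case 0
  then show ?case using assms by simp
next
  case (Suc t)
  then show ?case
    using mult_map_coset[of f m "f [^] t \<otimes> z"] assms by (simp add: m_ac)
qed

lemma mult_map_orbit_iff:
  assumes "f \<in> carrier R" "m \<in> carrier R" "z \<in> carrier R"
  shows "(\<exists>t. (mult_map R f m ^^ (t + l)) (PIdl m +> z) = (mult_map R f m ^^ t) (PIdl m +> z))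
    \<longleftrightarrow> returns f m z l"
proof -
  have "(mult_map R f m ^^ (t + l)) (PIdl m +> z) = (mult_map R f m ^^ t) (PIdl m +> z)
    \<longleftrightarrow> f [^] t \<otimes> ((f [^] l \<ominus> \<one>) \<otimes> z) \<in> PIdl m" for t
  proof -
    have pw: "f [^] t \<in> carrier R" "f [^] l \<in> carrier R" using assms by auto
    have "f [^] (t + l) \<otimes> z \<ominus> f [^] t \<otimes> z = f [^] t \<otimes> ((f [^] l \<ominus> \<one>) \<otimes> z)"
      unfolding nat_pow_mult[OF assms(1), symmetric] using pw assms(3) by algebra
    then show ?thesis
      unfolding mult_map_coset_funpow[OF assms]
      using quotient_eq_iff_same_a_r_cos[OF cgenideal_ideal[OF assms(2)],
          of "f [^] (t + l) \<otimes> z" "f [^] t \<otimes> z"] assms by auto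
  qed
  then show ?thesis unfolding returns_def by blast
qed

lemma per_mult_map:
  assumes "f \<in> carrier R" "m \<in> carrier R" "z \<in> carrier R"
    and "0 < N" "\<And>l. returns f m z l \<longleftrightarrow> N dvd l"
  shows "per (mult_map R f m) (PIdl m +> z) = N"
  by (rule per_eqI[OF assms(4)]) (simp only: mult_map_orbit_iff[OF assms(1-3)] assms(5))

lemma carrier_quot_by:
  "carrier (quot_by R m) = (\<lambda>z. PIdl m +> z) ` carrier R"
  unfolding quot_by_def FactRing_def A_RCOSETS_def' by auto

text \<open>
  Modulo \<open>m1\<close> the factor \<open>f\<^sup>t\<close> can be cancelled, as \<open>f\<close> and \<open>m1\<close> are comaximal; modulo \<open>m2\<close> a large power
  of \<open>f\<close> kills everything. Only the components modulo the \<open>g i\<close> are left.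
\<close>

lemma returns_iff:
  assumes f: "f \<in> carrier R" and z: "z \<in> carrier R"
    and dec: "is_decomposition R f m m1 m2"
    and m1: "m1 = finprod R g S" and S: "finite S" and g: "g \<in> S \<rightarrow> carrier R"
    and cop: "\<And>i j. i \<in> S \<Longrightarrow> j \<in> S \<Longrightarrow> i \<noteq> j \<Longrightarrow> bezout (g i) (g j)"
  shows "returns f m z l \<longleftrightarrow> (\<forall>i\<in>S. l \<in> fixing (PIdl (g i)) f z)"
proof -
  have m12: "m1 \<in> carrier R" "m2 \<in> carrier R" "m = m1 \<otimes> m2"
    and "gen_coprime R f m1" and "\<exists>N::nat. f [^] N \<in> PIdl m2"
    using dec unfolding is_decomposition_def by auto
  then obtain N :: nat where N: "f [^] N \<in> PIdl m2" by blast
  have bez: "bezout f m1" using gen_coprime_imp_bezout f m12 \<open>gen_coprime R f m1\<close> by blast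
  define y where "y = (f [^] l \<ominus> \<one>) \<otimes> z"
  have y: "y \<in> carrier R" using f z by (simp add: y_def)
  have "(\<exists>t::nat. f [^] t \<otimes> y \<in> PIdl m) \<longleftrightarrow> (\<forall>i\<in>S. y \<in> PIdl (g i))"
  proof
    assume "\<exists>t::nat. f [^] t \<otimes> y \<in> PIdl m"
    then obtain t :: nat and a where a: "a \<in> carrier R" "f [^] t \<otimes> y = a \<otimes> m" using mem_PIdl_iff by blast
    show "\<forall>i\<in>S. y \<in> PIdl (g i)"
    proof
      fix i assume i: "i \<in> S"
      have gi: "g i \<in> carrier R" using g i by auto
      obtain c where c: "c \<in> carrier R" "m1 = g i \<otimes> c" using factor_dvd_finprod[OF S g i] m1 by blast
      have "bezout f (g i)" using bezout_factor[OF f gi c(1)] bez c(2) by simp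
      then have "bezout (g i) (f [^] t)" using bezout_power bezout_commute f gi by blast
      moreover have "f [^] t \<otimes> y = a \<otimes> c \<otimes> m2 \<otimes> g i"
        unfolding a(2) m12(3) c(2) using a(1) c(1) gi m12(2) by (simp add: m_ac)
      then have "f [^] t \<otimes> y \<in> PIdl (g i)"
        using mem_PIdl_iff a(1) c(1) m12(2) by blast
      ultimately show "y \<in> PIdl (g i)" using bezout_cancel[of "g i" "f [^] t" y] f gi y by simp
    qed
  next
    assume "\<forall>i\<in>S. y \<in> PIdl (g i)"
    then have "y \<in> PIdl m1" using mem_PIdl_finprod[OF S g cop y] m1 by blast
    then obtain a where a: "a \<in> carrier R" "y = a \<otimes> m1" using mem_PIdl_iff by blast
    obtain b where b: "b \<in> carrier R" "f [^] N = b \<otimes> m2" using N mem_PIdl_iff by blast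
    have "f [^] N \<otimes> y = (b \<otimes> a) \<otimes> m"
      unfolding a(2) b(2) m12(3) using a(1) b(1) m12 by (simp add: m_ac)
    then show "\<exists>t::nat. f [^] t \<otimes> y \<in> PIdl m" using mem_PIdl_iff a b by blast
  qed
  then show ?thesis unfolding returns_def fixing_def y_def by simp
qed

end

section \<open>Cycle lengths as least common multiples\<close>

text \<open>
  Each \<open>R/(g i)\<close> is local as above, with its own order \<open>n i\<close> in the residue field. For
  \<open>R = R\<^sub>e[x]\<close> the hypothesis \<open>divide\<close> amounts to flatness of \<open>R/(g i)\<close> over \<open>R\<^sub>e\<close>.
\<close>

locale factored_modulus = cring +
  fixes p e r :: nat and n k :: "nat \<Rightarrow> nat" and M :: "nat \<Rightarrow> 'a set"
    and f m m1 m2 and g G w :: "nat \<Rightarrow> 'a" and \<pi>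
  defines "\<pi> \<equiv> [p] \<cdot> \<one>"
  assumes f [simp]: "f \<in> carrier R" and m [simp]: "m \<in> carrier R"
    and e: "1 < e"
    and dec: "is_decomposition R f m m1 m2"
    and m1: "m1 = finprod R g {1..r}"
    and g: "\<And>i. i \<in> {1..r} \<Longrightarrow> g i \<in> carrier R"
    and bez: "\<And>i j. i \<in> {1..r} \<Longrightarrow> j \<in> {1..r} \<Longrightarrow> i \<noteq> j \<Longrightarrow> bezout (g i) (g j)"
    and local: "\<And>i. i \<in> {1..r} \<Longrightarrow>
      local_factor R p e (n i) (k i) (PIdl (g i)) (M i) f (G i) (w i)"
    and n_coprime: "\<And>i. i \<in> {1..r} \<Longrightarrow> coprime (n i) p"
    and divide: "\<And>i u. i \<in> {1..r} \<Longrightarrow> u \<in> carrier R \<Longrightarrow> \<pi> \<otimes> u \<in> PIdl (g i) \<Longrightarrow>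
      \<exists>a\<in>carrier R. u \<ominus> \<pi> [^] (e - 1) \<otimes> a \<in> PIdl (g i)"
    and proper: "\<And>i. i \<in> {1..r} \<Longrightarrow> PIdl (g i) \<subseteq> M i" "\<And>i. i \<in> {1..r} \<Longrightarrow> \<one> \<notin> M i"
begin

definition level_at :: "nat \<Rightarrow> 'a \<Rightarrow> nat" where
  "level_at i = local_factor.level R p (n i) (PIdl (g i)) f"

definition ladder_lcm :: "(nat \<Rightarrow> nat) \<Rightarrow> nat" where
  "ladder_lcm c = (LCM i\<in>{1..r}. ladder p (n i) (c i))"

lemma \<pi>_closed [simp]: "\<pi> \<in> carrier R"
  by (simp add: \<pi>_def)

lemma ladder_pos: "i \<in> {1..r} \<Longrightarrow> 0 < ladder p (n i) c"
  using local_factor.n_pos[OF local] local_factor.prime[OF local] prime_gt_0_nat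
  by (cases c) auto

lemma ladder_lcm_pos: "0 < ladder_lcm c"
proof -
  have "0 \<notin> (\<lambda>i. ladder p (n i) (c i)) ` {1..r}"
  proof
    assume "0 \<in> (\<lambda>i. ladder p (n i) (c i)) ` {1..r}"
    then obtain i where "i \<in> {1..r}" "ladder p (n i) (c i) = 0" by auto
    then show False using ladder_pos[of i "c i"] by simp
  qed
  then have "ladder_lcm c \<noteq> 0" unfolding ladder_lcm_def by (simp add: Lcm_0_iff)
  then show ?thesis by simp
qed

lemma returns_iff_dvd:
  assumes z: "z \<in> carrier R"
  shows "returns f m z l \<longleftrightarrow> ladder_lcm (\<lambda>i. level_at i z) dvd l"
proof -
  have "returns f m z l \<longleftrightarrow> (\<forall>i\<in>{1..r}. l \<in> fixing (PIdl (g i)) f z)"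
    using g bez by (intro returns_iff[OF f z dec m1]) auto
  also have "\<dots> \<longleftrightarrow> (\<forall>i\<in>{1..r}. ladder p (n i) (level_at i z) dvd l)"
    unfolding level_at_def using local_factor.fixing_iff_ladder[OF local z] by blast
  also have "\<dots> \<longleftrightarrow> ladder_lcm (\<lambda>i. level_at i z) dvd l"
    unfolding ladder_lcm_def by (auto simp: Lcm_dvd_iff)
  finally show ?thesis .
qed

lemma per_coset:
  assumes z: "z \<in> carrier R"
  shows "per (mult_map R f m) (PIdl m +> z) = ladder_lcm (\<lambda>i. level_at i z)"
  using per_mult_map[OF f m z ladder_lcm_pos] returns_iff_dvd[OF z] by blast

text \<open>
  Inside each factor all levels up to that of \<open>d\<close> occur among the multiples of \<open>d\<close>, and the Chinese
  remainder theorem combines independent choices in the factors into one multiple of \<open>d\<close>.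
\<close>

lemma periods_of_multiples:
  assumes d: "d \<in> carrier R"
  shows "(\<lambda>a. per (mult_map R f m) (PIdl m +> a \<otimes> d)) ` carrier R =
    ladder_lcm ` {c. \<forall>i\<in>{1..r}. c i \<le> level_at i d}" (is "?P = ?L")
proof (intro equalityI subsetI)
  fix x assume "x \<in> ?P"
  then obtain a where a: "a \<in> carrier R" "x = ladder_lcm (\<lambda>i. level_at i (a \<otimes> d))"
    using per_coset d by auto
  moreover have "\<forall>i\<in>{1..r}. level_at i (a \<otimes> d) \<le> level_at i d"
    unfolding level_at_def using local_factor.level_mult_le[OF local a(1) d] by blast
  ultimately show "x \<in> ?L" by blast
next
  fix x assume "x \<in> ?L"
  then obtain c where c: "x = ladder_lcm c" "\<forall>i\<in>{1..r}. c i \<le> level_at i d" by blast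
  have "\<forall>i\<in>{1..r}. \<exists>a\<in>carrier R. level_at i (a \<otimes> d) = c i"
    unfolding level_at_def using local_factor.level_attained[OF local d] c(2)
    unfolding level_at_def by blast
  then obtain a where a: "\<And>i. i \<in> {1..r} \<Longrightarrow> a i \<in> carrier R"
    "\<And>i. i \<in> {1..r} \<Longrightarrow> level_at i (a i \<otimes> d) = c i" by metis
  obtain b where b: "b \<in> carrier R" "\<forall>i\<in>{1..r}. b \<ominus> a i \<in> PIdl (g i)"
    using chinese_remainder_principal[of "{1..r}" g a] g a(1) bez by auto
  have "level_at i (b \<otimes> d) = c i" if i: "i \<in> {1..r}" for i
  proof -
    have "(b \<ominus> a i) \<otimes> d \<in> PIdl (g i)"
      using b(2) i d ideal.I_r_closed[OF cgenideal_ideal[OF g[OF i]]] by blast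
    moreover have "b \<otimes> d \<ominus> a i \<otimes> d = (b \<ominus> a i) \<otimes> d" using b(1) a(1)[OF i] d by algebra
    ultimately have "level_at i (b \<otimes> d) = level_at i (a i \<otimes> d)"
      unfolding level_at_def using b(1) a(1)[OF i] d
      by (intro local_factor.level_cong[OF local[OF i]]) auto
    then show ?thesis using a(2)[OF i] by simp
  qed
  then have "x = ladder_lcm (\<lambda>i. level_at i (b \<otimes> d))"
    unfolding c(1) ladder_lcm_def by (intro arg_cong[of _ _ Lcm] image_cong) auto
  then show "x \<in> ?P" using per_coset b(1) d by (intro image_eqI[of _ _ b]) auto
qed

lemma mod_order_eq:
  assumes i: "i \<in> {1..r}"
  shows "mod_order R f (g i) = ladder p (n i) (level_at i \<one>)"
proof -
  have "f [^] l \<ominus> \<one> \<in> PIdl (g i) \<longleftrightarrow> ladder p (n i) (level_at i \<one>) dvd l" for l :: nat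
    using local_factor.fixing_iff_ladder[OF local[OF i] one_closed, of l]
    by (simp add: fixing_def level_at_def)
  then show ?thesis
    unfolding mod_order_def using ladder_pos[OF i] by (intro Least_equality) (auto dest: dvd_imp_le)
qed

text \<open>
  All classes are multiples of \<open>\<one>\<close>, so the left-hand side consists of the least common multiples with
  levels bounded by those of \<open>\<one>\<close>. These bounds exceed the levels of \<open>\<pi>\<close> by at most one, and the
  order of \<open>f\<close> modulo \<open>g i\<close> is the period of the class of \<open>\<one>\<close>.
\<close>

theorem cycle_lengths_mult_map:
  "cycle_lengths (mult_map R f m) (carrier (quot_by R m)) =
    (\<lambda>a. per (mult_map R f m) (PIdl m +> a \<otimes> \<pi>)) ` carrier R \<union>
    big_lcm_prod (\<lambda>i. {1, mod_order R f (g i)}) r"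
proof -
  have "cycle_lengths (mult_map R f m) (carrier (quot_by R m)) =
    (\<lambda>a. per (mult_map R f m) (PIdl m +> a \<otimes> \<one>)) ` carrier R"
    unfolding cycle_lengths_def carrier_quot_by image_image by (intro image_cong) auto
  also have "\<dots> = ladder_lcm ` {c. \<forall>i\<in>{1..r}. c i \<le> level_at i \<one>}"
    by (rule periods_of_multiples) simp
  also have "\<dots> = ladder_lcm ` {c. \<forall>i\<in>{1..r}. c i \<le> level_at i \<pi>} \<union>
      ladder_lcm ` {c. \<forall>i\<in>{1..r}. c i \<in> {0, level_at i \<one>}}"
    unfolding ladder_lcm_def
  proof (rule ladder_lcms_decomposition)
    fix i assume i: "i \<in> {1..r}"
    interpret L: local_factor R p e "n i" "k i" "PIdl (g i)" "M i" f "G i" "w i" "[p] \<cdot> \<one>"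
      using local[OF i] by simp_all
    show "1 \<le> level_at i \<pi>" "level_at i \<one> \<le> Suc (level_at i \<pi>)"
      using L.level_one_le[OF e _ proper[OF i]] divide[OF i]
      unfolding level_at_def \<pi>_def by blast+
    show "level_at i \<pi> \<le> level_at i \<one>"
      using L.level_mult_le[of \<pi> \<one>] unfolding level_at_def by simp
  qed (use n_coprime in auto)
  also have "ladder_lcm ` {c. \<forall>i\<in>{1..r}. c i \<le> level_at i \<pi>} =
    (\<lambda>a. per (mult_map R f m) (PIdl m +> a \<otimes> \<pi>)) ` carrier R"
    by (rule periods_of_multiples[symmetric]) simp
  also have "ladder_lcm ` {c. \<forall>i\<in>{1..r}. c i \<in> {0, level_at i \<one>}} =
    big_lcm_prod (\<lambda>i. {1, mod_order R f (g i)}) r" (is "?A = ?B")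
  proof (intro equalityI subsetI)
    fix x assume "x \<in> ?A"
    then obtain c where c: "x = ladder_lcm c" "\<forall>i\<in>{1..r}. c i \<in> {0, level_at i \<one>}" by blast
    then show "x \<in> ?B"
      unfolding big_lcm_prod_eq ladder_lcm_def
      by (intro CollectI exI[of _ "\<lambda>i. ladder p (n i) (c i)"]) (auto simp: mod_order_eq)
  next
    fix x assume "x \<in> ?B"
    then obtain y where y: "x = (LCM i\<in>{1..r}. y i)" "\<forall>i\<in>{1..r}. y i \<in> {1, mod_order R f (g i)}"
      unfolding big_lcm_prod_eq by blast
    define c where "c i = (if y i = 1 then 0 else level_at i \<one>)" for i
    have "x = ladder_lcm c"
      unfolding y(1) ladder_lcm_def
      using y(2) by (intro arg_cong[of _ _ Lcm] image_cong) (auto simp: c_def mod_order_eq)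
    then show "x \<in> ?A" by (auto simp: c_def)
  qed
  finally show ?thesis .
qed

end

section \<open>Comparison with a quotient ring\<close>

text \<open>
  By \<open>mem\<close>, multiplication by \<open>d\<close> induces an embedding of \<open>S/(\<phi> m)\<close> into \<open>R/(m)\<close>. It commutes with
  multiplication by \<open>f\<close>, hence preserves periods.
\<close>

lemma cycle_lengths_via_quotient:
  assumes hom: "ring_hom_cring R S \<phi>" and surj: "carrier S \<subseteq> \<phi> ` carrier R"
    and f: "f \<in> carrier R" and m: "m \<in> carrier R" and d: "d \<in> carrier R"
    and mem: "\<And>z. z \<in> carrier R \<Longrightarrow> \<phi> z \<in> PIdl\<^bsub>S\<^esub> (\<phi> m) \<longleftrightarrow> z \<otimes>\<^bsub>R\<^esub> d \<in> PIdl\<^bsub>R\<^esub> m"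
    and per: "\<And>z. z \<in> carrier R \<Longrightarrow> \<exists>N>0. \<forall>l. cring.returns R f m z l \<longleftrightarrow> N dvd l"
  shows "cycle_lengths (mult_map S (\<phi> f) (\<phi> m)) (carrier (quot_by S (\<phi> m))) =
    (\<lambda>a. per (mult_map R f m) (PIdl\<^bsub>R\<^esub> m +>\<^bsub>R\<^esub> a \<otimes>\<^bsub>R\<^esub> d)) ` carrier R"
proof -
  interpret hom: ring_hom_cring R S \<phi> by fact
  have eq: "per (mult_map S (\<phi> f) (\<phi> m)) (PIdl\<^bsub>S\<^esub> (\<phi> m) +>\<^bsub>S\<^esub> \<phi> a) =
    per (mult_map R f m) (PIdl\<^bsub>R\<^esub> m +>\<^bsub>R\<^esub> a \<otimes>\<^bsub>R\<^esub> d)" if a: "a \<in> carrier R" for a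
  proof -
    obtain N where N: "N > 0" "\<And>l. hom.R.returns f m (a \<otimes>\<^bsub>R\<^esub> d) l \<longleftrightarrow> N dvd l"
      using per[of "a \<otimes>\<^bsub>R\<^esub> d"] a d by auto
    have "hom.S.returns (\<phi> f) (\<phi> m) (\<phi> a) l \<longleftrightarrow> hom.R.returns f m (a \<otimes>\<^bsub>R\<^esub> d) l" for l
      unfolding hom.S.returns_def hom.R.returns_def
    proof (intro ex_cong1)
      fix t :: nat
      let ?z = "f [^]\<^bsub>R\<^esub> t \<otimes>\<^bsub>R\<^esub> ((f [^]\<^bsub>R\<^esub> l \<ominus>\<^bsub>R\<^esub> \<one>\<^bsub>R\<^esub>) \<otimes>\<^bsub>R\<^esub> a)"
      have z: "?z \<in> carrier R" using f a by simp
      have "\<phi> ?z = \<phi> f [^]\<^bsub>S\<^esub> t \<otimes>\<^bsub>S\<^esub> ((\<phi> f [^]\<^bsub>S\<^esub> l \<ominus>\<^bsub>S\<^esub> \<one>\<^bsub>S\<^esub>) \<otimes>\<^bsub>S\<^esub> \<phi> a)"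
        using f a by (simp add: a_minus_def)
      moreover have "?z \<otimes>\<^bsub>R\<^esub> d = f [^]\<^bsub>R\<^esub> t \<otimes>\<^bsub>R\<^esub> ((f [^]\<^bsub>R\<^esub> l \<ominus>\<^bsub>R\<^esub> \<one>\<^bsub>R\<^esub>) \<otimes>\<^bsub>R\<^esub> (a \<otimes>\<^bsub>R\<^esub> d))"
        using f a d by (simp add: hom.R.m_assoc)
      ultimately show "\<phi> f [^]\<^bsub>S\<^esub> t \<otimes>\<^bsub>S\<^esub> ((\<phi> f [^]\<^bsub>S\<^esub> l \<ominus>\<^bsub>S\<^esub> \<one>\<^bsub>S\<^esub>) \<otimes>\<^bsub>S\<^esub> \<phi> a) \<in> PIdl\<^bsub>S\<^esub> (\<phi> m) \<longleftrightarrow>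
        f [^]\<^bsub>R\<^esub> t \<otimes>\<^bsub>R\<^esub> ((f [^]\<^bsub>R\<^esub> l \<ominus>\<^bsub>R\<^esub> \<one>\<^bsub>R\<^esub>) \<otimes>\<^bsub>R\<^esub> (a \<otimes>\<^bsub>R\<^esub> d)) \<in> PIdl\<^bsub>R\<^esub> m"
        using mem[OF z] by simp
    qed
    then have "per (mult_map S (\<phi> f) (\<phi> m)) (PIdl\<^bsub>S\<^esub> (\<phi> m) +>\<^bsub>S\<^esub> \<phi> a) = N"
      using hom.S.per_mult_map[of "\<phi> f" "\<phi> m" "\<phi> a" N] f m a N by simp
    moreover have "per (mult_map R f m) (PIdl\<^bsub>R\<^esub> m +>\<^bsub>R\<^esub> a \<otimes>\<^bsub>R\<^esub> d) = N"
      using hom.R.per_mult_map[of f m "a \<otimes>\<^bsub>R\<^esub> d" N] f m d a N by simp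
    ultimately show ?thesis by simp
  qed
  have S: "carrier S = \<phi> ` carrier R" using surj by auto
  show ?thesis
    unfolding cycle_lengths_def hom.S.carrier_quot_by S image_image
    by (intro image_cong refl eq)
qed

section \<open>Orders in finite fields\<close>

text \<open>
  The order of \<open>x\<close> divides \<open>q - 1\<close>, where \<open>q\<close> is the number of elements, and \<open>p\<close> divides \<open>q\<close> because it is
  the additive order of \<open>\<one>\<close>.
\<close>

lemma (in field) finite_field_order:
  assumes fin: "finite (carrier R)" and p: "Factorial_Ring.prime (p::nat)"
    and char: "[p] \<cdot> \<one> = \<zero>" and x: "x \<in> carrier R" "x \<noteq> \<zero>"
  shows "\<exists>n>0. coprime n p \<and> (\<forall>l::nat. x [^] l = \<one> \<longleftrightarrow> n dvd l)"
proof -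
  interpret mult: group "Multiplicative_Group.mult_of R" by (rule field_mult_group)
  let ?n = "mult.ord x"
  have x': "x \<in> carrier (Multiplicative_Group.mult_of R)" using x by simp
  have iff: "x [^] l = \<one> \<longleftrightarrow> ?n dvd l" for l :: nat
    using mult.pow_eq_id[OF x', of l] by (simp add: Multiplicative_Group.nat_pow_mult_of)
  have dvd: "?n dvd order R - 1"
    using mult.ord_dvd_group_order[OF x'] order_mult_of[OF fin] by simp
  have "add.ord \<one> dvd p"
    using add.pow_eq_id[OF one_closed, of p] char by (simp add: add_pow_def)
  moreover have "add.ord \<one> \<noteq> 1"
    using add.pow_eq_id[OF one_closed, of 1] by (simp del: add.ord_eq_1)
  ultimately have "add.ord \<one> = p" using p by (metis prime_nat_iff)
  then have "p dvd order R"
    using add.ord_dvd_group_order[OF one_closed] by (simp add: order_def)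
  have "order R > 0" using fin by (simp add: order_gt_0_iff_finite)
  have "coprime (order R - 1) p"
    using \<open>p dvd order R\<close> \<open>order R > 0\<close>
    by (metis coprime_diff_one_left_nat coprime_divisors dvd_refl)
  then have "coprime ?n p" by (rule coprime_divisors[OF dvd dvd_refl])
  moreover have "?n > 0"
  proof (rule ccontr)
    assume "\<not> ?n > 0"
    then have "order R - 1 = 0" using dvd by simp
    then show False
      using \<open>p dvd order R\<close> \<open>order R > 0\<close> prime_gt_1_nat[OF p] by (simp add: le_Suc_eq)
  qed
  ultimately show ?thesis using iff by blast
qed

section \<open>Lifting from the residue field\<close>

lemma (in ring_hom_cring) hom_nat_one: "h ([(n::nat)] \<cdot>\<^bsub>R\<^esub> \<one>\<^bsub>R\<^esub>) = [n] \<cdot>\<^bsub>S\<^esub> \<one>\<^bsub>S\<^esub>"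
  by (induction n) auto

text \<open>
  The model is \<open>A = R\<^sub>e[x]\<close> with reductions \<open>\<beta>\<close> to \<open>D = R\<^sub>1[x]\<close> and \<open>\<rho>\<close> to \<open>S = R\<^sub>e\<^sub>-\<^sub>1[x]\<close>. The last two
  assumptions make multiplication by \<open>\<pi>\<close> on \<open>A\<close> factor through an embedding of \<open>S\<close> and bound its kernel.
\<close>

locale residue_tower =
  A?: cring A + D: "domain" D + S: cring S + \<beta>: ring_hom_cring A D \<beta> + \<rho>: ring_hom_cring A S \<rho>
  for A (structure) and D (structure) and S (structure) and \<beta> \<rho> +
  fixes p e :: nat and \<pi>
  defines "\<pi> \<equiv> [p] \<cdot>\<^bsub>A\<^esub> \<one>\<^bsub>A\<^esub>"
  assumes p: "Factorial_Ring.prime p" and e: "1 < e"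
    and \<beta>_surj: "\<And>y. y \<in> carrier D \<Longrightarrow> \<exists>x\<in>carrier A. \<beta> x = y"
    and \<rho>_surj: "\<And>y. y \<in> carrier S \<Longrightarrow> \<exists>x\<in>carrier A. \<rho> x = y"
    and nilpotent: "\<pi> [^]\<^bsub>A\<^esub> e = \<zero>\<^bsub>A\<^esub>"
    and char_D: "[p] \<cdot>\<^bsub>D\<^esub> \<one>\<^bsub>D\<^esub> = \<zero>\<^bsub>D\<^esub>"
    and \<beta>_kernel: "\<And>a. a \<in> carrier A \<Longrightarrow> \<beta> a = \<zero>\<^bsub>D\<^esub> \<Longrightarrow> a \<in> PIdl\<^bsub>A\<^esub> \<pi>"
    and \<rho>_kernel: "\<And>a. a \<in> carrier A \<Longrightarrow> \<rho> a = \<zero>\<^bsub>S\<^esub> \<longleftrightarrow> \<pi> \<otimes>\<^bsub>A\<^esub> a = \<zero>\<^bsub>A\<^esub>"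
    and annihilator: "\<And>a. a \<in> carrier A \<Longrightarrow> \<pi> \<otimes>\<^bsub>A\<^esub> a = \<zero>\<^bsub>A\<^esub> \<Longrightarrow> a \<in> PIdl\<^bsub>A\<^esub> (\<pi> [^]\<^bsub>A\<^esub> (e - 1))"
begin

lemma \<pi>_closed [simp]: "\<pi> \<in> carrier A"
  by (simp add: \<pi>_def)

lemma \<beta>_\<pi>: "\<beta> \<pi> = \<zero>\<^bsub>D\<^esub>"
  unfolding \<pi>_def \<beta>.hom_nat_one by (rule char_D)

text \<open>
  If \<open>\<pi> u = q g\<close>, then \<open>q\<close> vanishes in the domain \<open>D\<close>, where \<open>g\<close> does not. So \<open>q = q' \<pi>\<close>, and
  \<open>\<pi>\<close> annihilates \<open>u - q' g\<close>.
\<close>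

lemma divide_\<pi>:
  assumes g: "g \<in> carrier A" "\<beta> g \<noteq> \<zero>\<^bsub>D\<^esub>" and u: "u \<in> carrier A" "\<pi> \<otimes>\<^bsub>A\<^esub> u \<in> PIdl\<^bsub>A\<^esub> g"
  shows "\<exists>a\<in>carrier A. u \<ominus>\<^bsub>A\<^esub> \<pi> [^]\<^bsub>A\<^esub> (e - 1) \<otimes>\<^bsub>A\<^esub> a \<in> PIdl\<^bsub>A\<^esub> g"
proof -
  obtain q where q: "q \<in> carrier A" "\<pi> \<otimes>\<^bsub>A\<^esub> u = q \<otimes>\<^bsub>A\<^esub> g" using u(2) A.mem_PIdl_iff by blast
  have "\<beta> q \<otimes>\<^bsub>D\<^esub> \<beta> g = \<beta> (\<pi> \<otimes>\<^bsub>A\<^esub> u)" unfolding q(2) using q(1) g(1) by simp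
  also have "\<dots> = \<zero>\<^bsub>D\<^esub>" using u(1) by (simp add: \<beta>_\<pi>)
  finally have "\<beta> q = \<zero>\<^bsub>D\<^esub>" using D.integral g q(1) \<beta>.hom_closed by blast
  then obtain q' where q': "q' \<in> carrier A" "q = q' \<otimes>\<^bsub>A\<^esub> \<pi>"
    using \<beta>_kernel[OF q(1)] A.mem_PIdl_iff by blast
  have "\<pi> \<otimes>\<^bsub>A\<^esub> (u \<ominus>\<^bsub>A\<^esub> q' \<otimes>\<^bsub>A\<^esub> g) = \<pi> \<otimes>\<^bsub>A\<^esub> u \<ominus>\<^bsub>A\<^esub> q' \<otimes>\<^bsub>A\<^esub> \<pi> \<otimes>\<^bsub>A\<^esub> g"
    using u(1) q'(1) g(1) \<pi>_closed by algebra
  also have "\<dots> = \<zero>\<^bsub>A\<^esub>" unfolding q(2) q'(2) using q' g by (simp add: a_minus_def A.r_neg)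
  finally have "u \<ominus>\<^bsub>A\<^esub> q' \<otimes>\<^bsub>A\<^esub> g \<in> PIdl\<^bsub>A\<^esub> (\<pi> [^]\<^bsub>A\<^esub> (e - 1))"
    using annihilator u(1) q'(1) g(1) by simp
  then obtain a where a: "a \<in> carrier A" "u \<ominus>\<^bsub>A\<^esub> q' \<otimes>\<^bsub>A\<^esub> g = a \<otimes>\<^bsub>A\<^esub> \<pi> [^]\<^bsub>A\<^esub> (e - 1)"
    using A.mem_PIdl_iff by blast
  have "u = q' \<otimes>\<^bsub>A\<^esub> g \<oplus>\<^bsub>A\<^esub> (u \<ominus>\<^bsub>A\<^esub> q' \<otimes>\<^bsub>A\<^esub> g)" using u(1) q'(1) g(1) by algebra
  then have "u \<ominus>\<^bsub>A\<^esub> \<pi> [^]\<^bsub>A\<^esub> (e - 1) \<otimes>\<^bsub>A\<^esub> a =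
    q' \<otimes>\<^bsub>A\<^esub> g \<oplus>\<^bsub>A\<^esub> a \<otimes>\<^bsub>A\<^esub> \<pi> [^]\<^bsub>A\<^esub> (e - 1) \<ominus>\<^bsub>A\<^esub> \<pi> [^]\<^bsub>A\<^esub> (e - 1) \<otimes>\<^bsub>A\<^esub> a"
    unfolding a(2) by simp
  also have "\<dots> = q' \<otimes>\<^bsub>A\<^esub> g"
  proof -
    have "\<pi> [^]\<^bsub>A\<^esub> (e - 1) \<in> carrier A" by simp
    then show ?thesis using q'(1) g(1) a(1) by algebra
  qed
  finally show ?thesis unfolding A.mem_PIdl_iff using q'(1) a(1) by blast
qed

text \<open>
  Multiplication by \<open>\<pi>\<close> embeds \<open>S/(\<rho> m)\<close> into \<open>A/(m)\<close>, so the periods at the lower level are the periods of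
  the multiples of \<open>\<pi>\<close> at the upper level.
\<close>

lemma \<rho>_mem_iff:
  assumes m: "m \<in> carrier A" "\<beta> m \<noteq> \<zero>\<^bsub>D\<^esub>" and z: "z \<in> carrier A"
  shows "\<rho> z \<in> PIdl\<^bsub>S\<^esub> (\<rho> m) \<longleftrightarrow> z \<otimes>\<^bsub>A\<^esub> \<pi> \<in> PIdl\<^bsub>A\<^esub> m"
proof
  assume "\<rho> z \<in> PIdl\<^bsub>S\<^esub> (\<rho> m)"
  then obtain c' where c': "c' \<in> carrier S" "\<rho> z = c' \<otimes>\<^bsub>S\<^esub> \<rho> m" using S.mem_PIdl_iff by blast
  then obtain c where c: "c \<in> carrier A" "\<rho> c = c'" using \<rho>_surj by blast
  have "\<rho> (z \<ominus>\<^bsub>A\<^esub> c \<otimes>\<^bsub>A\<^esub> m) = \<zero>\<^bsub>S\<^esub>"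
    using c c' m z by (simp add: a_minus_def S.r_neg)
  moreover have "z \<ominus>\<^bsub>A\<^esub> c \<otimes>\<^bsub>A\<^esub> m \<in> carrier A" using c(1) m(1) z by simp
  ultimately have zero: "\<pi> \<otimes>\<^bsub>A\<^esub> (z \<ominus>\<^bsub>A\<^esub> c \<otimes>\<^bsub>A\<^esub> m) = \<zero>\<^bsub>A\<^esub>" using \<rho>_kernel by blast
  have "z \<otimes>\<^bsub>A\<^esub> \<pi> = c \<otimes>\<^bsub>A\<^esub> \<pi> \<otimes>\<^bsub>A\<^esub> m \<oplus>\<^bsub>A\<^esub> \<pi> \<otimes>\<^bsub>A\<^esub> (z \<ominus>\<^bsub>A\<^esub> c \<otimes>\<^bsub>A\<^esub> m)"
    using c(1) m(1) z \<pi>_closed by algebra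
  also have "\<dots> = c \<otimes>\<^bsub>A\<^esub> \<pi> \<otimes>\<^bsub>A\<^esub> m" unfolding zero using c(1) m(1) by simp
  finally show "z \<otimes>\<^bsub>A\<^esub> \<pi> \<in> PIdl\<^bsub>A\<^esub> m" unfolding A.mem_PIdl_iff using c(1) by (intro bexI[of _ "c \<otimes>\<^bsub>A\<^esub> \<pi>"]) auto
next
  assume "z \<otimes>\<^bsub>A\<^esub> \<pi> \<in> PIdl\<^bsub>A\<^esub> m"
  then have "\<pi> \<otimes>\<^bsub>A\<^esub> z \<in> PIdl\<^bsub>A\<^esub> m" using z by (simp add: A.m_comm)
  then obtain a where a: "a \<in> carrier A" "z \<ominus>\<^bsub>A\<^esub> \<pi> [^]\<^bsub>A\<^esub> (e - 1) \<otimes>\<^bsub>A\<^esub> a \<in> PIdl\<^bsub>A\<^esub> m"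
    using divide_\<pi>[OF m z] by blast
  then obtain c where c: "c \<in> carrier A" "z \<ominus>\<^bsub>A\<^esub> \<pi> [^]\<^bsub>A\<^esub> (e - 1) \<otimes>\<^bsub>A\<^esub> a = c \<otimes>\<^bsub>A\<^esub> m"
    using A.mem_PIdl_iff by blast
  have "e = Suc (e - 1)" using e by simp
  then have "\<pi> \<otimes>\<^bsub>A\<^esub> \<pi> [^]\<^bsub>A\<^esub> (e - 1) = \<zero>\<^bsub>A\<^esub>"
    using nilpotent by (metis A.m_comm A.nat_pow_Suc A.nat_pow_closed \<pi>_closed)
  note zero = this
  define q where "q = \<pi> [^]\<^bsub>A\<^esub> (e - 1)"
  have "q \<in> carrier A" by (simp add: q_def)
  then have q: "q \<in> carrier A" "\<rho> q = \<zero>\<^bsub>S\<^esub>" using \<rho>_kernel[of q] zero unfolding q_def by blast+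
  have "\<rho> (z \<ominus>\<^bsub>A\<^esub> q \<otimes>\<^bsub>A\<^esub> a) = \<rho> z"
    using z a(1) q by (simp add: a_minus_def)
  then have "\<rho> z = \<rho> c \<otimes>\<^bsub>S\<^esub> \<rho> m" using c q_def m(1) by simp
  then show "\<rho> z \<in> PIdl\<^bsub>S\<^esub> (\<rho> m)" unfolding S.mem_PIdl_iff using c(1) by auto
qed

text \<open>
  The ideal \<open>M\<close> is the kernel of the composite map from \<open>A\<close> to the field \<open>Q\<close>, a copy of \<open>D/(G)\<close>. Since
  \<open>g\<close> becomes a power of \<open>G\<close> modulo \<open>\<pi>\<close>, a power of a lift of \<open>G\<close> lies in the ideal generated by \<open>g\<close> and \<open>\<pi>\<close>.
\<close>

lemma local_factor_exists:
  assumes f: "f \<in> carrier A" and g: "g \<in> carrier A" and bez: "A.bezout f g"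
    and G: "G \<in> carrier D" "\<beta> g = G [^]\<^bsub>D\<^esub> k" and k: "1 \<le> k"
    and fld: "field Q" and fin: "finite (carrier Q)" and hom: "ring_hom_cring D Q \<theta>"
    and \<theta>_surj: "\<And>y. y \<in> carrier Q \<Longrightarrow> \<exists>x\<in>carrier D. \<theta> x = y"
    and \<theta>_kernel: "\<And>x. x \<in> carrier D \<Longrightarrow> \<theta> x = \<zero>\<^bsub>Q\<^esub> \<longleftrightarrow> x \<in> PIdl\<^bsub>D\<^esub> G"
  shows "\<exists>n M G' w. local_factor A p e n k (PIdl\<^bsub>A\<^esub> g) M f G' w \<and> coprime n p \<and>
    PIdl\<^bsub>A\<^esub> g \<subseteq> M \<and> \<one>\<^bsub>A\<^esub> \<notin> M"
proof -
  interpret Q: field Q by fact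
  interpret \<theta>: ring_hom_cring D Q \<theta> by fact
  define \<sigma> where "\<sigma> a = \<theta> (\<beta> a)" for a
  have "ring_hom_cring A Q \<sigma>"
    by (rule ring_hom_cringI[OF A.is_cring Q.is_cring])
      (auto simp: \<sigma>_def intro!: ring_hom_memI)
  then interpret \<sigma>: ring_hom_cring A Q \<sigma> .
  have \<sigma>_surj: "\<exists>x\<in>carrier A. \<sigma> x = y" if "y \<in> carrier Q" for y
    using \<theta>_surj[OF that] \<beta>_surj unfolding \<sigma>_def by metis
  have \<sigma>_0: "\<sigma> a = \<zero>\<^bsub>Q\<^esub> \<longleftrightarrow> \<beta> a \<in> PIdl\<^bsub>D\<^esub> G" if "a \<in> carrier A" for a
    unfolding \<sigma>_def using \<theta>_kernel that by blast
  obtain G' where G': "G' \<in> carrier A" "\<beta> G' = G" using \<beta>_surj G(1) by blast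
  define M where "M = {a \<in> carrier A. \<sigma> a = \<zero>\<^bsub>Q\<^esub>}"
  have M: "ideal M A"
    using ring_hom_ring.kernel_is_ideal[OF ring_hom_ringI2[OF A.ring_axioms Q.ring_axioms \<sigma>.homh]]
    unfolding M_def a_kernel_def' .
  have "\<beta> g \<in> PIdl\<^bsub>D\<^esub> G"
  proof -
    obtain k' where "k = Suc k'" using k by (cases k) auto
    then show ?thesis unfolding G(2) using G(1) by (auto simp: D.mem_PIdl_iff)
  qed
  then have gM: "g \<in> M" using \<sigma>_0[OF g] g unfolding M_def by blast
  then have sub: "PIdl\<^bsub>A\<^esub> g \<subseteq> M" by (rule A.cgenideal_minimal[OF M])
  have oneM: "\<one>\<^bsub>A\<^esub> \<notin> M"
    using \<sigma>.hom_one Q.one_not_zero unfolding M_def by force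
  have "\<sigma> f \<noteq> \<zero>\<^bsub>Q\<^esub>"
  proof
    assume "\<sigma> f = \<zero>\<^bsub>Q\<^esub>"
    then have "f \<in> M" using f by (simp add: M_def)
    then have "\<one>\<^bsub>A\<^esub> \<in> M"
      using bez gM unfolding A.bezout_def 
      by (metis ideal.I_r_closed[OF M] additive_subgroup.a_closed[OF ideal.axioms(1)[OF M]])
    then show False using oneM by simp
  qed
  moreover have char_Q: "[p] \<cdot>\<^bsub>Q\<^esub> \<one>\<^bsub>Q\<^esub> = \<zero>\<^bsub>Q\<^esub>"
    using \<theta>.hom_nat_one[of p] char_D \<theta>.hom_zero by simp
  ultimately obtain n where n: "n > 0" "coprime n p"
    "\<And>l::nat. \<sigma> f [^]\<^bsub>Q\<^esub> l = \<one>\<^bsub>Q\<^esub> \<longleftrightarrow> n dvd l"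
    using Q.finite_field_order[OF fin p, of "\<sigma> f"] f by auto
  have "\<beta> (g \<ominus>\<^bsub>A\<^esub> G' [^]\<^bsub>A\<^esub> k) = \<zero>\<^bsub>D\<^esub>"
    using g G' G by (simp add: a_minus_def D.r_neg)
  then obtain w where w: "w \<in> carrier A" "g \<ominus>\<^bsub>A\<^esub> G' [^]\<^bsub>A\<^esub> k = w \<otimes>\<^bsub>A\<^esub> \<pi>"
    using \<beta>_kernel[of "g \<ominus>\<^bsub>A\<^esub> G' [^]\<^bsub>A\<^esub> k"] g G' A.mem_PIdl_iff by auto
  have "local_factor A p e n k (PIdl\<^bsub>A\<^esub> g) M f G' w"
    unfolding local_factor_def local_factor_axioms_def \<pi>_def[symmetric]
  proof (intro conjI allI impI)
    have "G' [^]\<^bsub>A\<^esub> k \<oplus>\<^bsub>A\<^esub> \<pi> \<otimes>\<^bsub>A\<^esub> w = G' [^]\<^bsub>A\<^esub> k \<oplus>\<^bsub>A\<^esub> (g \<ominus>\<^bsub>A\<^esub> G' [^]\<^bsub>A\<^esub> k)"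
      unfolding w(2) using w(1) by (simp add: A.m_comm)
    also have "\<dots> = g"
    proof -
      have "G' [^]\<^bsub>A\<^esub> k \<in> carrier A" using G' by simp
      then show ?thesis using g by algebra
    qed
    finally show "G' [^]\<^bsub>A\<^esub> k \<oplus>\<^bsub>A\<^esub> \<pi> \<otimes>\<^bsub>A\<^esub> w \<in> PIdl\<^bsub>A\<^esub> g"
      using A.cgenideal_self[OF g] by simp
    show "\<pi> \<in> M" by (simp add: M_def \<sigma>_def \<beta>_\<pi>)
    show "G' \<in> M"
      using \<sigma>_0[OF G'(1)] G'(1) D.cgenideal_self[OF G(1)] unfolding M_def G'(2) by blast
    show "(f [^]\<^bsub>A\<^esub> l \<ominus>\<^bsub>A\<^esub> \<one>\<^bsub>A\<^esub> \<in> M) = (n dvd l)" for l :: nat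
    proof -
      have "\<sigma> (f [^]\<^bsub>A\<^esub> l \<ominus>\<^bsub>A\<^esub> \<one>\<^bsub>A\<^esub>) = \<sigma> f [^]\<^bsub>Q\<^esub> l \<ominus>\<^bsub>Q\<^esub> \<one>\<^bsub>Q\<^esub>"
        using f by (simp add: a_minus_def)
      then show ?thesis using f n(3)[of l] by (simp add: M_def)
    qed
  next
    fix x assume x: "x \<in> M"
    then have xA: "x \<in> carrier A" by (simp add: M_def)
    obtain c' where c': "c' \<in> carrier D" "\<beta> x = c' \<otimes>\<^bsub>D\<^esub> G"
      using x \<sigma>_0[OF xA] unfolding M_def D.mem_PIdl_iff by blast
    then obtain c where c: "c \<in> carrier A" "\<beta> c = c'" using \<beta>_surj by blast
    have "\<beta> (x \<ominus>\<^bsub>A\<^esub> c \<otimes>\<^bsub>A\<^esub> G') = \<zero>\<^bsub>D\<^esub>"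
      using xA c c' G' G by (simp add: a_minus_def D.r_neg)
    then obtain a where a: "a \<in> carrier A" "x \<ominus>\<^bsub>A\<^esub> c \<otimes>\<^bsub>A\<^esub> G' = a \<otimes>\<^bsub>A\<^esub> \<pi>"
      using \<beta>_kernel[of "x \<ominus>\<^bsub>A\<^esub> c \<otimes>\<^bsub>A\<^esub> G'"] xA c G' A.mem_PIdl_iff by auto
    have "x = (x \<ominus>\<^bsub>A\<^esub> c \<otimes>\<^bsub>A\<^esub> G') \<oplus>\<^bsub>A\<^esub> c \<otimes>\<^bsub>A\<^esub> G'" using xA c(1) G'(1) by algebra
    then show "\<exists>a\<in>carrier A. \<exists>b\<in>carrier A. x = a \<otimes>\<^bsub>A\<^esub> \<pi> \<oplus>\<^bsub>A\<^esub> b \<otimes>\<^bsub>A\<^esub> G'"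
      unfolding a(2) using a(1) c(1) by blast
  next
    fix a assume a: "a \<in> carrier A" "a \<notin> M"
    then have "\<sigma> a \<in> Units Q" unfolding Q.field_Units by (simp add: M_def)
    then obtain b' where b': "b' \<in> carrier Q" "b' \<otimes>\<^bsub>Q\<^esub> \<sigma> a = \<one>\<^bsub>Q\<^esub>"
      using Q.Units_l_inv_ex by blast
    then obtain b where b: "b \<in> carrier A" "\<sigma> b = b'" using \<sigma>_surj by blast
    have "\<sigma> (b \<otimes>\<^bsub>A\<^esub> a \<ominus>\<^bsub>A\<^esub> \<one>\<^bsub>A\<^esub>) = \<sigma> b \<otimes>\<^bsub>Q\<^esub> \<sigma> a \<ominus>\<^bsub>Q\<^esub> \<one>\<^bsub>Q\<^esub>"
      using a b(1) by (simp add: a_minus_def)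
    then have "b \<otimes>\<^bsub>A\<^esub> a \<ominus>\<^bsub>A\<^esub> \<one>\<^bsub>A\<^esub> \<in> M"
      using a b b' by (simp add: M_def a_minus_def Q.r_neg)
    then show "\<exists>b\<in>carrier A. b \<otimes>\<^bsub>A\<^esub> a \<ominus>\<^bsub>A\<^esub> \<one>\<^bsub>A\<^esub> \<in> M" using b(1) by blast
  qed (use f g G' w p n nilpotent A.is_cring A.cgenideal_ideal M in auto)
  then show ?thesis using n(2) sub oneM by blast
qed

theorem cycle_lengths_step:
  fixes r :: nat and k :: "nat \<Rightarrow> nat"
  assumes f: "f \<in> carrier A" and m: "m \<in> carrier A" "\<beta> m \<noteq> \<zero>\<^bsub>D\<^esub>"
    and dec: "is_decomposition A f m m1 m2"
    and m1: "m1 = finprod A g {1..r}"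
    and g: "\<And>i. i \<in> {1..r} \<Longrightarrow> g i \<in> carrier A"
    and cop: "\<And>i j. i \<in> {1..r} \<Longrightarrow> j \<in> {1..r} \<Longrightarrow> i \<noteq> j \<Longrightarrow> gen_coprime A (g i) (g j)"
    and G: "\<And>i. i \<in> {1..r} \<Longrightarrow> G i \<in> carrier D"
    and k: "\<And>i. i \<in> {1..r} \<Longrightarrow> 1 \<le> k i"
    and power: "\<And>i. i \<in> {1..r} \<Longrightarrow> \<beta> (g i) = G i [^]\<^bsub>D\<^esub> k i"
    and nonzero: "\<And>i. i \<in> {1..r} \<Longrightarrow> G i \<noteq> \<zero>\<^bsub>D\<^esub>"
    and fld: "\<And>i. i \<in> {1..r} \<Longrightarrow> field (D Quot PIdl\<^bsub>D\<^esub> (G i))"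
    and fin: "\<And>i. i \<in> {1..r} \<Longrightarrow> finite (carrier (D Quot PIdl\<^bsub>D\<^esub> (G i)))"
  shows "cycle_lengths (mult_map A f m) (carrier (quot_by A m)) =
    cycle_lengths (mult_map S (\<rho> f) (\<rho> m)) (carrier (quot_by S (\<rho> m))) \<union>
    big_lcm_prod (\<lambda>i. {1, mod_order A f (g i)}) r"
proof -
  have m12: "m1 \<in> carrier A" "gen_coprime A f m1"
    using dec unfolding is_decomposition_def by auto
  have bez_f: "A.bezout f (g i)" if i: "i \<in> {1..r}" for i
  proof -
    obtain c where "c \<in> carrier A" "m1 = g i \<otimes>\<^bsub>A\<^esub> c"
      using A.factor_dvd_finprod[of "{1..r}" g i] g i m1 by auto
    then show ?thesis
      using A.bezout_factor[OF f g[OF i]] A.gen_coprime_imp_bezout[OF f m12] by blast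
  qed
  have "\<exists>n M G' w. local_factor A p e n (k i) (PIdl\<^bsub>A\<^esub> (g i)) M f G' w \<and> coprime n p \<and>
    PIdl\<^bsub>A\<^esub> (g i) \<subseteq> M \<and> \<one>\<^bsub>A\<^esub> \<notin> M" if i: "i \<in> {1..r}" for i
  proof (rule local_factor_exists[OF f g[OF i] bez_f[OF i] G[OF i] power[OF i] k[OF i] fld[OF i] fin[OF i]])
    interpret J: ideal "PIdl\<^bsub>D\<^esub> (G i)" D using G[OF i] by (rule D.cgenideal_ideal)
    show "ring_hom_cring D (D Quot PIdl\<^bsub>D\<^esub> (G i)) ((+>\<^bsub>D\<^esub>) (PIdl\<^bsub>D\<^esub> (G i)))"
      by (rule J.rcos_ring_hom_cring) (rule D.is_cring)
    show "\<exists>x\<in>carrier D. PIdl\<^bsub>D\<^esub> (G i) +>\<^bsub>D\<^esub> x = y" if "y \<in> carrier (D Quot PIdl\<^bsub>D\<^esub> (G i))" for y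
      using that unfolding FactRing_def A_RCOSETS_def' by auto
    show "(PIdl\<^bsub>D\<^esub> (G i) +>\<^bsub>D\<^esub> x = \<zero>\<^bsub>D Quot PIdl\<^bsub>D\<^esub> (G i)\<^esub>) = (x \<in> PIdl\<^bsub>D\<^esub> (G i))"
      if "x \<in> carrier D" for x
      using D.a_rcos_zero[OF J.is_ideal] J.rcos_const_imp_mem[OF that]
      unfolding FactRing_def by auto
  qed
  then obtain n M G' w where loc: "\<And>i. i \<in> {1..r} \<Longrightarrow>
      local_factor A p e (n i) (k i) (PIdl\<^bsub>A\<^esub> (g i)) (M i) f (G' i) (w i)"
    and cop_n: "\<And>i. i \<in> {1..r} \<Longrightarrow> coprime (n i) p"
    and M: "\<And>i. i \<in> {1..r} \<Longrightarrow> PIdl\<^bsub>A\<^esub> (g i) \<subseteq> M i" "\<And>i. i \<in> {1..r} \<Longrightarrow> \<one>\<^bsub>A\<^esub> \<notin> M i"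
    by metis
  have nz: "\<beta> (g i) \<noteq> \<zero>\<^bsub>D\<^esub>" if "i \<in> {1..r}" for i
  proof -
    have "G i [^]\<^bsub>D\<^esub> l \<noteq> \<zero>\<^bsub>D\<^esub>" for l :: nat
      by (induction l) (use G[OF that] nonzero[OF that] D.integral in auto)
    then show ?thesis using power[OF that] by simp
  qed
  have "factored_modulus A p e r n k M f m m1 m2 g G' w"
  proof (intro factored_modulus.intro factored_modulus_axioms.intro)
    show "A.bezout (g i) (g j)" if "i \<in> {1..r}" "j \<in> {1..r}" "i \<noteq> j" for i j
      using A.gen_coprime_imp_bezout[OF g g cop] that by blast
    show "\<exists>a\<in>carrier A. u \<ominus>\<^bsub>A\<^esub> ([p] \<cdot>\<^bsub>A\<^esub> \<one>\<^bsub>A\<^esub>) [^]\<^bsub>A\<^esub> (e - 1) \<otimes>\<^bsub>A\<^esub> a \<in> PIdl\<^bsub>A\<^esub> (g i)"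
      if "i \<in> {1..r}" "u \<in> carrier A" "[p] \<cdot>\<^bsub>A\<^esub> \<one>\<^bsub>A\<^esub> \<otimes>\<^bsub>A\<^esub> u \<in> PIdl\<^bsub>A\<^esub> (g i)" for i u
      using divide_\<pi>[OF g nz] that unfolding \<pi>_def by blast
  qed (use A.is_cring f m e dec m1 g loc cop_n M in blast)+
  then interpret F: factored_modulus A p e r n k M f m m1 m2 g G' w \<pi>
    by (simp_all add: \<pi>_def)
  have "cycle_lengths (mult_map S (\<rho> f) (\<rho> m)) (carrier (quot_by S (\<rho> m))) =
    (\<lambda>a. per (mult_map A f m) (PIdl\<^bsub>A\<^esub> m +>\<^bsub>A\<^esub> a \<otimes>\<^bsub>A\<^esub> \<pi>)) ` carrier A"
  proof (rule cycle_lengths_via_quotient[OF \<rho>.ring_hom_cring_axioms _ f m(1) \<pi>_closed])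
    show "carrier S \<subseteq> \<rho> ` carrier A" using \<rho>_surj by blast
    show "\<exists>N>0. \<forall>l. A.returns f m z l \<longleftrightarrow> N dvd l" if "z \<in> carrier A" for z
      using F.returns_iff_dvd[OF that] F.ladder_lcm_pos by blast
  qed (rule \<rho>_mem_iff[OF m])
  then show ?thesis using F.cycle_lengths_mult_map by simp
qed

end

section \<open>Coefficientwise homomorphisms\<close>

lemma (in cring) nat_one_mult: "[(a::nat)] \<cdot> \<one> \<otimes> [(b::nat)] \<cdot> \<one> = [(a * b)] \<cdot> \<one>"
proof (induction b)
  case 0
  then show ?case by simp
next
  case (Suc b)
  have "[(a * Suc b)] \<cdot> \<one> = [a] \<cdot> \<one> \<oplus> [(a * b)] \<cdot> \<one>"
    by (simp add: add.nat_pow_mult)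
  then show ?case using Suc by (simp add: r_distr a_comm)
qed

lemma (in cring) nat_one_power: "([(a::nat)] \<cdot> \<one>) [^] (e::nat) = [(a ^ e)] \<cdot> \<one>"
  by (induction e) (auto simp: nat_one_mult mult.commute)

lemma coeff_UP_eq: "a \<in> carrier (UP R) \<Longrightarrow> coeff (UP R) a n = a n"
  by (simp add: UP_def)

lemma UP_closed: "a \<in> carrier (UP R) \<Longrightarrow> a n \<in> carrier R"
  by (auto simp: UP_def)

lemma UP_mult_eq:
  "a \<in> carrier (UP R) \<Longrightarrow> b \<in> carrier (UP R) \<Longrightarrow>
    a \<otimes>\<^bsub>UP R\<^esub> b = (\<lambda>n. \<Oplus>\<^bsub>R\<^esub>i\<in>{..n}. a i \<otimes>\<^bsub>R\<^esub> b (n - i))"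
  by (simp add: UP_def)

lemma UP_add_eq:
  "a \<in> carrier (UP R) \<Longrightarrow> b \<in> carrier (UP R) \<Longrightarrow>
    a \<oplus>\<^bsub>UP R\<^esub> b = (\<lambda>n. a n \<oplus>\<^bsub>R\<^esub> b n)"
  by (simp add: UP_def)

lemma UP_one_eq: "\<one>\<^bsub>UP R\<^esub> = (\<lambda>n. if n = 0 then \<one>\<^bsub>R\<^esub> else \<zero>\<^bsub>R\<^esub>)"
  by (simp add: UP_def)

lemma UP_zero_eq: "\<zero>\<^bsub>UP R\<^esub> = (\<lambda>n. \<zero>\<^bsub>R\<^esub>)"
  by (simp add: UP_def)

text \<open>
  For coefficientwise constructions: \<open>b\<close> inherits finite support from \<open>a\<close>.
\<close>

lemma (in ring) UP_memI:
  assumes a: "a \<in> carrier (UP S)" and "\<And>n. b n \<in> carrier R"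
    and "\<And>n. a n = \<zero>\<^bsub>S\<^esub> \<Longrightarrow> b n = \<zero>"
  shows "b \<in> carrier (UP R)"
proof -
  obtain N where "bound \<zero>\<^bsub>S\<^esub> N a" using a by (auto simp: UP_def up_def)
  then have "bound \<zero> N b" using assms(3) by (auto simp: bound_def)
  then show ?thesis using assms(2) by (auto simp: UP_def)
qed

lemma (in UP_cring) nat_one_coeff_mult:
  assumes "a \<in> carrier P"
  shows "([(n::nat)] \<cdot>\<^bsub>P\<^esub> \<one>\<^bsub>P\<^esub> \<otimes>\<^bsub>P\<^esub> a) k = [n] \<cdot>\<^bsub>R\<^esub> \<one>\<^bsub>R\<^esub> \<otimes>\<^bsub>R\<^esub> a k"
proof -
  interpret c: ring_hom_cring R P "\<lambda>a. up_ring.monom P a 0"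
    by (rule ring_hom_cringI[OF R.is_cring UP_cring const_ring_hom])
  have "[n] \<cdot>\<^bsub>P\<^esub> \<one>\<^bsub>P\<^esub> \<otimes>\<^bsub>P\<^esub> a = ([n] \<cdot>\<^bsub>R\<^esub> \<one>\<^bsub>R\<^esub>) \<odot>\<^bsub>P\<^esub> a"
    using c.hom_nat_one[of n] assms by (simp add: monom_mult_is_smult[symmetric])
  moreover have "up_ring.coeff P (([n] \<cdot>\<^bsub>R\<^esub> \<one>\<^bsub>R\<^esub>) \<odot>\<^bsub>P\<^esub> a) k = [n] \<cdot>\<^bsub>R\<^esub> \<one>\<^bsub>R\<^esub> \<otimes>\<^bsub>R\<^esub> up_ring.coeff P a k"
    using assms by simp
  ultimately show ?thesis
    using assms unfolding P_def by (metis UP_smult_closed P_def R.add.nat_pow_closed R.one_closed coeff_UP_eq)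
qed

context ring_hom_cring
begin

lemma up_map_ring_hom: "ring_hom_cring (UP R) (UP S) (up_map h)"
proof -
  interpret UR: UP_cring R "UP R" by unfold_locales
  interpret US: UP_cring S "UP S" by unfold_locales
  have closed: "up_map h a \<in> carrier (UP S)" if "a \<in> carrier (UP R)" for a
  proof (rule S.UP_memI[OF that])
    fix n
    show "up_map h a n \<in> carrier S"
      unfolding up_map_def by (rule hom_closed[OF UP_closed[OF that]])
    show "a n = \<zero> \<Longrightarrow> up_map h a n = \<zero>\<^bsub>S\<^esub>"
      unfolding up_map_def by simp
  qed
  show ?thesis
  proof (rule ring_hom_cringI[OF UR.UP_cring US.UP_cring], rule ring_hom_memI)
    fix a b assume a: "a \<in> carrier (UP R)" and b: "b \<in> carrier (UP R)"
    have "h (\<Oplus>i\<in>{..n}. a i \<otimes> b (n - i)) = (\<Oplus>\<^bsub>S\<^esub>i\<in>{..n}. h (a i) \<otimes>\<^bsub>S\<^esub> h (b (n - i)))" for n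
    proof -
      have "h (\<Oplus>i\<in>{..n}. a i \<otimes> b (n - i)) = (\<Oplus>\<^bsub>S\<^esub>i\<in>{..n}. (h \<circ> (\<lambda>i. a i \<otimes> b (n - i))) i)"
        by (intro hom_finsum) (simp add: UP_closed[OF a] UP_closed[OF b])
      also have "\<dots> = (\<Oplus>\<^bsub>S\<^esub>i\<in>{..n}. h (a i) \<otimes>\<^bsub>S\<^esub> h (b (n - i)))"
        by (intro S.finsum_cong') (simp_all add: UP_closed[OF a] UP_closed[OF b])
      finally show ?thesis .
    qed
    then show "up_map h (a \<otimes>\<^bsub>UP R\<^esub> b) = up_map h a \<otimes>\<^bsub>UP S\<^esub> up_map h b"
      unfolding UP_mult_eq[OF a b] UP_mult_eq[OF closed[OF a] closed[OF b]]
      by (simp only: up_map_def)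
    show "up_map h (a \<oplus>\<^bsub>UP R\<^esub> b) = up_map h a \<oplus>\<^bsub>UP S\<^esub> up_map h b"
      unfolding UP_add_eq[OF a b] UP_add_eq[OF closed[OF a] closed[OF b]]
      using hom_add[OF UP_closed[OF a] UP_closed[OF b]] by (simp only: up_map_def)
  next
    show "up_map h \<one>\<^bsub>UP R\<^esub> = \<one>\<^bsub>UP S\<^esub>"
      by (simp add: UP_one_eq up_map_def fun_eq_iff)
  qed (rule closed)
qed

text \<open>
  Zero coefficients must be lifted to zero, or the lift would have infinite support. The same
  care is needed for the coefficientwise quotients in the next lemma.
\<close>

lemma up_map_surj:
  assumes surj: "\<And>y. y \<in> carrier S \<Longrightarrow> \<exists>x\<in>carrier R. h x = y" and b: "b \<in> carrier (UP S)"
  shows "\<exists>a\<in>carrier (UP R). up_map h a = b"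
proof -
  define a where "a n = (if b n = \<zero>\<^bsub>S\<^esub> then \<zero> else (SOME x. x \<in> carrier R \<and> h x = b n))" for n
  have a: "a n \<in> carrier R \<and> h (a n) = b n" for n
    using someI_ex[of "\<lambda>x. x \<in> carrier R \<and> h x = b n"] surj[OF UP_closed[OF b, of n]]
    by (auto simp: a_def)
  have "a \<in> carrier (UP R)" 
  proof (rule R.UP_memI[OF b])
    show "a n \<in> carrier R" for n using a by blast
    show "b n = \<zero>\<^bsub>S\<^esub> \<Longrightarrow> a n = \<zero>" for n by (simp add: a_def)
  qed
  moreover have "up_map h a = b" using a by (auto simp: up_map_def)
  ultimately show ?thesis by blast
qed

lemma up_map_kernel:
  assumes ker: "\<And>x. x \<in> carrier R \<Longrightarrow> h x = \<zero>\<^bsub>S\<^esub> \<Longrightarrow> x \<in> PIdl ([(n::nat)] \<cdot> \<one>)"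
    and a: "a \<in> carrier (UP R)" and zero: "up_map h a = \<zero>\<^bsub>UP S\<^esub>"
  shows "a \<in> PIdl\<^bsub>UP R\<^esub> ([n] \<cdot>\<^bsub>UP R\<^esub> \<one>\<^bsub>UP R\<^esub>)"
proof -
  interpret UR: UP_cring R "UP R" by unfold_locales
  define b where "b k = (if a k = \<zero> then \<zero> else (SOME y. y \<in> carrier R \<and> a k = y \<otimes> [n] \<cdot> \<one>))" for k
  have b: "b k \<in> carrier R \<and> a k = b k \<otimes> [n] \<cdot> \<one>" for k
  proof -
    have "h (a k) = \<zero>\<^bsub>S\<^esub>" using fun_cong[OF zero, of k] by (simp add: up_map_def UP_zero_eq)
    then have "\<exists>y. y \<in> carrier R \<and> a k = y \<otimes> [n] \<cdot> \<one>"
      using ker[OF UP_closed[OF a]] by (auto simp: cgenideal_def)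
    then show ?thesis
      using someI_ex[of "\<lambda>y. y \<in> carrier R \<and> a k = y \<otimes> [n] \<cdot> \<one>"] by (auto simp: b_def)
  qed
  have bP: "b \<in> carrier (UP R)" 
  proof (rule R.UP_memI[OF a])
    show "b n \<in> carrier R" for n using b by blast
    show "a n = \<zero> \<Longrightarrow> b n = \<zero>" for n by (simp add: b_def)
  qed
  have "a = [n] \<cdot>\<^bsub>UP R\<^esub> \<one>\<^bsub>UP R\<^esub> \<otimes>\<^bsub>UP R\<^esub> b"
    using UR.nat_one_coeff_mult[OF bP, of n] b by (intro ext) (metis R.add.nat_pow_closed R.m_comm R.one_closed)
  then have "a = b \<otimes>\<^bsub>UP R\<^esub> [n] \<cdot>\<^bsub>UP R\<^esub> \<one>\<^bsub>UP R\<^esub>"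
    using bP by (simp add: UR.P.m_comm)
  then show ?thesis using bP by (auto simp: cgenideal_def)
qed

end

section \<open>Irreducible polynomials over a finite field\<close>

locale UP_field = UP + R?: field R

sublocale UP_field < UP_domain
  by intro_locales [1] (rule P_def)

context UP_field
begin

lemma long_division:
  assumes g: "g \<in> carrier P" "g \<noteq> \<zero>\<^bsub>P\<^esub>" and a: "a \<in> carrier P"
  shows "\<exists>q\<in>carrier P. \<exists>s\<in>carrier P. a = g \<otimes>\<^bsub>P\<^esub> q \<oplus>\<^bsub>P\<^esub> s \<and> (s = \<zero>\<^bsub>P\<^esub> \<or> deg R s < deg R g)"
proof -
  obtain q s k where qs: "q \<in> carrier P" "s \<in> carrier P"
    "lcoeff g [^]\<^bsub>R\<^esub> (k::nat) \<odot>\<^bsub>P\<^esub> a = g \<otimes>\<^bsub>P\<^esub> q \<oplus>\<^bsub>P\<^esub> s" "s = \<zero>\<^bsub>P\<^esub> \<or> deg R s < deg R g"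
    using long_div_theorem[OF g(1) a g(2)] by blast
  have "lcoeff g \<in> Units R"
    using lcoeff_nonzero2[OF g] g(1) by (simp add: R.field_Units)
  then have "lcoeff g [^]\<^bsub>R\<^esub> k \<in> Units R" by (rule R.Units_pow_closed)
  then obtain u where u: "u \<in> carrier R" "u \<otimes>\<^bsub>R\<^esub> lcoeff g [^]\<^bsub>R\<^esub> k = \<one>\<^bsub>R\<^esub>"
    using R.Units_l_inv_ex by blast
  have "a = (u \<otimes>\<^bsub>R\<^esub> lcoeff g [^]\<^bsub>R\<^esub> k) \<odot>\<^bsub>P\<^esub> a" unfolding u(2) using a by simp
  also have "\<dots> = u \<odot>\<^bsub>P\<^esub> (g \<otimes>\<^bsub>P\<^esub> q \<oplus>\<^bsub>P\<^esub> s)"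
    unfolding qs(3)[symmetric] using u(1) a g(1) by (simp add: UP_smult_assoc1)
  also have "\<dots> = g \<otimes>\<^bsub>P\<^esub> (u \<odot>\<^bsub>P\<^esub> q) \<oplus>\<^bsub>P\<^esub> u \<odot>\<^bsub>P\<^esub> s"
    using u(1) g(1) qs(1,2) by (simp add: UP_smult_r_distr P.m_comm[of g] UP_smult_assoc2)
  finally have "a = g \<otimes>\<^bsub>P\<^esub> (u \<odot>\<^bsub>P\<^esub> q) \<oplus>\<^bsub>P\<^esub> u \<odot>\<^bsub>P\<^esub> s" .
  moreover have "u \<odot>\<^bsub>P\<^esub> s = \<zero>\<^bsub>P\<^esub> \<or> deg R (u \<odot>\<^bsub>P\<^esub> s) < deg R g"
    using qs(4)
  proof
    assume "s = \<zero>\<^bsub>P\<^esub>"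
    have "up_ring.monom P u 0 \<otimes>\<^bsub>P\<^esub> \<zero>\<^bsub>P\<^esub> = \<zero>\<^bsub>P\<^esub>" using u(1) by simp
    then have "u \<odot>\<^bsub>P\<^esub> s = \<zero>\<^bsub>P\<^esub>"
      using monom_mult_is_smult[OF u(1) UP_zero_closed] \<open>s = \<zero>\<^bsub>P\<^esub>\<close> by simp
    then show ?thesis ..
  next
    assume "deg R s < deg R g"
    then show ?thesis using deg_smult_decr[OF u(1) qs(2)] by simp
  qed
  ultimately show ?thesis using u(1) qs(1,2) UP_smult_closed by blast
qed

text \<open>
  By long division, a nonzero element \<open>d\<close> of least degree in the ideal generated by \<open>a\<close> and \<open>G\<close> divides
  both of them. Since \<open>G\<close> is irreducible, \<open>d\<close> is a unit or associated to \<open>G\<close>; the latter would make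
  \<open>a\<close> a multiple of \<open>G\<close>.
\<close>

lemma inverse_mod_irreducible:
  assumes G: "G \<in> carrier P" "ring_irreducible\<^bsub>P\<^esub> G" and a: "a \<in> carrier P" "a \<notin> PIdl\<^bsub>P\<^esub> G"
  shows "\<exists>b\<in>carrier P. b \<otimes>\<^bsub>P\<^esub> a \<ominus>\<^bsub>P\<^esub> \<one>\<^bsub>P\<^esub> \<in> PIdl\<^bsub>P\<^esub> G"
proof -
  define J where "J = {x \<otimes>\<^bsub>P\<^esub> a \<oplus>\<^bsub>P\<^esub> y \<otimes>\<^bsub>P\<^esub> G | x y. x \<in> carrier P \<and> y \<in> carrier P}"
  have JP: "J \<subseteq> carrier P" using a(1) G(1) by (auto simp: J_def)
  have "a = \<one>\<^bsub>P\<^esub> \<otimes>\<^bsub>P\<^esub> a \<oplus>\<^bsub>P\<^esub> \<zero>\<^bsub>P\<^esub> \<otimes>\<^bsub>P\<^esub> G" using a(1) G(1) by simp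
  then have aJ: "a \<in> J" unfolding J_def by blast
  have "G = \<zero>\<^bsub>P\<^esub> \<otimes>\<^bsub>P\<^esub> a \<oplus>\<^bsub>P\<^esub> \<one>\<^bsub>P\<^esub> \<otimes>\<^bsub>P\<^esub> G" using a(1) G(1) by simp
  then have GJ: "G \<in> J" unfolding J_def by blast
  have "G \<noteq> \<zero>\<^bsub>P\<^esub>" using G(2) by (simp add: ring_irreducible_def)
  obtain d where d: "d \<in> J" "d \<noteq> \<zero>\<^bsub>P\<^esub>" "\<And>y. y \<in> J \<Longrightarrow> y \<noteq> \<zero>\<^bsub>P\<^esub> \<Longrightarrow> deg R d \<le> deg R y"
    using ex_has_least_nat[of "\<lambda>y. y \<in> J \<and> y \<noteq> \<zero>\<^bsub>P\<^esub>" G "deg R"] GJ \<open>G \<noteq> \<zero>\<^bsub>P\<^esub>\<close> by blast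
  obtain x y where xy: "x \<in> carrier P" "y \<in> carrier P" "d = x \<otimes>\<^bsub>P\<^esub> a \<oplus>\<^bsub>P\<^esub> y \<otimes>\<^bsub>P\<^esub> G"
    using d(1) unfolding J_def by blast
  have dP: "d \<in> carrier P" using d(1) JP by blast
  have div: "\<exists>q\<in>carrier P. z = d \<otimes>\<^bsub>P\<^esub> q" if z: "z \<in> J" for z
  proof -
    obtain s t where st: "s \<in> carrier P" "t \<in> carrier P" "z = s \<otimes>\<^bsub>P\<^esub> a \<oplus>\<^bsub>P\<^esub> t \<otimes>\<^bsub>P\<^esub> G"
      using z unfolding J_def by blast
    obtain q w where qw: "q \<in> carrier P" "w \<in> carrier P" "z = d \<otimes>\<^bsub>P\<^esub> q \<oplus>\<^bsub>P\<^esub> w"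
      "w = \<zero>\<^bsub>P\<^esub> \<or> deg R w < deg R d"
      using long_division[OF dP d(2)] z JP by blast
    have "w = z \<ominus>\<^bsub>P\<^esub> d \<otimes>\<^bsub>P\<^esub> q" unfolding qw(3) using dP qw(1,2) by algebra
    also have "\<dots> = (s \<ominus>\<^bsub>P\<^esub> x \<otimes>\<^bsub>P\<^esub> q) \<otimes>\<^bsub>P\<^esub> a \<oplus>\<^bsub>P\<^esub> (t \<ominus>\<^bsub>P\<^esub> y \<otimes>\<^bsub>P\<^esub> q) \<otimes>\<^bsub>P\<^esub> G"
      unfolding st(3) xy(3) using st(1,2) xy(1,2) qw(1) a(1) G(1) by algebra
    finally have "w \<in> J" unfolding J_def using st xy qw by blast
    then have "w = \<zero>\<^bsub>P\<^esub>" using d(3) qw(4) by fastforce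
    then show ?thesis using qw dP by auto
  qed
  obtain c where c: "c \<in> carrier P" "G = d \<otimes>\<^bsub>P\<^esub> c" using div[OF GJ] by blast
  obtain q where q: "q \<in> carrier P" "a = d \<otimes>\<^bsub>P\<^esub> q" using div[OF aJ] by blast
  have "d \<in> Units P \<or> c \<in> Units P"
    using domain.ring_irreducibleE(5)[OF UP_domain G(1,2) dP c(1) c(2)] .
  then show ?thesis
  proof
    assume "d \<in> Units P"
    then obtain u where u: "u \<in> carrier P" "u \<otimes>\<^bsub>P\<^esub> d = \<one>\<^bsub>P\<^esub>" using P.Units_l_inv_ex by blast
    have "u \<otimes>\<^bsub>P\<^esub> x \<otimes>\<^bsub>P\<^esub> a \<ominus>\<^bsub>P\<^esub> \<one>\<^bsub>P\<^esub> = (\<ominus>\<^bsub>P\<^esub> (u \<otimes>\<^bsub>P\<^esub> y)) \<otimes>\<^bsub>P\<^esub> G"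
      unfolding u(2)[symmetric] xy(3) using u(1) xy(1,2) a(1) G(1) by algebra
    then have "u \<otimes>\<^bsub>P\<^esub> x \<otimes>\<^bsub>P\<^esub> a \<ominus>\<^bsub>P\<^esub> \<one>\<^bsub>P\<^esub> \<in> PIdl\<^bsub>P\<^esub> G"
      unfolding cgenideal_def using u(1) xy(2) by blast
    then show ?thesis using u(1) xy(1) by blast
  next
    assume "c \<in> Units P"
    then obtain v where v: "v \<in> carrier P" "v \<otimes>\<^bsub>P\<^esub> c = \<one>\<^bsub>P\<^esub>" using P.Units_l_inv_ex by blast
    have "q \<otimes>\<^bsub>P\<^esub> v \<otimes>\<^bsub>P\<^esub> G = (v \<otimes>\<^bsub>P\<^esub> c) \<otimes>\<^bsub>P\<^esub> (d \<otimes>\<^bsub>P\<^esub> q)"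
      unfolding c(2) using q(1) v(1) c(1) dP by algebra
    also have "\<dots> = a" unfolding v(2) q(2) using dP q(1) by simp
    finally have "a \<in> PIdl\<^bsub>P\<^esub> G" unfolding cgenideal_def using q(1) v(1) by blast
    then show ?thesis using a(2) by blast
  qed
qed

lemma quotient_irreducible_field:
  assumes G: "G \<in> carrier P" "ring_irreducible\<^bsub>P\<^esub> G"
  shows "field (P Quot PIdl\<^bsub>P\<^esub> G)"
proof -
  interpret J: ideal "PIdl\<^bsub>P\<^esub> G" P using G(1) by (rule P.cgenideal_ideal)
  let ?Q = "P Quot PIdl\<^bsub>P\<^esub> G"
  interpret Q: cring ?Q by (rule J.quotient_is_cring[OF P.is_cring])
  interpret \<theta>: ring_hom_cring P ?Q "(+>\<^bsub>P\<^esub>) (PIdl\<^bsub>P\<^esub> G)"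
    by (rule J.rcos_ring_hom_cring[OF P.is_cring])
  have ker: "PIdl\<^bsub>P\<^esub> G +>\<^bsub>P\<^esub> x = \<zero>\<^bsub>?Q\<^esub> \<longleftrightarrow> x \<in> PIdl\<^bsub>P\<^esub> G" if "x \<in> carrier P" for x
    using P.a_rcos_zero[OF J.is_ideal] J.rcos_const_imp_mem[OF that] unfolding FactRing_def by auto
  show ?thesis
  proof (rule Q.cring_fieldI2)
    show "\<zero>\<^bsub>?Q\<^esub> \<noteq> \<one>\<^bsub>?Q\<^esub>"
    proof
      assume "\<zero>\<^bsub>?Q\<^esub> = \<one>\<^bsub>?Q\<^esub>"
      then have "\<one>\<^bsub>P\<^esub> \<in> PIdl\<^bsub>P\<^esub> G" using ker[of "\<one>\<^bsub>P\<^esub>"] \<theta>.hom_one by simp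
      then obtain c where c: "c \<in> carrier P" "\<one>\<^bsub>P\<^esub> = c \<otimes>\<^bsub>P\<^esub> G" unfolding cgenideal_def by blast
      then have "G \<in> Units P" using G(1) P.m_comm[of c G] unfolding Units_def by auto
      then show False using domain.ring_irreducibleE(4)[OF UP_domain G] by blast
    qed
    fix y assume y: "y \<in> carrier ?Q" "y \<noteq> \<zero>\<^bsub>?Q\<^esub>"
    then obtain a where a: "a \<in> carrier P" "y = PIdl\<^bsub>P\<^esub> G +>\<^bsub>P\<^esub> a"
      unfolding FactRing_def A_RCOSETS_def' by auto
    then have "a \<notin> PIdl\<^bsub>P\<^esub> G" using ker y(2) by blast
    then obtain b where b: "b \<in> carrier P" "b \<otimes>\<^bsub>P\<^esub> a \<ominus>\<^bsub>P\<^esub> \<one>\<^bsub>P\<^esub> \<in> PIdl\<^bsub>P\<^esub> G"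
      using inverse_mod_irreducible[OF G a(1)] by blast
    then have "PIdl\<^bsub>P\<^esub> G +>\<^bsub>P\<^esub> (b \<otimes>\<^bsub>P\<^esub> a) = PIdl\<^bsub>P\<^esub> G +>\<^bsub>P\<^esub> \<one>\<^bsub>P\<^esub>"
      using P.quotient_eq_iff_same_a_r_cos[OF J.is_ideal, of "b \<otimes>\<^bsub>P\<^esub> a" "\<one>\<^bsub>P\<^esub>"] a(1) by simp
    then have "(PIdl\<^bsub>P\<^esub> G +>\<^bsub>P\<^esub> b) \<otimes>\<^bsub>?Q\<^esub> y = \<one>\<^bsub>?Q\<^esub>"
      using a b(1) \<theta>.hom_mult \<theta>.hom_one by metis
    then show "\<exists>b\<in>carrier ?Q. y \<otimes>\<^bsub>?Q\<^esub> b = \<one>\<^bsub>?Q\<^esub>"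
      using \<theta>.hom_closed[OF b(1)] y(1) Q.m_comm by metis
  qed
qed

text \<open>
  Every class contains a remainder of degree at most that of \<open>G\<close>.
\<close>

lemma quotient_finite:
  assumes fin: "finite (carrier R)" and G: "G \<in> carrier P" "G \<noteq> \<zero>\<^bsub>P\<^esub>"
  shows "finite (carrier (P Quot PIdl\<^bsub>P\<^esub> G))"
proof -
  interpret J: ideal "PIdl\<^bsub>P\<^esub> G" P using G(1) by (rule P.cgenideal_ideal)
  let ?F = "{s. \<forall>n. (n \<in> {..deg R G} \<longrightarrow> s n \<in> carrier R) \<and> (n \<notin> {..deg R G} \<longrightarrow> s n = \<zero>\<^bsub>R\<^esub>)}"
  have fin_F: "finite ?F" using fin by (intro finite_set_of_finite_funs) auto
  have sub: "carrier (P Quot PIdl\<^bsub>P\<^esub> G) \<subseteq> (\<lambda>s. PIdl\<^bsub>P\<^esub> G +>\<^bsub>P\<^esub> s) ` ?F"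
  proof
    fix y assume "y \<in> carrier (P Quot PIdl\<^bsub>P\<^esub> G)"
    then obtain a where a: "a \<in> carrier P" "y = PIdl\<^bsub>P\<^esub> G +>\<^bsub>P\<^esub> a"
      unfolding FactRing_def A_RCOSETS_def' by auto
    obtain q s where qs: "q \<in> carrier P" "s \<in> carrier P" "a = G \<otimes>\<^bsub>P\<^esub> q \<oplus>\<^bsub>P\<^esub> s"
      "s = \<zero>\<^bsub>P\<^esub> \<or> deg R s < deg R G"
      using long_division[OF G a(1)] by blast
    have "a \<ominus>\<^bsub>P\<^esub> s = q \<otimes>\<^bsub>P\<^esub> G" unfolding qs(3) using qs(1,2) G(1) by algebra
    then have "a \<ominus>\<^bsub>P\<^esub> s \<in> PIdl\<^bsub>P\<^esub> G" unfolding cgenideal_def using qs(1) by blast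
    then have "y = PIdl\<^bsub>P\<^esub> G +>\<^bsub>P\<^esub> s"
      using P.quotient_eq_iff_same_a_r_cos[OF J.is_ideal a(1) qs(2)] a(2) by simp
    moreover have "s \<in> ?F"
    proof -
      have "s n = \<zero>\<^bsub>R\<^esub>" if "deg R G < n" for n
      proof -
        have "deg R s \<le> deg R G" using qs(4) by auto
        then have "up_ring.coeff P s n = \<zero>\<^bsub>R\<^esub>" using deg_aboveD[OF _ qs(2)] that by simp
        then show ?thesis using coeff_UP_eq[of s R n] qs(2) unfolding P_def by simp
      qed
      then show ?thesis using UP_closed[of s R] qs(2) unfolding P_def by auto
    qed
    ultimately show "y \<in> (\<lambda>s. PIdl\<^bsub>P\<^esub> G +>\<^bsub>P\<^esub> s) ` ?F" by blast
  qed
  show ?thesis by (rule finite_subset[OF sub finite_imageI[OF fin_F]])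
qed

end

section \<open>Quotient maps\<close>

text \<open>
  Two surjective images of \<open>A\<close> with the same kernel are isomorphic; only the consequences for
  fields and finiteness are spelled out.
\<close>

lemma field_finite_of_same_kernel:
  assumes \<sigma>: "ring_hom_cring A Q \<sigma>" and \<psi>: "ring_hom_cring A S \<psi>"
    and \<sigma>_surj: "\<And>y. y \<in> carrier Q \<Longrightarrow> \<exists>x\<in>carrier A. \<sigma> x = y"
    and \<psi>_surj: "\<And>y. y \<in> carrier S \<Longrightarrow> \<exists>x\<in>carrier A. \<psi> x = y"
    and kernels: "\<And>a. a \<in> carrier A \<Longrightarrow> \<sigma> a = \<zero>\<^bsub>Q\<^esub> \<longleftrightarrow> \<psi> a = \<zero>\<^bsub>S\<^esub>"
    and fld: "field Q" and fin: "finite (carrier Q)"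
  shows "field S" "finite (carrier S)"
proof -
  interpret Q: field Q by fact
  interpret A: cring A using \<sigma> by (rule ring_hom_cring.axioms(1))
  interpret S: cring S using \<psi> by (rule ring_hom_cring.axioms(2))
  interpret \<sigma>: ring_hom_cring A Q \<sigma> by fact
  interpret \<psi>: ring_hom_cring A S \<psi> by fact
  have eq: "\<psi> a = \<psi> b" if ab: "a \<in> carrier A" "b \<in> carrier A" "\<sigma> a = \<sigma> b" for a b
  proof -
    have "\<sigma> (a \<ominus>\<^bsub>A\<^esub> b) = \<zero>\<^bsub>Q\<^esub>" using ab by (simp add: a_minus_def Q.r_neg)
    then have "\<psi> (a \<ominus>\<^bsub>A\<^esub> b) = \<zero>\<^bsub>S\<^esub>" using kernels[of "a \<ominus>\<^bsub>A\<^esub> b"] ab(1,2) by blast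
    then have "\<psi> a \<ominus>\<^bsub>S\<^esub> \<psi> b = \<zero>\<^bsub>S\<^esub>" using ab(1,2) by (simp add: a_minus_def)
    then show ?thesis using ab(1,2) by simp
  qed
  show "field S"
  proof (rule S.cring_fieldI2)
    show "\<zero>\<^bsub>S\<^esub> \<noteq> \<one>\<^bsub>S\<^esub>"
      using kernels[of "\<one>\<^bsub>A\<^esub>"] \<sigma>.hom_one \<psi>.hom_one Q.one_not_zero A.one_closed by metis
    fix y assume y: "y \<in> carrier S" "y \<noteq> \<zero>\<^bsub>S\<^esub>"
    then obtain a where a: "a \<in> carrier A" "\<psi> a = y" using \<psi>_surj by blast
    then have "\<sigma> a \<in> Units Q" using y kernels[OF a(1)] by (simp add: Q.field_Units)
    then obtain c where c: "c \<in> carrier Q" "\<sigma> a \<otimes>\<^bsub>Q\<^esub> c = \<one>\<^bsub>Q\<^esub>" using Q.Units_r_inv_ex by blast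
    then obtain b where b: "b \<in> carrier A" "\<sigma> b = c" using \<sigma>_surj by blast
    have ab: "a \<otimes>\<^bsub>A\<^esub> b \<in> carrier A" using a(1) b(1) by simp
    have "\<sigma> (a \<otimes>\<^bsub>A\<^esub> b) = \<sigma> \<one>\<^bsub>A\<^esub>" using a(1) b c(2) by simp
    then have "\<psi> (a \<otimes>\<^bsub>A\<^esub> b) = \<psi> \<one>\<^bsub>A\<^esub>" by (rule eq[OF ab A.one_closed])
    then have "y \<otimes>\<^bsub>S\<^esub> \<psi> b = \<one>\<^bsub>S\<^esub>" using a b(1) by simp
    then show "\<exists>b\<in>carrier S. y \<otimes>\<^bsub>S\<^esub> b = \<one>\<^bsub>S\<^esub>" using \<psi>.hom_closed[OF b(1)] by blast
  qed
  have sub: "carrier S \<subseteq> (\<lambda>y. \<psi> (SOME a. a \<in> carrier A \<and> \<sigma> a = y)) ` carrier Q"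
  proof
    fix y assume "y \<in> carrier S"
    then obtain a where a: "a \<in> carrier A" "\<psi> a = y" using \<psi>_surj by blast
    define b where "b = (SOME b. b \<in> carrier A \<and> \<sigma> b = \<sigma> a)"
    have "b \<in> carrier A \<and> \<sigma> b = \<sigma> a"
      unfolding b_def by (rule someI[of _ a]) (simp add: a(1))
    then have "\<psi> b = y" using eq[of b a] a by blast
    then show "y \<in> (\<lambda>y. \<psi> (SOME a. a \<in> carrier A \<and> \<sigma> a = y)) ` carrier Q"
      using \<sigma>.hom_closed[OF a(1)] unfolding b_def by blast
  qed
  show "finite (carrier S)" by (rule finite_subset[OF sub finite_imageI[OF fin]])
qed

context cring
begin

lemma quotient_hom: "ideal I R \<Longrightarrow> ring_hom_cring R (R Quot I) ((+>) I)"
  using ideal.rcos_ring_hom_cring is_cring by blast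

lemma quotient_surj:
  assumes "ideal I R" "y \<in> carrier (R Quot I)"
  shows "\<exists>a\<in>carrier R. I +> a = y"
  using assms unfolding FactRing_def A_RCOSETS_def' by auto

lemma quotient_zero_iff:
  assumes "ideal I R" "a \<in> carrier R"
  shows "I +> a = \<zero>\<^bsub>R Quot I\<^esub> \<longleftrightarrow> a \<in> I"
  using a_rcos_zero[OF assms(1)] ideal.rcos_const_imp_mem[OF assms] unfolding FactRing_def by auto

lemma set_add_coset:
  assumes I: "ideal I R" and J: "ideal J R" and sub: "I \<subseteq> J" and a: "a \<in> carrier R"
  shows "J <+>\<^bsub>R\<^esub> (I +> a) = J +> a"
proof (intro equalityI subsetI)
  fix x assume "x \<in> J <+>\<^bsub>R\<^esub> (I +> a)"
  then obtain y i where yi: "y \<in> J" "i \<in> I" "x = y \<oplus> (i \<oplus> a)"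
    unfolding set_add_def' a_r_coset_def' by blast
  moreover have "y \<in> carrier R" "i \<in> carrier R"
    using ideal.Icarr[OF J yi(1)] ideal.Icarr[OF I yi(2)] by auto
  ultimately have "x = (y \<oplus> i) \<oplus> a" using a yi(3) by (simp add: a_assoc)
  moreover have "y \<oplus> i \<in> J"
    using additive_subgroup.a_closed[OF ideal.axioms(1)[OF J] yi(1), of i] yi(2) sub by blast
  ultimately show "x \<in> J +> a" unfolding a_r_coset_def' by blast
next
  fix x assume "x \<in> J +> a"
  then obtain y where y: "y \<in> J" "x = y \<oplus> a" unfolding a_r_coset_def' by blast
  have "\<zero> \<in> I" using additive_subgroup.zero_closed[OF ideal.axioms(1)[OF I]] .
  moreover have "x = y \<oplus> (\<zero> \<oplus> a)" using y a by simp
  ultimately show "x \<in> J <+>\<^bsub>R\<^esub> (I +> a)"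
    using y(1) unfolding set_add_def' a_r_coset_def' by blast
qed

lemma quotient_quotient_hom:
  assumes I: "ideal I R" and J: "ideal J R" and sub: "I \<subseteq> J"
  shows "ring_hom_cring (R Quot I) (R Quot J) (\<lambda>c. J <+>\<^bsub>R\<^esub> c)"
proof -
  interpret i: ring_hom_cring R "R Quot I" "(+>) I" by (rule quotient_hom[OF I])
  interpret j: ring_hom_cring R "R Quot J" "(+>) J" by (rule quotient_hom[OF J])
  note eq = set_add_coset[OF I J sub]
  show ?thesis
  proof (rule ring_hom_cringI[OF i.S.is_cring j.S.is_cring], rule ring_hom_memI)
    fix x assume "x \<in> carrier (R Quot I)"
    then obtain a where a: "a \<in> carrier R" "I +> a = x" using quotient_surj[OF I] by blast
    then show "J <+>\<^bsub>R\<^esub> x \<in> carrier (R Quot J)" using eq[OF a(1)] j.hom_closed[OF a(1)] by simp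
    fix y assume "y \<in> carrier (R Quot I)"
    then obtain b where b: "b \<in> carrier R" "I +> b = y" using quotient_surj[OF I] by blast
    have "x \<otimes>\<^bsub>R Quot I\<^esub> y = I +> (a \<otimes> b)" "x \<oplus>\<^bsub>R Quot I\<^esub> y = I +> (a \<oplus> b)"
      using a b i.hom_mult i.hom_add by simp_all
    moreover have "J <+>\<^bsub>R\<^esub> x = J +> a" "J <+>\<^bsub>R\<^esub> y = J +> b"
      using eq[OF a(1)] eq[OF b(1)] unfolding a(2) b(2) .
    ultimately show "J <+>\<^bsub>R\<^esub> (x \<otimes>\<^bsub>R Quot I\<^esub> y) = (J <+>\<^bsub>R\<^esub> x) \<otimes>\<^bsub>R Quot J\<^esub> (J <+>\<^bsub>R\<^esub> y)"
      "J <+>\<^bsub>R\<^esub> (x \<oplus>\<^bsub>R Quot I\<^esub> y) = (J <+>\<^bsub>R\<^esub> x) \<oplus>\<^bsub>R Quot J\<^esub> (J <+>\<^bsub>R\<^esub> y)"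
      using eq[of "a \<otimes> b"] eq[of "a \<oplus> b"] j.hom_mult[OF a(1) b(1)] j.hom_add[OF a(1) b(1)] a(1) b(1)
      by simp_all
  next
    have "\<one>\<^bsub>R Quot I\<^esub> = I +> \<one>" using i.hom_one by simp
    then show "J <+>\<^bsub>R\<^esub> \<one>\<^bsub>R Quot I\<^esub> = \<one>\<^bsub>R Quot J\<^esub>" using eq[of \<one>] j.hom_one by simp
  qed
qed

end

section \<open>The residue field\<close>

lemma finite_domain_is_field:
  assumes "domain F" and fin: "finite (carrier F)"
  shows "field F"
proof -
  interpret domain F by fact
  show ?thesis
  proof (rule cring_fieldI2)
    fix a assume a: "a \<in> carrier F" "a \<noteq> \<zero>\<^bsub>F\<^esub>"
    have "inj_on (\<lambda>x. a \<otimes>\<^bsub>F\<^esub> x) (carrier F)"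
      using a m_lcancel by (auto intro!: inj_onI)
    then have "(\<lambda>x. a \<otimes>\<^bsub>F\<^esub> x) ` carrier F = carrier F"
      using a(1) by (intro endo_inj_surj[OF fin]) auto
    then show "\<exists>b\<in>carrier F. a \<otimes>\<^bsub>F\<^esub> b = \<one>\<^bsub>F\<^esub>"
      using one_closed by (metis imageE)
  qed simp
qed

lemma nat_one_int_ring: "[(n::nat)] \<cdot>\<^bsub>\<Z>\<^esub> \<one>\<^bsub>\<Z>\<^esub> = int n"
proof -
  show ?thesis by (induction n) (auto simp: add_pow_def nat_pow_def)
qed

lemma ZMod_hom: "ring_hom_cring \<Z> (ZFact k) (ZMod k)"
proof -
  have "ideal (Idl\<^bsub>\<Z>\<^esub> {k}) \<Z>" by (rule int.genideal_ideal) simp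
  moreover have "ZMod k = (+>\<^bsub>\<Z>\<^esub>) (Idl\<^bsub>\<Z>\<^esub> {k})" by (rule ext) (simp add: ZMod_def)
  ultimately show ?thesis unfolding ZFact_def using cring.quotient_hom[OF int_is_cring] by simp
qed

lemma ZMod_surj:
  assumes "y \<in> carrier (ZFact k)"
  shows "\<exists>x\<in>carrier \<Z>. ZMod k x = y"
proof -
  have "ideal (Idl\<^bsub>\<Z>\<^esub> {k}) \<Z>" by (rule int.genideal_ideal) simp
  then show ?thesis using cring.quotient_surj[OF int_is_cring] assms unfolding ZFact_def ZMod_def by blast
qed

lemma ZMod_kernel:
  assumes "ZMod (int p) x = \<zero>\<^bsub>ZFact (int p)\<^esub>"
  shows "x \<in> PIdl\<^bsub>\<Z>\<^esub> ([p] \<cdot>\<^bsub>\<Z>\<^esub> \<one>\<^bsub>\<Z>\<^esub>)"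
proof -
  have "ideal (Idl\<^bsub>\<Z>\<^esub> {int p}) \<Z>" by (rule int.genideal_ideal) simp
  then have "x \<in> Idl\<^bsub>\<Z>\<^esub> {int p}"
    using cring.quotient_zero_iff[OF int_is_cring, of "Idl\<^bsub>\<Z>\<^esub> {int p}" x] assms unfolding ZFact_def ZMod_def by simp
  then show ?thesis unfolding nat_one_int_ring int_Idl cgenideal_def by auto
qed

lemma ZFact_prime_field:
  assumes p: "Factorial_Ring.prime (p::nat)"
  shows "field (ZFact (int p))" "finite (carrier (ZFact (int p)))"
proof -
  have "carrier (ZFact (int p)) \<subseteq> ZMod (int p) ` {0..<int p}"
  proof
    fix y assume "y \<in> carrier (ZFact (int p))"
    then obtain x where "y = ZMod (int p) x" using ZMod_surj by blast
    then have "y = ZMod (int p) (x mod int p)" using ZMod_mod by simp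
    moreover have "x mod int p \<in> {0..<int p}" using prime_gt_0_nat[OF p] by simp
    ultimately show "y \<in> ZMod (int p) ` {0..<int p}" by blast
  qed
  then show fin: "finite (carrier (ZFact (int p)))" by (rule finite_subset) simp
  have "domain (ZFact (int p))" using p by (intro ZFact_prime_is_domain) simp
  then show "field (ZFact (int p))" using fin by (rule finite_domain_is_field)
qed

locale galois_tower =
  fixes p :: nat and h :: "nat \<Rightarrow> int"
  assumes p: "Factorial_Ring.prime p"
    and h_closed: "h \<in> carrier (UP \<Z>)"
    and irreducible: "irreducible_mod p h"
begin

abbreviation (input) "F \<equiv> ZFact (int p)"
abbreviation (input) "B \<equiv> base_ring h"
abbreviation (input) "\<mu> \<equiv> up_map (ZMod (int p))"

sublocale F: field F by (rule ZFact_prime_field[OF p])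
sublocale ZP: UP_cring \<Z> "UP \<Z>" by (intro UP_cring.intro int_is_cring) 
sublocale FP: UP_field F "UP F" by unfold_locales
sublocale \<mu>: ring_hom_cring "UP \<Z>" "UP F" \<mu>
  by (rule ring_hom_cring.up_map_ring_hom[OF ZMod_hom])

lemma \<mu>_surj: "y \<in> carrier (UP F) \<Longrightarrow> \<exists>x\<in>carrier (UP \<Z>). \<mu> x = y"
  by (rule ring_hom_cring.up_map_surj[OF ZMod_hom ZMod_surj])

lemma \<mu>_kernel:
  assumes "a \<in> carrier (UP \<Z>)" "\<mu> a = \<zero>\<^bsub>UP F\<^esub>"
  shows "a \<in> PIdl\<^bsub>UP \<Z>\<^esub> ([p] \<cdot>\<^bsub>UP \<Z>\<^esub> \<one>\<^bsub>UP \<Z>\<^esub>)"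
  by (rule ring_hom_cring.up_map_kernel[OF ZMod_hom _ assms]) (rule ZMod_kernel)

lemma \<mu>_p: "\<mu> ([p] \<cdot>\<^bsub>UP \<Z>\<^esub> \<one>\<^bsub>UP \<Z>\<^esub>) = \<zero>\<^bsub>UP F\<^esub>"
proof -
  have "[p] \<cdot>\<^bsub>F\<^esub> \<one>\<^bsub>F\<^esub> = ZMod (int p) (int p)"
    using ring_hom_cring.hom_nat_one[OF ZMod_hom, of "int p" p] nat_one_int_ring by simp
  also have "\<dots> = ZMod (int p) 0" by (simp add: ZMod_eq_mod)
  also have "\<dots> = \<zero>\<^bsub>F\<^esub>"
    using ring_hom_cring.hom_zero[OF ZMod_hom, of "int p"] by simp
  finally have "[p] \<cdot>\<^bsub>F\<^esub> \<one>\<^bsub>F\<^esub> = \<zero>\<^bsub>F\<^esub>" .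
  then have "[p] \<cdot>\<^bsub>UP F\<^esub> \<one>\<^bsub>UP F\<^esub> \<otimes>\<^bsub>UP F\<^esub> \<one>\<^bsub>UP F\<^esub> = \<zero>\<^bsub>UP F\<^esub>"
    using FP.nat_one_coeff_mult[of "\<one>\<^bsub>UP F\<^esub>" p] UP_closed[of "\<one>\<^bsub>UP F\<^esub>" F]
    by (intro ext) (simp add: UP_zero_eq)
  then show ?thesis by (simp add: \<mu>.hom_nat_one)
qed

lemma \<mu>_h: "\<mu> h \<in> carrier (UP F)" "ring_irreducible\<^bsub>UP F\<^esub> (\<mu> h)" "\<mu> h \<noteq> \<zero>\<^bsub>UP F\<^esub>"
  using irreducible h_closed by (auto simp: irreducible_mod_def ring_irreducible_def)

lemma h_ideal: "ideal (PIdl\<^bsub>UP \<Z>\<^esub> h) (UP \<Z>)"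
  by (rule ZP.P.cgenideal_ideal[OF h_closed])

abbreviation (input) "\<beta>\<^sub>0 a \<equiv> PIdl\<^bsub>UP \<Z>\<^esub> h +>\<^bsub>UP \<Z>\<^esub> a"

lemma B_eq: "B = UP \<Z> Quot PIdl\<^bsub>UP \<Z>\<^esub> h"
  by (simp add: base_ring_def quot_by_def)

sublocale \<beta>\<^sub>0: ring_hom_cring "UP \<Z>" B "(+>\<^bsub>UP \<Z>\<^esub>) (PIdl\<^bsub>UP \<Z>\<^esub> h)"
  unfolding B_eq by (rule ZP.P.quotient_hom[OF h_ideal])

lemma \<beta>\<^sub>0_surj: "y \<in> carrier B \<Longrightarrow> \<exists>a\<in>carrier (UP \<Z>). \<beta>\<^sub>0 a = y"
  unfolding B_eq by (rule ZP.P.quotient_surj[OF h_ideal])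

lemma \<beta>\<^sub>0_zero_iff: "a \<in> carrier (UP \<Z>) \<Longrightarrow> \<beta>\<^sub>0 a = \<zero>\<^bsub>B\<^esub> \<longleftrightarrow> a \<in> PIdl\<^bsub>UP \<Z>\<^esub> h"
  unfolding B_eq by (rule ZP.P.quotient_zero_iff[OF h_ideal])

text \<open>
  Modulo \<open>p\<close> the polynomial \<open>h\<close> is a nonzero element of the domain \<open>UP F\<close>. So \<open>p a = q h\<close> forces \<open>p\<close> to divide
  \<open>q\<close>, and \<open>p\<close> can be cancelled in \<open>\<int>[t]\<close>.
\<close>

lemma p_regular:
  assumes x: "x \<in> carrier B" and zero: "[p] \<cdot>\<^bsub>B\<^esub> \<one>\<^bsub>B\<^esub> \<otimes>\<^bsub>B\<^esub> x = \<zero>\<^bsub>B\<^esub>"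
  shows "x = \<zero>\<^bsub>B\<^esub>"
proof -
  define \<pi> where "\<pi> = [p] \<cdot>\<^bsub>UP \<Z>\<^esub> \<one>\<^bsub>UP \<Z>\<^esub>"
  have \<pi>: "\<pi> \<in> carrier (UP \<Z>)" by (simp add: \<pi>_def)
  obtain a where a: "a \<in> carrier (UP \<Z>)" "\<beta>\<^sub>0 a = x" using \<beta>\<^sub>0_surj[OF x] by blast
  have "\<beta>\<^sub>0 (\<pi> \<otimes>\<^bsub>UP \<Z>\<^esub> a) = \<zero>\<^bsub>B\<^esub>"
    using zero \<beta>\<^sub>0.hom_mult[OF \<pi> a(1)] \<beta>\<^sub>0.hom_nat_one[of p] a(2) unfolding \<pi>_def by simp
  then have "\<pi> \<otimes>\<^bsub>UP \<Z>\<^esub> a \<in> PIdl\<^bsub>UP \<Z>\<^esub> h"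
    by (rule iffD1[OF \<beta>\<^sub>0_zero_iff[OF ZP.P.m_closed[OF \<pi> a(1)]]])
  then obtain q where q: "q \<in> carrier (UP \<Z>)" "\<pi> \<otimes>\<^bsub>UP \<Z>\<^esub> a = q \<otimes>\<^bsub>UP \<Z>\<^esub> h"
    unfolding ZP.P.mem_PIdl_iff by blast
  have "\<mu> q \<otimes>\<^bsub>UP F\<^esub> \<mu> h = \<mu> (\<pi> \<otimes>\<^bsub>UP \<Z>\<^esub> a)" unfolding q(2) using q(1) h_closed by simp
  also have "\<dots> = \<mu> \<pi> \<otimes>\<^bsub>UP F\<^esub> \<mu> a" by (rule \<mu>.hom_mult[OF \<pi> a(1)])
  also have "\<dots> = \<zero>\<^bsub>UP F\<^esub>" unfolding \<pi>_def \<mu>_p using \<mu>.hom_closed[OF a(1)] by simp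
  finally have "\<mu> q = \<zero>\<^bsub>UP F\<^esub>"
    using domain.integral[OF FP.UP_domain _ \<mu>.hom_closed[OF q(1)] \<mu>_h(1)] \<mu>_h(3) by blast
  then have "q \<in> PIdl\<^bsub>UP \<Z>\<^esub> \<pi>" unfolding \<pi>_def by (rule \<mu>_kernel[OF q(1)])
  then obtain q' where q': "q' \<in> carrier (UP \<Z>)" "q = q' \<otimes>\<^bsub>UP \<Z>\<^esub> \<pi>"
    unfolding ZP.P.mem_PIdl_iff by blast
  define b where "b = a \<ominus>\<^bsub>UP \<Z>\<^esub> q' \<otimes>\<^bsub>UP \<Z>\<^esub> h"
  have b: "b \<in> carrier (UP \<Z>)" using a(1) q'(1) h_closed by (simp add: b_def)
  have "\<pi> \<otimes>\<^bsub>UP \<Z>\<^esub> b = \<pi> \<otimes>\<^bsub>UP \<Z>\<^esub> a \<ominus>\<^bsub>UP \<Z>\<^esub> q' \<otimes>\<^bsub>UP \<Z>\<^esub> \<pi> \<otimes>\<^bsub>UP \<Z>\<^esub> h"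
    unfolding b_def using a(1) q'(1) h_closed \<pi> by algebra
  also have "\<dots> = \<zero>\<^bsub>UP \<Z>\<^esub>"
    unfolding q(2) q'(2) using q'(1) h_closed \<pi> by (simp add: a_minus_def ZP.P.r_neg)
  finally have "(\<pi> \<otimes>\<^bsub>UP \<Z>\<^esub> b) n = 0" for n by (simp add: UP_zero_eq)
  then have "int p * b n = 0" for n
    using ZP.nat_one_coeff_mult[OF b, of p] nat_one_int_ring[of p] unfolding \<pi>_def by simp
  then have "b n = 0" for n using prime_gt_0_nat[OF p] by simp
  then have "b = \<zero>\<^bsub>UP \<Z>\<^esub>" by (intro ext) (simp add: UP_zero_eq)
  then have "a = q' \<otimes>\<^bsub>UP \<Z>\<^esub> h" unfolding b_def using a(1) q'(1) h_closed by simp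
  then have "a \<in> PIdl\<^bsub>UP \<Z>\<^esub> h" unfolding ZP.P.mem_PIdl_iff using q'(1) by blast
  then show ?thesis using \<beta>\<^sub>0_zero_iff[OF a(1)] a(2) by simp
qed

section \<open>The tower of quotients\<close>

abbreviation (input) "I e \<equiv> p_ideal p h e"
abbreviation (input) "L e \<equiv> level_ring p h e"

lemma I_ideal: "ideal (I e) B"
  unfolding p_ideal_def by (rule \<beta>\<^sub>0.S.cgenideal_ideal) simp

lemma mem_I_iff: "a \<in> I e \<longleftrightarrow> (\<exists>c\<in>carrier B. a = c \<otimes>\<^bsub>B\<^esub> [(p ^ e)] \<cdot>\<^bsub>B\<^esub> \<one>\<^bsub>B\<^esub>)"
  unfolding p_ideal_def by (rule \<beta>\<^sub>0.S.mem_PIdl_iff)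

lemma I_antimono:
  assumes "e' \<le> e"
  shows "I e \<subseteq> I e'"
proof
  fix a assume "a \<in> I e"
  then obtain c where c: "c \<in> carrier B" "a = c \<otimes>\<^bsub>B\<^esub> [(p ^ e)] \<cdot>\<^bsub>B\<^esub> \<one>\<^bsub>B\<^esub>" using mem_I_iff by blast
  have "p ^ e = p ^ (e - e') * p ^ e'" using assms by (simp flip: power_add)
  then have "a = (c \<otimes>\<^bsub>B\<^esub> [(p ^ (e - e'))] \<cdot>\<^bsub>B\<^esub> \<one>\<^bsub>B\<^esub>) \<otimes>\<^bsub>B\<^esub> [(p ^ e')] \<cdot>\<^bsub>B\<^esub> \<one>\<^bsub>B\<^esub>"
    unfolding c(2) using c(1) by (simp add: \<beta>\<^sub>0.S.m_assoc \<beta>\<^sub>0.S.nat_one_mult)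
  then show "a \<in> I e'"
    unfolding mem_I_iff using c(1)
    by (intro bexI[of _ "c \<otimes>\<^bsub>B\<^esub> [(p ^ (e - e'))] \<cdot>\<^bsub>B\<^esub> \<one>\<^bsub>B\<^esub>"]) simp_all
qed

lemma proj_hom: "ring_hom_cring B (L e) (proj p h e)"
proof -
  have "proj p h e = (+>\<^bsub>B\<^esub>) (I e)" by (rule ext) (simp add: proj_def)
  then show ?thesis unfolding level_ring_def using \<beta>\<^sub>0.S.quotient_hom[OF I_ideal] by simp
qed

lemma proj_surj: "y \<in> carrier (L e) \<Longrightarrow> \<exists>a\<in>carrier B. proj p h e a = y"
  unfolding level_ring_def proj_def by (rule \<beta>\<^sub>0.S.quotient_surj[OF I_ideal])

lemma proj_zero_iff: "a \<in> carrier B \<Longrightarrow> proj p h e a = \<zero>\<^bsub>L e\<^esub> \<longleftrightarrow> a \<in> I e"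
  unfolding level_ring_def proj_def by (rule \<beta>\<^sub>0.S.quotient_zero_iff[OF I_ideal])

lemma L_cring: "cring (L e)"
  using proj_hom[of e] by (rule ring_hom_cring.axioms(2))

text \<open>
  Reduction \<open>R\<^sub>i \<rightarrow> R\<^sub>e\<close> for any \<open>i \<ge> e\<close>, on cosets; it generalises \<^const>\<open>bar\<close> from \<open>e = 1\<close> and has the
  source level \<open>i\<close> only implicitly.
\<close>

definition red :: "nat \<Rightarrow> (nat \<Rightarrow> int) set set \<Rightarrow> (nat \<Rightarrow> int) set set" where
  "red e c = I e <+>\<^bsub>B\<^esub> c"

lemma bar_eq_red: "bar p h = red 1"
  by (rule ext) (simp add: bar_def red_def)

lemma red_proj: "e' \<le> e \<Longrightarrow> a \<in> carrier B \<Longrightarrow> red e' (proj p h e a) = proj p h e' a"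
  unfolding red_def proj_def by (rule \<beta>\<^sub>0.S.set_add_coset[OF I_ideal I_ideal I_antimono])

lemma red_hom:
  assumes "e' \<le> e"
  shows "ring_hom_cring (L e) (L e') (red e')"
proof -
  have "red e' = (\<lambda>c. I e' <+>\<^bsub>B\<^esub> c)" by (rule ext) (simp add: red_def)
  then show ?thesis
    unfolding level_ring_def
    using \<beta>\<^sub>0.S.quotient_quotient_hom[OF I_ideal I_ideal I_antimono[OF assms]] by simp
qed

lemma red_surj:
  assumes "e' \<le> e" "y \<in> carrier (L e')"
  shows "\<exists>x\<in>carrier (L e). red e' x = y"
proof -
  interpret pr: ring_hom_cring B "L e" "proj p h e" by (rule proj_hom)
  obtain a where a: "a \<in> carrier B" "proj p h e' a = y" using proj_surj[OF assms(2)] by blast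
  then show ?thesis
    using red_proj[OF assms(1) a(1)] pr.hom_closed[OF a(1)] by blast
qed

lemma red_kernel:
  assumes e: "e' \<le> e" and x: "x \<in> carrier (L e)" and zero: "red e' x = \<zero>\<^bsub>L e'\<^esub>"
  shows "x \<in> PIdl\<^bsub>L e\<^esub> ([(p ^ e')] \<cdot>\<^bsub>L e\<^esub> \<one>\<^bsub>L e\<^esub>)"
proof -
  interpret L: cring "L e" by (rule L_cring)
  interpret pr: ring_hom_cring B "L e" "proj p h e" by (rule proj_hom)
  obtain a where a: "a \<in> carrier B" "proj p h e a = x" using proj_surj[OF x] by blast
  have "a \<in> I e'" using zero red_proj[OF e a(1)] proj_zero_iff[OF a(1), of e'] a(2) by simp
  then obtain c where c: "c \<in> carrier B" "a = c \<otimes>\<^bsub>B\<^esub> [(p ^ e')] \<cdot>\<^bsub>B\<^esub> \<one>\<^bsub>B\<^esub>" using mem_I_iff by blast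
  have "x = proj p h e c \<otimes>\<^bsub>L e\<^esub> [(p ^ e')] \<cdot>\<^bsub>L e\<^esub> \<one>\<^bsub>L e\<^esub>"
    using a(2) pr.hom_mult[OF c(1), of "[(p ^ e')] \<cdot>\<^bsub>B\<^esub> \<one>\<^bsub>B\<^esub>"] pr.hom_nat_one[of "p ^ e'"]
    unfolding c(2) by simp
  then show ?thesis unfolding L.mem_PIdl_iff using pr.hom_closed[OF c(1)] by blast
qed

lemma L_char: "[(p ^ e)] \<cdot>\<^bsub>L e\<^esub> \<one>\<^bsub>L e\<^esub> = \<zero>\<^bsub>L e\<^esub>"
proof -
  have "[(p ^ e)] \<cdot>\<^bsub>B\<^esub> \<one>\<^bsub>B\<^esub> \<in> I e"
    unfolding mem_I_iff by (intro bexI[of _ "\<one>\<^bsub>B\<^esub>"]) auto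
  then have "proj p h e ([(p ^ e)] \<cdot>\<^bsub>B\<^esub> \<one>\<^bsub>B\<^esub>) = \<zero>\<^bsub>L e\<^esub>"
    using proj_zero_iff[of "[(p ^ e)] \<cdot>\<^bsub>B\<^esub> \<one>\<^bsub>B\<^esub>" e] by simp
  then show ?thesis using ring_hom_cring.hom_nat_one[OF proj_hom, of e "p ^ e"] by simp
qed

text \<open>
  Since \<open>p\<close> is regular in the base ring, \<open>p a \<in> p\<^sup>e R\<close> holds exactly if \<open>a \<in> p\<^sup>e\<^sup>-\<^sup>1 R\<close>.
\<close>

lemma red_zero_iff:
  assumes e: "1 \<le> e" and x: "x \<in> carrier (L e)"
  shows "red (e - 1) x = \<zero>\<^bsub>L (e - 1)\<^esub> \<longleftrightarrow> [p] \<cdot>\<^bsub>L e\<^esub> \<one>\<^bsub>L e\<^esub> \<otimes>\<^bsub>L e\<^esub> x = \<zero>\<^bsub>L e\<^esub>"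
proof -
  interpret pr: ring_hom_cring B "L e" "proj p h e" by (rule proj_hom)
  define \<pi> where "\<pi> = [p] \<cdot>\<^bsub>B\<^esub> \<one>\<^bsub>B\<^esub>"
  define s where "s = [(p ^ (e - 1))] \<cdot>\<^bsub>B\<^esub> \<one>\<^bsub>B\<^esub>"
  have \<pi>s: "\<pi> \<in> carrier B" "s \<in> carrier B" by (simp_all add: \<pi>_def s_def)
  have "p ^ e = p ^ (e - 1) * p" using e by (cases e) auto
  then have pe: "[(p ^ e)] \<cdot>\<^bsub>B\<^esub> \<one>\<^bsub>B\<^esub> = s \<otimes>\<^bsub>B\<^esub> \<pi>" unfolding s_def \<pi>_def by (simp add: \<beta>\<^sub>0.S.nat_one_mult)
  obtain a where a: "a \<in> carrier B" "proj p h e a = x" using proj_surj[OF x] by blast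
  have "[p] \<cdot>\<^bsub>L e\<^esub> \<one>\<^bsub>L e\<^esub> \<otimes>\<^bsub>L e\<^esub> x = proj p h e (\<pi> \<otimes>\<^bsub>B\<^esub> a)"
    using pr.hom_mult[OF \<pi>s(1) a(1)] pr.hom_nat_one[of p] a(2) unfolding \<pi>_def by simp
  then have "[p] \<cdot>\<^bsub>L e\<^esub> \<one>\<^bsub>L e\<^esub> \<otimes>\<^bsub>L e\<^esub> x = \<zero>\<^bsub>L e\<^esub> \<longleftrightarrow> \<pi> \<otimes>\<^bsub>B\<^esub> a \<in> I e"
    using proj_zero_iff[of "\<pi> \<otimes>\<^bsub>B\<^esub> a" e] \<pi>s a(1) by simp
  also have "\<dots> \<longleftrightarrow> a \<in> I (e - 1)"
  proof
    assume "\<pi> \<otimes>\<^bsub>B\<^esub> a \<in> I e"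
    then obtain c where c: "c \<in> carrier B" "\<pi> \<otimes>\<^bsub>B\<^esub> a = c \<otimes>\<^bsub>B\<^esub> (s \<otimes>\<^bsub>B\<^esub> \<pi>)"
      unfolding mem_I_iff pe by blast
    have "\<pi> \<otimes>\<^bsub>B\<^esub> (a \<ominus>\<^bsub>B\<^esub> c \<otimes>\<^bsub>B\<^esub> s) = \<pi> \<otimes>\<^bsub>B\<^esub> a \<ominus>\<^bsub>B\<^esub> c \<otimes>\<^bsub>B\<^esub> (s \<otimes>\<^bsub>B\<^esub> \<pi>)"
      using \<pi>s a(1) c(1) by algebra
    also have "\<dots> = \<zero>\<^bsub>B\<^esub>" unfolding c(2) using \<pi>s c(1) by (simp add: a_minus_def \<beta>\<^sub>0.S.r_neg)
    finally have "a \<ominus>\<^bsub>B\<^esub> c \<otimes>\<^bsub>B\<^esub> s = \<zero>\<^bsub>B\<^esub>"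
      using p_regular[of "a \<ominus>\<^bsub>B\<^esub> c \<otimes>\<^bsub>B\<^esub> s"] \<pi>s a(1) c(1) unfolding \<pi>_def by simp
    then have "a = c \<otimes>\<^bsub>B\<^esub> s" using a(1) c(1) \<pi>s by simp
    then show "a \<in> I (e - 1)" unfolding mem_I_iff s_def[symmetric] using c(1) by blast
  next
    assume "a \<in> I (e - 1)"
    then obtain c where c: "c \<in> carrier B" "a = c \<otimes>\<^bsub>B\<^esub> s"
      unfolding mem_I_iff s_def[symmetric] by blast
    have "\<pi> \<otimes>\<^bsub>B\<^esub> a = c \<otimes>\<^bsub>B\<^esub> (s \<otimes>\<^bsub>B\<^esub> \<pi>)" unfolding c(2) using \<pi>s c(1) by algebra
    then show "\<pi> \<otimes>\<^bsub>B\<^esub> a \<in> I e" unfolding mem_I_iff pe using c(1) by blast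
  qed
  also have "\<dots> \<longleftrightarrow> red (e - 1) x = \<zero>\<^bsub>L (e - 1)\<^esub>"
    using proj_zero_iff[OF a(1), of "e - 1"] red_proj[of "e - 1" e a] a by simp
  finally show ?thesis by simp
qed

text \<open>
  Both \<open>R\<^sub>1\<close> and the quotient of \<open>UP F\<close> by \<open>h\<close> modulo \<open>p\<close> are images of \<open>\<int>[t]\<close> with kernel generated by
  \<open>h\<close> and \<open>p\<close>, and the second one is a finite field because \<open>h\<close> is irreducible modulo \<open>p\<close>.
\<close>

lemma residue_field: "field (L 1)" "finite (carrier (L 1))"
proof -
  let ?Q = "UP F Quot PIdl\<^bsub>UP F\<^esub> (\<mu> h)"
  have J: "ideal (PIdl\<^bsub>UP F\<^esub> (\<mu> h)) (UP F)" by (rule FP.P.cgenideal_ideal[OF \<mu>_h(1)])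
  interpret \<theta>: ring_hom_cring "UP F" ?Q "(+>\<^bsub>UP F\<^esub>) (PIdl\<^bsub>UP F\<^esub> (\<mu> h))"
    by (rule FP.P.quotient_hom[OF J])
  interpret pr: ring_hom_cring B "L 1" "proj p h 1" by (rule proj_hom)
  define \<sigma> where "\<sigma> a = PIdl\<^bsub>UP F\<^esub> (\<mu> h) +>\<^bsub>UP F\<^esub> \<mu> a" for a
  define \<psi> where "\<psi> a = proj p h 1 (\<beta>\<^sub>0 a)" for a
  define \<pi> where "\<pi> = [p] \<cdot>\<^bsub>UP \<Z>\<^esub> \<one>\<^bsub>UP \<Z>\<^esub>"
  have \<pi>: "\<pi> \<in> carrier (UP \<Z>)" by (simp add: \<pi>_def)
  have \<sigma>_hom: "ring_hom_cring (UP \<Z>) ?Q \<sigma>"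
  proof (rule ring_hom_cringI[OF ZP.UP_cring \<theta>.S.is_cring], rule ring_hom_memI)
    fix a b assume ab: "a \<in> carrier (UP \<Z>)" "b \<in> carrier (UP \<Z>)"
    show "\<sigma> (a \<otimes>\<^bsub>UP \<Z>\<^esub> b) = \<sigma> a \<otimes>\<^bsub>?Q\<^esub> \<sigma> b"
      unfolding \<sigma>_def \<mu>.hom_mult[OF ab]
      by (rule \<theta>.hom_mult[OF \<mu>.hom_closed[OF ab(1)] \<mu>.hom_closed[OF ab(2)]])
    show "\<sigma> (a \<oplus>\<^bsub>UP \<Z>\<^esub> b) = \<sigma> a \<oplus>\<^bsub>?Q\<^esub> \<sigma> b"
      unfolding \<sigma>_def \<mu>.hom_add[OF ab]
      by (rule \<theta>.hom_add[OF \<mu>.hom_closed[OF ab(1)] \<mu>.hom_closed[OF ab(2)]])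
  next
    show "\<sigma> \<one>\<^bsub>UP \<Z>\<^esub> = \<one>\<^bsub>?Q\<^esub>" unfolding \<sigma>_def \<mu>.hom_one by (rule \<theta>.hom_one)
  next
    fix a assume "a \<in> carrier (UP \<Z>)"
    then show "\<sigma> a \<in> carrier ?Q" unfolding \<sigma>_def by (intro \<theta>.hom_closed \<mu>.hom_closed)
  qed
  have \<psi>_hom: "ring_hom_cring (UP \<Z>) (L 1) \<psi>"
  proof (rule ring_hom_cringI[OF ZP.UP_cring L_cring], rule ring_hom_memI)
    fix a b assume ab: "a \<in> carrier (UP \<Z>)" "b \<in> carrier (UP \<Z>)"
    show "\<psi> (a \<otimes>\<^bsub>UP \<Z>\<^esub> b) = \<psi> a \<otimes>\<^bsub>L 1\<^esub> \<psi> b"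
      unfolding \<psi>_def \<beta>\<^sub>0.hom_mult[OF ab]
      by (rule pr.hom_mult[OF \<beta>\<^sub>0.hom_closed[OF ab(1)] \<beta>\<^sub>0.hom_closed[OF ab(2)]])
    show "\<psi> (a \<oplus>\<^bsub>UP \<Z>\<^esub> b) = \<psi> a \<oplus>\<^bsub>L 1\<^esub> \<psi> b"
      unfolding \<psi>_def \<beta>\<^sub>0.hom_add[OF ab]
      by (rule pr.hom_add[OF \<beta>\<^sub>0.hom_closed[OF ab(1)] \<beta>\<^sub>0.hom_closed[OF ab(2)]])
  next
    show "\<psi> \<one>\<^bsub>UP \<Z>\<^esub> = \<one>\<^bsub>L 1\<^esub>" unfolding \<psi>_def \<beta>\<^sub>0.hom_one by (rule pr.hom_one)
  next
    fix a assume "a \<in> carrier (UP \<Z>)"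
    then show "\<psi> a \<in> carrier (L 1)" unfolding \<psi>_def by (intro pr.hom_closed \<beta>\<^sub>0.hom_closed)
  qed
  interpret \<sigma>: ring_hom_cring "UP \<Z>" ?Q \<sigma> by (rule \<sigma>_hom)
  interpret \<psi>: ring_hom_cring "UP \<Z>" "L 1" \<psi> by (rule \<psi>_hom)
  have \<sigma>_\<pi>: "\<sigma> \<pi> = \<zero>\<^bsub>?Q\<^esub>" unfolding \<sigma>_def \<pi>_def \<mu>_p by (rule \<theta>.hom_zero)
  have \<sigma>_h: "\<sigma> h = \<zero>\<^bsub>?Q\<^esub>"
    unfolding \<sigma>_def using FP.P.quotient_zero_iff[OF J \<mu>_h(1)] FP.P.cgenideal_self[OF \<mu>_h(1)] by blast
  have \<psi>_\<pi>: "\<psi> \<pi> = \<zero>\<^bsub>L 1\<^esub>"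
    using \<psi>.hom_nat_one[of p] L_char[of 1] unfolding \<pi>_def by simp
  have "\<beta>\<^sub>0 h = \<zero>\<^bsub>B\<^esub>" using \<beta>\<^sub>0_zero_iff[OF h_closed] ZP.P.cgenideal_self[OF h_closed] by blast
  then have \<psi>_h: "\<psi> h = \<zero>\<^bsub>L 1\<^esub>" unfolding \<psi>_def by (simp only: pr.hom_zero)
  have generate: "\<sigma> a = \<zero>\<^bsub>?Q\<^esub> \<and> \<psi> a = \<zero>\<^bsub>L 1\<^esub>"
    if "c \<in> carrier (UP \<Z>)" "d \<in> carrier (UP \<Z>)" "a = c \<otimes>\<^bsub>UP \<Z>\<^esub> h \<oplus>\<^bsub>UP \<Z>\<^esub> d \<otimes>\<^bsub>UP \<Z>\<^esub> \<pi>" for a c d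
    unfolding that(3) using that(1,2) h_closed \<pi> by (simp add: \<sigma>_\<pi> \<sigma>_h \<psi>_\<pi> \<psi>_h del: One_nat_def)
  have kernels: "\<sigma> a = \<zero>\<^bsub>?Q\<^esub> \<longleftrightarrow> \<psi> a = \<zero>\<^bsub>L 1\<^esub>" if a: "a \<in> carrier (UP \<Z>)" for a
  proof
    assume "\<sigma> a = \<zero>\<^bsub>?Q\<^esub>"
    then have "\<mu> a \<in> PIdl\<^bsub>UP F\<^esub> (\<mu> h)"
      unfolding \<sigma>_def using FP.P.quotient_zero_iff[OF J \<mu>.hom_closed[OF a]] by blast
    then obtain c' where c': "c' \<in> carrier (UP F)" "\<mu> a = c' \<otimes>\<^bsub>UP F\<^esub> \<mu> h"
      unfolding FP.P.mem_PIdl_iff by blast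
    obtain c where c: "c \<in> carrier (UP \<Z>)" "\<mu> c = c'" using \<mu>_surj[OF c'(1)] by blast
    define b where "b = a \<ominus>\<^bsub>UP \<Z>\<^esub> c \<otimes>\<^bsub>UP \<Z>\<^esub> h"
    have b: "b \<in> carrier (UP \<Z>)" using a c(1) h_closed by (simp add: b_def)
    have "\<mu> b = \<zero>\<^bsub>UP F\<^esub>"
      using a c h_closed c' \<mu>_h(1) by (simp add: b_def a_minus_def FP.P.r_neg)
    then have "b \<in> PIdl\<^bsub>UP \<Z>\<^esub> \<pi>" unfolding \<pi>_def by (rule \<mu>_kernel[OF b])
    then obtain d where d: "d \<in> carrier (UP \<Z>)" "b = d \<otimes>\<^bsub>UP \<Z>\<^esub> \<pi>" unfolding ZP.P.mem_PIdl_iff by blast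
    have "a = c \<otimes>\<^bsub>UP \<Z>\<^esub> h \<oplus>\<^bsub>UP \<Z>\<^esub> b" unfolding b_def using a c(1) h_closed by algebra
    then show "\<psi> a = \<zero>\<^bsub>L 1\<^esub>" using generate c(1) d by blast
  next
    assume "\<psi> a = \<zero>\<^bsub>L 1\<^esub>"
    then have "\<beta>\<^sub>0 a \<in> I 1" unfolding \<psi>_def by (rule iffD1[OF proj_zero_iff[OF \<beta>\<^sub>0.hom_closed[OF a]]])
    then obtain d' where d': "d' \<in> carrier B" "\<beta>\<^sub>0 a = d' \<otimes>\<^bsub>B\<^esub> [p] \<cdot>\<^bsub>B\<^esub> \<one>\<^bsub>B\<^esub>"
      unfolding mem_I_iff by auto
    obtain d where d: "d \<in> carrier (UP \<Z>)" "\<beta>\<^sub>0 d = d'" using \<beta>\<^sub>0_surj[OF d'(1)] by blast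
    define b where "b = a \<ominus>\<^bsub>UP \<Z>\<^esub> d \<otimes>\<^bsub>UP \<Z>\<^esub> \<pi>"
    have b: "b \<in> carrier (UP \<Z>)" using a d(1) \<pi> by (simp add: b_def)
    have "\<beta>\<^sub>0 \<pi> = [p] \<cdot>\<^bsub>B\<^esub> \<one>\<^bsub>B\<^esub>" unfolding \<pi>_def by (rule \<beta>\<^sub>0.hom_nat_one)
    then have "\<beta>\<^sub>0 b = \<zero>\<^bsub>B\<^esub>"
      using a d d' \<pi> by (simp add: b_def a_minus_def \<beta>\<^sub>0.S.r_neg)
    then have "b \<in> PIdl\<^bsub>UP \<Z>\<^esub> h" using \<beta>\<^sub>0_zero_iff[OF b] by blast
    then obtain c where c: "c \<in> carrier (UP \<Z>)" "b = c \<otimes>\<^bsub>UP \<Z>\<^esub> h" unfolding ZP.P.mem_PIdl_iff by blast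
    have "a = b \<oplus>\<^bsub>UP \<Z>\<^esub> d \<otimes>\<^bsub>UP \<Z>\<^esub> \<pi>" unfolding b_def using a d(1) \<pi> by algebra
    then show "\<sigma> a = \<zero>\<^bsub>?Q\<^esub>" using generate c d(1) by blast
  qed
  have \<sigma>_surj: "\<exists>x\<in>carrier (UP \<Z>). \<sigma> x = y" if "y \<in> carrier ?Q" for y
    using FP.P.quotient_surj[OF J that] \<mu>_surj unfolding \<sigma>_def by metis
  have \<psi>_surj: "\<exists>x\<in>carrier (UP \<Z>). \<psi> x = y" if "y \<in> carrier (L 1)" for y
    using proj_surj[OF that] \<beta>\<^sub>0_surj unfolding \<psi>_def by metis
  have Q: "field ?Q" "finite (carrier ?Q)"
    using FP.quotient_irreducible_field[OF \<mu>_h(1,2)]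
      FP.quotient_finite[OF ZFact_prime_field(2)[OF p] \<mu>_h(1,3)] .
  show "field (L 1)" "finite (carrier (L 1))"
    using field_finite_of_same_kernel[OF \<sigma>_hom \<psi>_hom \<sigma>_surj \<psi>_surj kernels Q] by blast+
qed


section \<open>Polynomials over the tower\<close>

lemma residue_tower_UP:
  assumes e: "1 < e"
  shows "residue_tower (UP (L e)) (UP (L 1)) (UP (L (e - 1)))
    (up_map (bar p h)) (up_map (red (e - 1))) p e"
proof -
  have e1: "1 \<le> e" "e - 1 \<le> e" using e by simp_all
  interpret Le: cring "L e" by (rule L_cring)
  interpret A: UP_cring "L e" "UP (L e)" by (intro UP_cring.intro L_cring)
  interpret K: field "L 1" by (rule residue_field)
  interpret D: UP_field "L 1" "UP (L 1)" by unfold_locales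
  interpret b: ring_hom_cring "L e" "L 1" "bar p h" unfolding bar_eq_red by (rule red_hom[OF e1(1)])
  interpret r: ring_hom_cring "L e" "L (e - 1)" "red (e - 1)" by (rule red_hom[OF e1(2)])
  interpret \<rho>: ring_hom_cring "UP (L e)" "UP (L (e - 1))" "up_map (red (e - 1))"
    by (rule r.up_map_ring_hom)
  let ?\<pi> = "[p] \<cdot>\<^bsub>UP (L e)\<^esub> \<one>\<^bsub>UP (L e)\<^esub>"
  have \<pi>: "?\<pi> \<in> carrier (UP (L e))" by simp
  have zero: "[(p ^ i)] \<cdot>\<^bsub>UP (L i)\<^esub> \<one>\<^bsub>UP (L i)\<^esub> = \<zero>\<^bsub>UP (L i)\<^esub>" for i
  proof -
    interpret Li: cring "L i" by (rule L_cring)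
    interpret i: UP_cring "L i" "UP (L i)" by (intro UP_cring.intro L_cring)
    have "([(p ^ i)] \<cdot>\<^bsub>UP (L i)\<^esub> \<one>\<^bsub>UP (L i)\<^esub> \<otimes>\<^bsub>UP (L i)\<^esub> \<one>\<^bsub>UP (L i)\<^esub>) j = \<zero>\<^bsub>L i\<^esub>" for j
      unfolding i.nat_one_coeff_mult[OF i.P.one_closed] L_char
      by (rule Li.l_null[OF UP_closed[OF i.P.one_closed]])
    then have "[(p ^ i)] \<cdot>\<^bsub>UP (L i)\<^esub> \<one>\<^bsub>UP (L i)\<^esub> \<otimes>\<^bsub>UP (L i)\<^esub> \<one>\<^bsub>UP (L i)\<^esub> = \<zero>\<^bsub>UP (L i)\<^esub>"
      by (intro ext) (simp only: UP_zero_eq)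
    then show ?thesis by simp
  qed
  have char_D: "[p] \<cdot>\<^bsub>UP (L 1)\<^esub> \<one>\<^bsub>UP (L 1)\<^esub> = \<zero>\<^bsub>UP (L 1)\<^esub>" using zero[of 1] by simp
  have \<rho>_kernel: "up_map (red (e - 1)) a = \<zero>\<^bsub>UP (L (e - 1))\<^esub> \<longleftrightarrow>
    ?\<pi> \<otimes>\<^bsub>UP (L e)\<^esub> a = \<zero>\<^bsub>UP (L e)\<^esub>" if a: "a \<in> carrier (UP (L e))" for a
  proof -
    have "up_map (red (e - 1)) a = \<zero>\<^bsub>UP (L (e - 1))\<^esub> \<longleftrightarrow> (\<forall>j. red (e - 1) (a j) = \<zero>\<^bsub>L (e - 1)\<^esub>)"
      unfolding up_map_def UP_zero_eq fun_eq_iff ..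
    also have "\<dots> \<longleftrightarrow> (\<forall>j. [p] \<cdot>\<^bsub>L e\<^esub> \<one>\<^bsub>L e\<^esub> \<otimes>\<^bsub>L e\<^esub> a j = \<zero>\<^bsub>L e\<^esub>)"
      using red_zero_iff[OF e1(1) UP_closed[OF a]] by simp
    also have "\<dots> \<longleftrightarrow> ?\<pi> \<otimes>\<^bsub>UP (L e)\<^esub> a = \<zero>\<^bsub>UP (L e)\<^esub>"
      unfolding A.nat_one_coeff_mult[OF a, symmetric] UP_zero_eq fun_eq_iff ..
    finally show ?thesis .
  qed
  show ?thesis
  proof (intro residue_tower.intro residue_tower_axioms.intro)
    show "cring (UP (L e))" by (rule A.UP_cring)
    show "domain (UP (L 1))" by (rule D.UP_domain)
    show "cring (UP (L (e - 1)))" by (rule \<rho>.S.is_cring)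
    show "ring_hom_cring (UP (L e)) (UP (L 1)) (up_map (bar p h))" by (rule b.up_map_ring_hom)
    show "ring_hom_cring (UP (L e)) (UP (L (e - 1))) (up_map (red (e - 1)))" by (rule r.up_map_ring_hom)
    show "\<exists>x\<in>carrier (UP (L e)). up_map (bar p h) x = y" if "y \<in> carrier (UP (L 1))" for y
      using b.up_map_surj[OF _ that] red_surj[OF e1(1)] unfolding bar_eq_red by blast
    show "\<exists>x\<in>carrier (UP (L e)). up_map (red (e - 1)) x = y" if "y \<in> carrier (UP (L (e - 1)))" for y
      using r.up_map_surj[OF _ that] red_surj[OF e1(2)] by blast
    show "?\<pi> [^]\<^bsub>UP (L e)\<^esub> e = \<zero>\<^bsub>UP (L e)\<^esub>"
      unfolding A.P.nat_one_power by (rule zero)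
    show "a \<in> PIdl\<^bsub>UP (L e)\<^esub> ?\<pi>"
      if "a \<in> carrier (UP (L e))" "up_map (bar p h) a = \<zero>\<^bsub>UP (L 1)\<^esub>" for a
      using red_kernel[OF e1(1)] by (intro b.up_map_kernel[OF _ that]) (simp add: bar_eq_red)
    show "a \<in> PIdl\<^bsub>UP (L e)\<^esub> (?\<pi> [^]\<^bsub>UP (L e)\<^esub> (e - 1))"
      if a: "a \<in> carrier (UP (L e))" and z: "?\<pi> \<otimes>\<^bsub>UP (L e)\<^esub> a = \<zero>\<^bsub>UP (L e)\<^esub>" for a
      unfolding A.P.nat_one_power
      by (rule r.up_map_kernel[OF red_kernel[OF e1(2)] a]) (simp_all only: \<rho>_kernel[OF a] z)
  qed (use p e char_D \<rho>_kernel in auto)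
qed

end

section \<open>Cycle lengths over consecutive levels\<close>



theorem theorem9:
  fixes p e r :: nat
    and h :: "nat \<Rightarrow> int"
    and f m :: "nat \<Rightarrow> (nat \<Rightarrow> int) set"
    and m1 m2 :: "nat \<Rightarrow> (nat \<Rightarrow> int) set set"
    and g G :: "nat \<Rightarrow> nat \<Rightarrow> (nat \<Rightarrow> int) set set"
    and k :: "nat \<Rightarrow> nat"
  assumes "Factorial_Ring.prime p"
    and "up_monic \<Z> h" and "1 \<le> deg \<Z> h" and "irreducible_mod p h"
    and "1 < e"
    and "up_monic (base_ring h) f" and "up_monic (base_ring h) m"
    and "1 \<le> deg (base_ring h) f" and "deg (base_ring h) f < deg (base_ring h) m"
    and "is_decomposition (level_poly p h e)
           (up_map (proj p h e) f) (up_map (proj p h e) m) m1 m2"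
    and "\<And>i. i \<in> {1..r} \<Longrightarrow> g i \<in> carrier (level_poly p h e)"
    and "\<And>i j. i \<in> {1..r} \<Longrightarrow> j \<in> {1..r} \<Longrightarrow> i \<noteq> j \<Longrightarrow>
           gen_coprime (level_poly p h e) (g i) (g j)"
    and "m1 = (\<Otimes>\<^bsub>level_poly p h e\<^esub>i\<in>{1..r}. g i)"
    and "\<And>i. i \<in> {1..r} \<Longrightarrow> G i \<in> carrier (level_poly p h 1)"
    and "\<And>i. i \<in> {1..r} \<Longrightarrow> ring_irreducible\<^bsub>level_poly p h 1\<^esub> (G i)"
    and "\<And>i. i \<in> {1..r} \<Longrightarrow> 1 \<le> k i"
    and "\<And>i. i \<in> {1..r} \<Longrightarrow> up_map (bar p h) (g i) = G i [^]\<^bsub>level_poly p h 1\<^esub> k i"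
  shows "Gamma_cycle_lengths p h e f m =
           Gamma_cycle_lengths p h (e - 1) f m \<union>
           big_lcm_prod (\<lambda>i. {1, mod_order (level_poly p h e) (up_map (proj p h e) f) (g i)}) r"
proof -
  let ?L = "level_ring p h"
  interpret galois_tower p h
    using assms(1,2,4) by (intro galois_tower.intro) (auto simp: up_monic_def)
  interpret T: residue_tower "UP (?L e)" "UP (?L 1)" "UP (?L (e - 1))"
    "up_map (bar p h)" "up_map (red (e - 1))" p e "[p] \<cdot>\<^bsub>UP (?L e)\<^esub> \<one>\<^bsub>UP (?L e)\<^esub>"
    using residue_tower_UP[OF assms(5)] by simp_all
  interpret K: field "?L 1" by (rule residue_field)
  interpret KP: UP_field "?L 1" "UP (?L 1)" by unfold_locales
  have closed: "up_map (proj p h e) a \<in> carrier (UP (?L e))" if "a \<in> carrier (UP (base_ring h))" for a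
    using ring_hom_closed[OF ring_hom_cring.homh[OF ring_hom_cring.up_map_ring_hom[OF proj_hom]] that] .
  have bar_proj: "up_map (bar p h) (up_map (proj p h e) a) = up_map (proj p h 1) a"
    and red_proj': "up_map (red (e - 1)) (up_map (proj p h e) a) = up_map (proj p h (e - 1)) a"
    if "a \<in> carrier (UP (base_ring h))" for a
    using red_proj[of 1 e] red_proj[of "e - 1" e] UP_closed[OF that] assms(5)
    unfolding bar_eq_red up_map_def by auto
  have f: "f \<in> carrier (UP (base_ring h))" and m: "m \<in> carrier (UP (base_ring h))"
    using assms(6,7) by (auto simp: up_monic_def)
  have "up_map (proj p h 1) m \<noteq> \<zero>\<^bsub>UP (?L 1)\<^esub>"
  proof
    assume "up_map (proj p h 1) m = \<zero>\<^bsub>UP (?L 1)\<^esub>"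
    then have "proj p h 1 (m (deg (base_ring h) m)) = \<zero>\<^bsub>?L 1\<^esub>"
      unfolding up_map_def UP_zero_eq by (rule fun_cong)
    moreover have "m (deg (base_ring h) m) = \<one>\<^bsub>base_ring h\<^esub>"
      using assms(7) coeff_UP_eq[OF m] unfolding up_monic_def by simp
    ultimately show False
      using ring_hom_one[OF ring_hom_cring.homh[OF proj_hom], of 1] K.one_not_zero by simp
  qed
  then have nonzero: "up_map (bar p h) (up_map (proj p h e) m) \<noteq> \<zero>\<^bsub>UP (?L 1)\<^esub>"
    using bar_proj[OF m] by simp
  have G: "G i \<noteq> \<zero>\<^bsub>UP (?L 1)\<^esub>" "field (UP (?L 1) Quot PIdl\<^bsub>UP (?L 1)\<^esub> (G i))"
    "finite (carrier (UP (?L 1) Quot PIdl\<^bsub>UP (?L 1)\<^esub> (G i)))" if i: "i \<in> {1..r}" for i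
  proof -
    show nz: "G i \<noteq> \<zero>\<^bsub>UP (?L 1)\<^esub>" using assms(15)[OF i] by (simp add: ring_irreducible_def)
    show "field (UP (?L 1) Quot PIdl\<^bsub>UP (?L 1)\<^esub> (G i))"
      by (rule KP.quotient_irreducible_field[OF assms(14,15)[OF i]])
    show "finite (carrier (UP (?L 1) Quot PIdl\<^bsub>UP (?L 1)\<^esub> (G i)))"
      by (rule KP.quotient_finite[OF residue_field(2) assms(14)[OF i] nz])
  qed
  show ?thesis
    using T.cycle_lengths_step[OF closed[OF f] closed[OF m] nonzero assms(10,13) assms(11,12,14,16,17) G]
    unfolding Gamma_cycle_lengths_def red_proj'[OF f] red_proj'[OF m] .
qed

end
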